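(* Let $a\in\mathbb{N}$, $q_0=2^a$, $q=2q_0^2$, and let $\mathcal{S}_q$ be the Suzuki curve (the smooth projective curve with affine model $y^q+y=x^{q_0}(x^q+x)$). Then there are linear locally recoverable codes with availability $2$ and locality $(q-1,q-2)$, obtained by evaluating a space of rational functions on $\mathcal{S}_q$ at a set of rational points of $\mathcal{S}_q$: (1) over $\mathbb{F}_q$, with length $n=q(q-1)$ and dimension $k=(q-1)(q-2)$; and (2) over $\mathbb{F}_{q^4}$, with length $n=q(q-1)(q^2+2qq_0+q+1)$ and dimension $k=(q-1)(q-2)(q^2+2qq_0+q+1)$.
   Context: A linear code of length $n$ has availability $2$ and locality $(r_1,r_2)$ if each position $i$ has two disjoint sets $A_{i1},A_{i2}\subseteq[n]\setminus\{i\}$ with $|A_{ij}|=r_j$ such that the $i$-th entry of every codeword is a function of its entries on $A_{ij}$, for $j=1,2$. *)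

theory Defs
  imports
    "HOL-Algebra.Subrings"
    "HOL-Computational_Algebra.Factorial_Ring"
    "HOL-Computational_Algebra.Polynomial"
    "HOL-Library.Cardinality"
    "HOL-Library.Function_Algebras"
    "HOL-Library.FuncSet"
begin

section \<open>Function field of an affine plane curve\<close>

text \<open>
  The type \<^typ>\<open>'k poly poly\<close> stands for \<open>K[X,Y]\<close>, with \<open>Y\<close> the outer variable.
  The function field of the irreducible curve \<open>f = 0\<close> is the field of fractions of
  \<open>K[X,Y]/(f)\<close>. Its elements are the classes of fractions \<open>g/h\<close> with \<open>f\<close> not dividing \<open>h\<close>,
  where \<open>g/h\<close> and \<open>g'/h'\<close> are identified iff \<open>f\<close> divides \<open>g h' - g' h\<close>.
\<close>

definition fraction_rel ::
  "'k::field poly poly \<Rightarrow> (('k poly poly \<times> 'k poly poly) \<times> ('k poly poly \<times> 'k poly poly)) set" where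
  "fraction_rel f =
    {((g, h), (g', h')). \<not> f dvd h \<and> \<not> f dvd h' \<and> f dvd g * h' - g' * h}"

definition fraction ::
  "'k::field poly poly \<Rightarrow> 'k poly poly \<Rightarrow> 'k poly poly \<Rightarrow> ('k poly poly \<times> 'k poly poly) set" where
  "fraction f g h = fraction_rel f `` {(g, h)}"

definition function_field ::
  "'k::field poly poly \<Rightarrow> ('k poly poly \<times> 'k poly poly) set ring" where
  "function_field f =
    \<lparr>carrier = {fraction f g h | g h. \<not> f dvd h},
     monoid.mult = (\<lambda>A B. \<Union>(g, h)\<in>A. \<Union>(g', h')\<in>B. fraction f (g * g') (h * h')),
     one = fraction f 1 1,
     zero = fraction f 0 1,
     add = (\<lambda>A B. \<Union>(g, h)\<in>A. \<Union>(g', h')\<in>B. fraction f (g * h' + g' * h) (h * h'))\<rparr>"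

definition const_fun ::
  "'k::field poly poly \<Rightarrow> 'k \<Rightarrow> ('k poly poly \<times> 'k poly poly) set" where
  "const_fun f c = fraction f [:[:c:]:] 1"

lemma equiv_fraction_rel:
  assumes "prime_elem f"
  shows "equiv {(g, h). \<not> f dvd h} (fraction_rel f)"
proof (rule equivI)
  show "fraction_rel f \<subseteq> {(g, h). \<not> f dvd h} \<times> {(g, h). \<not> f dvd h}"
    by (auto simp: fraction_rel_def)
  show "refl_on {(g, h). \<not> f dvd h} (fraction_rel f)"
    by (auto simp: refl_on_def fraction_rel_def)
  show "sym (fraction_rel f)"
    by (auto simp: sym_def fraction_rel_def) (metis dvd_minus_iff minus_diff_eq)+
  show "trans (fraction_rel f)"
  proof (rule transI, clarsimp simp: fraction_rel_def)
    fix g h g' h' g'' h''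
    assume h': "\<not> f dvd h'" and 1: "f dvd g * h' - g' * h" and 2: "f dvd g' * h'' - g'' * h'"
    have "f dvd (g * h' - g' * h) * h'' + (g' * h'' - g'' * h') * h"
      using 1 2 by (intro dvd_add dvd_mult2)
    also have "\<dots> = h' * (g * h'' - g'' * h)" by (simp add: algebra_simps)
    finally show "f dvd g * h'' - g'' * h"
      using h' assms by (simp add: prime_elem_dvd_mult_iff)
  qed
qed

lemma fraction_eq_iff:
  assumes "prime_elem f" "\<not> f dvd h" "\<not> f dvd h'"
  shows "fraction f g h = fraction f g' h' \<longleftrightarrow> f dvd g * h' - g' * h"
  using eq_equiv_class_iff[OF equiv_fraction_rel[OF assms(1)], of "(g,h)" "(g',h')"] assms
  by (auto simp: fraction_def fraction_rel_def)

lemma in_fraction: "(g', h') \<in> fraction f g h \<longleftrightarrow> \<not> f dvd h \<and> \<not> f dvd h' \<and> f dvd g * h' - g' * h"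
  by (auto simp: fraction_def fraction_rel_def)

lemma function_field_mult:
  assumes f: "prime_elem f" and h: "\<not> f dvd h" "\<not> f dvd k"
  shows "fraction f g h \<otimes>\<^bsub>function_field f\<^esub> fraction f e k = fraction f (g * e) (h * k)"
proof -
  have *: "fraction f (g' * e') (h' * k') = fraction f (g * e) (h * k)"
    if "(g',h') \<in> fraction f g h" "(e',k') \<in> fraction f e k" for g' h' e' k'
  proof -
    from that have d: "\<not> f dvd h'" "\<not> f dvd k'" "f dvd g * h' - g' * h" "f dvd e * k' - e' * k"
      by (auto simp: in_fraction)
    have "f dvd (g * h' - g' * h) * (e * k') + (e * k' - e' * k) * (g' * h)"
      using d by (intro dvd_add dvd_mult2)
    also have "\<dots> = (g * e) * (h' * k') - (g' * e') * (h * k)" by (simp add: algebra_simps)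
    finally show ?thesis using d h f
      by (subst eq_commute, subst fraction_eq_iff) (auto simp: prime_elem_dvd_mult_iff)
  qed
  have "(g,h) \<in> fraction f g h" "(e,k) \<in> fraction f e k" using h by (auto simp: in_fraction)
  note mem = this
  have "(\<Union>y\<in>fraction f e k. case y of (e', k') \<Rightarrow> fraction f (g' * e') (h' * k')) = fraction f (g * e) (h * k)"
    if "(g', h') \<in> fraction f g h" for g' h'
    using mem(2) by (rule UN_constant_eq) (auto simp only: split_paired_all prod.case *[OF that])
  then have "(\<Union>x\<in>fraction f g h. case x of (g', h') \<Rightarrow>
      \<Union>y\<in>fraction f e k. case y of (e', k') \<Rightarrow> fraction f (g' * e') (h' * k')) = fraction f (g * e) (h * k)"
    by (intro UN_constant_eq[OF mem(1)]) (auto simp only: split_paired_all prod.case)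
  then show ?thesis by (simp add: function_field_def)
qed

lemma function_field_add:
  assumes f: "prime_elem f" and h: "\<not> f dvd h" "\<not> f dvd k"
  shows "fraction f g h \<oplus>\<^bsub>function_field f\<^esub> fraction f e k = fraction f (g * k + e * h) (h * k)"
proof -
  have *: "fraction f (g' * k' + e' * h') (h' * k') = fraction f (g * k + e * h) (h * k)"
    if "(g',h') \<in> fraction f g h" "(e',k') \<in> fraction f e k" for g' h' e' k'
  proof -
    from that have d: "\<not> f dvd h'" "\<not> f dvd k'" "f dvd g * h' - g' * h" "f dvd e * k' - e' * k"
      by (auto simp: in_fraction)
    have "f dvd (g * h' - g' * h) * (k * k') + (e * k' - e' * k) * (h * h')"
      using d by (intro dvd_add dvd_mult2)
    also have "\<dots> = (g * k + e * h) * (h' * k') - (g' * k' + e' * h') * (h * k)" by (simp add: algebra_simps)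
    finally show ?thesis using d h f
      by (subst eq_commute, subst fraction_eq_iff) (auto simp: prime_elem_dvd_mult_iff)
  qed
  have "(g,h) \<in> fraction f g h" "(e,k) \<in> fraction f e k" using h by (auto simp: in_fraction)
  note mem = this
  have "(\<Union>y\<in>fraction f e k. case y of (e', k') \<Rightarrow> fraction f (g' * k' + e' * h') (h' * k')) = fraction f (g * k + e * h) (h * k)"
    if "(g', h') \<in> fraction f g h" for g' h'
    using mem(2) by (rule UN_constant_eq) (auto simp only: split_paired_all prod.case *[OF that])
  then have "(\<Union>x\<in>fraction f g h. case x of (g', h') \<Rightarrow>
      \<Union>y\<in>fraction f e k. case y of (e', k') \<Rightarrow> fraction f (g' * k' + e' * h') (h' * k')) = fraction f (g * k + e * h) (h * k)"
    by (intro UN_constant_eq[OF mem(1)]) (auto simp only: split_paired_all prod.case)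
  then show ?thesis by (simp add: function_field_def)
qed

lemma field_function_field:
  assumes f: "prime_elem f"
  shows "field (function_field f)"
proof -
  let ?F = "function_field f"
  have n1: "\<not> f dvd 1" using f by (auto simp: prime_elem_def)
  have car: "carrier ?F = {fraction f g h | g h. \<not> f dvd h}" and
    one: "\<one>\<^bsub>?F\<^esub> = fraction f 1 1" and zero: "\<zero>\<^bsub>?F\<^esub> = fraction f 0 1"
    by (simp_all add: function_field_def)
  note S = one zero function_field_mult[OF f] function_field_add[OF f] fraction_eq_iff[OF f]
    prime_elem_dvd_mult_iff[OF f] n1
  have I: "fraction f g h \<in> carrier ?F" if "\<not> f dvd h" for g h using that by (auto simp: car)
  have E: "\<exists>g h. x = fraction f g h \<and> \<not> f dvd h" if "x \<in> carrier ?F" for x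
    using that by (auto simp: car)
  have neg: "\<exists>y\<in>carrier ?F. y \<oplus>\<^bsub>?F\<^esub> x = \<zero>\<^bsub>?F\<^esub>" if xc: "x \<in> carrier ?F" for x
  proof -
    obtain g h where x: "x = fraction f g h" "\<not> f dvd h" using E[OF xc] by auto
    show ?thesis by (rule bexI[of _ "fraction f (-g) h"]) (use x in \<open>auto simp: S I\<close>)
  qed
  have ab: "abelian_group ?F"
  proof (rule abelian_groupI)
    show "\<exists>y\<in>carrier ?F. y \<oplus>\<^bsub>?F\<^esub> x = \<zero>\<^bsub>?F\<^esub>" if "x \<in> carrier ?F" for x
      by (rule neg[OF that])
  qed (auto dest!: E simp: S I algebra_simps)
  have cm: "comm_monoid ?F"
    by (rule comm_monoidI) (auto dest!: E simp: S I algebra_simps)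
  have cr: "cring ?F"
    by (rule cringI[OF ab cm]) (clarsimp dest!: E simp: S I algebra_simps)
  show ?thesis
  proof (rule cring.cring_fieldI2[OF cr])
    show "\<zero>\<^bsub>?F\<^esub> \<noteq> \<one>\<^bsub>?F\<^esub>" by (simp add: S)
    fix x assume xc: "x \<in> carrier ?F" "x \<noteq> \<zero>\<^bsub>?F\<^esub>"
    obtain g h where x: "x = fraction f g h" "\<not> f dvd h" using E[OF xc(1)] by auto
    with xc(2) have "\<not> f dvd g" by (simp add: S)
    note x = x this
    show "\<exists>y\<in>carrier ?F. x \<otimes>\<^bsub>?F\<^esub> y = \<one>\<^bsub>?F\<^esub>"
      by (rule bexI[of _ "fraction f h g"]) (use x in \<open>auto simp: S I\<close>)
  qed
qed


section \<open>Rational points of the smooth projective model\<close>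

text \<open>
  The closed points of the smooth projective curve with function field \<open>F/K\<close> are the places of
  \<open>F/K\<close>, each given by its valuation ring; the \<open>K\<close>-rational points are those with residue field
  \<open>K\<close>. The map \<open>\<kappa>\<close> is the embedding of the field of constants \<open>K\<close> into \<open>F\<close>.
\<close>

definition valuation_ring :: "'f ring \<Rightarrow> ('k \<Rightarrow> 'f) \<Rightarrow> 'f set \<Rightarrow> bool" where
  "valuation_ring F \<kappa> V \<longleftrightarrow>
     subring V F \<and> range \<kappa> \<subset> V \<and> V \<subset> carrier F \<and>
     (\<forall>z \<in> carrier F - {\<zero>\<^bsub>F\<^esub>}. z \<in> V \<or> inv\<^bsub>F\<^esub> z \<in> V)"

definition maximal_ideal_of :: "'f ring \<Rightarrow> 'f set \<Rightarrow> 'f set" where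
  "maximal_ideal_of F V = {z \<in> V. z = \<zero>\<^bsub>F\<^esub> \<or> inv\<^bsub>F\<^esub> z \<notin> V}"

definition rational_point :: "'f ring \<Rightarrow> ('k \<Rightarrow> 'f) \<Rightarrow> 'f set \<Rightarrow> bool" where
  "rational_point F \<kappa> V \<longleftrightarrow>
     valuation_ring F \<kappa> V \<and> (\<forall>z \<in> V. \<exists>c. z \<ominus>\<^bsub>F\<^esub> \<kappa> c \<in> maximal_ideal_of F V)"

text \<open>The value of a function regular at a rational point, i.e. lying in its valuation ring.\<close>

definition value_at :: "'f ring \<Rightarrow> ('k \<Rightarrow> 'f) \<Rightarrow> 'f set \<Rightarrow> 'f \<Rightarrow> 'k" where
  "value_at F \<kappa> V z = (THE c. z \<ominus>\<^bsub>F\<^esub> \<kappa> c \<in> maximal_ideal_of F V)"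

definition function_space :: "'f ring \<Rightarrow> ('k \<Rightarrow> 'f) \<Rightarrow> 'f set \<Rightarrow> bool" where
  "function_space F \<kappa> L \<longleftrightarrow>
     subgroup L (add_monoid F) \<and> (\<forall>c. \<forall>z \<in> L. \<kappa> c \<otimes>\<^bsub>F\<^esub> z \<in> L)"


section \<open>Linear codes\<close>

text \<open>
  A word of length \<open>n\<close> over \<open>K\<close> is a function on \<^typ>\<open>nat\<close> that vanishes outside \<open>{..<n}\<close>.
\<close>

definition scale_word :: "'k::field \<Rightarrow> (nat \<Rightarrow> 'k) \<Rightarrow> nat \<Rightarrow> 'k" where
  "scale_word c w = (\<lambda>i. c * w i)"

global_interpretation word: vector_space scale_word
  by unfold_locales (auto simp: scale_word_def fun_eq_iff algebra_simps)

definition linear_code :: "nat \<Rightarrow> (nat \<Rightarrow> 'k::field) set \<Rightarrow> bool" where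
  "linear_code n C \<longleftrightarrow> word.subspace C \<and> (\<forall>w \<in> C. \<forall>i \<ge> n. w i = 0)"

definition recovery_set :: "(nat \<Rightarrow> 'k) set \<Rightarrow> nat \<Rightarrow> nat set \<Rightarrow> bool" where
  "recovery_set C i A \<longleftrightarrow> (\<exists>\<phi>. \<forall>w \<in> C. w i = \<phi> (restrict w A))"

definition availability2_locality :: "nat \<Rightarrow> (nat \<Rightarrow> 'k) set \<Rightarrow> nat \<Rightarrow> nat \<Rightarrow> bool" where
  "availability2_locality n C r\<^sub>1 r\<^sub>2 \<longleftrightarrow>
     (\<forall>i < n. \<exists>A\<^sub>1 A\<^sub>2.
        A\<^sub>1 \<subseteq> {..<n} - {i} \<and> A\<^sub>2 \<subseteq> {..<n} - {i} \<and> A\<^sub>1 \<inter> A\<^sub>2 = {} \<and>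
        card A\<^sub>1 = r\<^sub>1 \<and> card A\<^sub>2 = r\<^sub>2 \<and>
        recovery_set C i A\<^sub>1 \<and> recovery_set C i A\<^sub>2)"

definition evaluation_code ::
  "'f ring \<Rightarrow> ('k::field \<Rightarrow> 'f) \<Rightarrow> nat \<Rightarrow> (nat \<Rightarrow> 'f set) \<Rightarrow> 'f set \<Rightarrow> (nat \<Rightarrow> 'k) set" where
  "evaluation_code F \<kappa> n P L =
     (\<lambda>z i. if i < n then value_at F \<kappa> (P i) z else 0) ` L"

definition is_evaluation_code :: "'f ring \<Rightarrow> ('k::field \<Rightarrow> 'f) \<Rightarrow> nat \<Rightarrow> (nat \<Rightarrow> 'k) set \<Rightarrow> bool" where
  "is_evaluation_code F \<kappa> n C \<longleftrightarrow>
     (\<exists>P L. inj_on P {..<n} \<and> (\<forall>i < n. rational_point F \<kappa> (P i)) \<and>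
        function_space F \<kappa> L \<and> (\<forall>i < n. L \<subseteq> P i) \<and>
        C = evaluation_code F \<kappa> n P L)"


section \<open>The Suzuki curve\<close>

definition suzuki_poly :: "nat \<Rightarrow> nat \<Rightarrow> 'k::field poly poly" where
  "suzuki_poly q0 q =
     monom 1 q + monom 1 1 - [:monom 1 q0 * (monom 1 q + monom 1 1):]"

definition suzuki_evaluation_code :: "nat \<Rightarrow> nat \<Rightarrow> nat \<Rightarrow> (nat \<Rightarrow> 'k::field) set \<Rightarrow> bool" where
  "suzuki_evaluation_code q0 q n C \<longleftrightarrow>
     is_evaluation_code (function_field (suzuki_poly q0 q)) (const_fun (suzuki_poly q0 q)) n C"

end

theory Submission
  imports Defs "HOL-Number_Theory.Gauss" "HOL-Computational_Algebra.Polynomial_FPS"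
begin

text \<open>
  Let \<open>F x = x^q0 (x^q + x)\<close>. The group of maps \<open>(x, y) \<mapsto> (z x, z^(q0+1) y + b)\<close> with \<open>z\<close>, \<open>b\<close> in
  \<open>F_q\<close> and \<open>z \<noteq> 0\<close> acts freely on the affine points with \<open>x \<noteq> 0\<close>. The code consists of the values
  at all of these points of the polynomials spanned by the monomials \<open>x^i y^j\<close> with \<open>j \<le> q - 2\<close>, \<open>i\<close>
  smaller than the number of abscissas, and \<open>i + (q0 + 1) j\<close> not divisible by \<open>q - 1\<close>. One recovers
  along a fibre of \<open>x\<close> by interpolation in \<open>y\<close>, and along an orbit of the torus because the values on
  it sum to zero.

  The points are counted with the quadratic form \<open>Tr (F x)\<close> on \<open>F_(q^4)\<close> over \<open>F_2\<close>. Its radical has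
  \<open>2 q\<close> elements and the form vanishes there, so the exponential sum is \<open>\<plusminus> 2 q0 q^2\<close>. The sign is found by
  descending to the subfields of degree \<open>4 d\<close> with \<open>d\<close> dividing \<open>log_2 q\<close>: a Galois orbit argument gives
  a congruence modulo each prime \<open>p\<close> between the sums for \<open>d p\<close> and \<open>d\<close>, and \<open>2^((p-1)/2)\<close> modulo \<open>p\<close> is
  known; the descent ends in \<open>F_16\<close>.

  For the places, a point \<open>(x0, y0)\<close> gives a homomorphism from \<open>K[X, Y]\<close> to \<open>K[[t]]\<close> with
  \<open>X \<mapsto> x0 + t\<close>, and \<open>Y\<close> mapped to the power series solution through \<open>y0\<close>. Its kernel is generated by
  the equation of the curve, which proves irreducibility, and the pullback of \<open>K[[t]]\<close> is the
  valuation ring. If the kernel were larger, the Artin-Schreier extension would contain a trace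
  \<open>Tr (c Y)\<close> that is a polynomial in \<open>X\<close>; comparing the coefficients at \<open>2^i (2 q0 + 1)\<close> shows that this is
  impossible.
\<close>

unbundle fps_syntax

section \<open>Fields of characteristic two\<close>

lemma add_self_char2:
  fixes x :: "'a::comm_ring_1"
  assumes "(2::'a) = 0"
  shows "x + x = 0"
  using assms by (metis mult_2 mult_zero_left)

lemma minus_char2:
  fixes x y :: "'a::comm_ring_1"
  assumes "(2::'a) = 0"
  shows "- x = x" "x - y = x + y"
proof -
  show *: "- x = x" for x :: 'a using minus_unique[OF add_self_char2[OF assms, of x]] .
  show "x - y = x + y" by (simp only: diff_conv_add_uminus *)
qed

lemma frobenius_add:
  fixes x y :: "'a::comm_ring_1"
  assumes two: "(2::'a) = 0"
  shows "(x + y) ^ (2 ^ k) = x ^ (2 ^ k) + y ^ (2 ^ k)"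
proof (induction k)
  case (Suc k)
  have "(x + y) ^ (2 ^ Suc k) = (x ^ (2 ^ k) + y ^ (2 ^ k)) ^ 2"
    by (simp add: power_mult[symmetric] Suc.IH[symmetric] mult.commute)
  also have "\<dots> = (x ^ (2 ^ k)) ^ 2 + (y ^ (2 ^ k)) ^ 2"
    using two by (simp add: power2_sum)
  finally show ?case
    by (simp add: power_mult[symmetric] mult.commute)
qed simp

lemma frobenius_sum:
  fixes f :: "'b \<Rightarrow> 'a::comm_ring_1"
  assumes two: "(2::'a) = 0"
  shows "(\<Sum>i\<in>A. f i) ^ (2 ^ k) = (\<Sum>i\<in>A. f i ^ (2 ^ k))"
  by (induction A rule: infinite_finite_induct) (simp_all add: frobenius_add[OF two] power_0_left)

lemma frobenius_comp: "(x ^ (2 ^ i)) ^ (2 ^ j) = x ^ (2 ^ (i + j))" for x :: "'a::monoid_mult"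
  by (simp add: power_mult[symmetric] power_add)

section \<open>Fixed points of Frobenius powers, traces and the additive character\<close>

definition frob_fixed :: "nat \<Rightarrow> 'a::comm_ring_1 set" where
  "frob_fixed d = {x. x ^ (2 ^ d) = x}"

text \<open>On \<open>frob_fixed d\<close> this is the trace of F_(2^d) over F_2. It is defined in
  every commutative ring because it is also applied to polynomials in \<open>X\<close> and
  \<open>Y\<close> and to power series.\<close>

definition abs_trace :: "nat \<Rightarrow> 'a::comm_ring_1 \<Rightarrow> 'a" where
  "abs_trace d x = (\<Sum>i<d. x ^ (2 ^ i))"

text \<open>The nontrivial additive character of F_2 with integer values; on arguments 0 and 1 it
  turns sums into products.\<close>

definition sign_char :: "'a::zero \<Rightarrow> int" where
  "sign_char t = (if t = 0 then 1 else - 1)"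

lemma sign_char_add:
  fixes s t :: "'a::comm_ring_1"
  assumes two: "(2::'a) = 0" and "s \<in> {0, 1}" "t \<in> {0, 1}"
  shows "sign_char (s + t) = sign_char s * sign_char t"
  using assms add_self_char2[OF two] by (auto simp: sign_char_def)

lemma sign_char_square: "sign_char t * sign_char t = 1"
  by (simp add: sign_char_def)

text \<open>Translation by an element \<open>b\<close> with \<open>L b \<noteq> 0\<close> permutes
  \<open>A\<close> and reverses every sign. The set \<open>A\<close> will be a subfield, or a
  subgroup of one.\<close>

lemma sum_sign_char_additive:
  fixes L :: "'b::ab_group_add \<Rightarrow> 'a::comm_ring_1"
  assumes two: "(2::'a) = 0"
    and fin: "finite A" and clos: "\<And>x y. x \<in> A \<Longrightarrow> y \<in> A \<Longrightarrow> x + y \<in> A"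
    and dbl: "\<And>x. x \<in> A \<Longrightarrow> x + x = 0"
    and L: "\<And>x. x \<in> A \<Longrightarrow> L x \<in> {0, 1}"
    and add: "\<And>x y. x \<in> A \<Longrightarrow> y \<in> A \<Longrightarrow> L (x + y) = L x + L y"
  shows "(\<Sum>x\<in>A. sign_char (L x)) = (if \<forall>x\<in>A. L x = 0 then int (card A) else 0)"
proof (cases "\<forall>x\<in>A. L x = 0")
  case True
  then show ?thesis by (simp add: sign_char_def)
next
  case False
  then obtain b where b: "b \<in> A" "L b \<noteq> 0" by auto
  have b2: "x + b + b = x" for x using dbl[OF b(1)] by (simp only: add.assoc add_0_right)
  have "(\<Sum>x\<in>A. sign_char (L x)) = (\<Sum>x\<in>A. sign_char (L (x + b)))"
    by (rule sum.reindex_bij_witness[of _ "\<lambda>x. x + b" "\<lambda>x. x + b"]) (use b clos in \<open>auto simp only: b2\<close>)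
  also have "\<dots> = (\<Sum>x\<in>A. - sign_char (L x))"
  proof (rule sum.cong)
    fix x assume x: "x \<in> A"
    have "sign_char (L (x + b)) = sign_char (L x) * sign_char (L b)"
      using add[OF x b(1)] sign_char_add[OF two L[OF x] L[OF b(1)]] by simp
    then show "sign_char (L (x + b)) = - sign_char (L x)" using b(2) by (simp add: sign_char_def)
  qed simp
  finally have "(\<Sum>x\<in>A. sign_char (L x)) = 0" by (simp add: sum_negf)
  then show ?thesis using False by (simp only: if_False)
qed

lemma frob_fixedD: "x \<in> frob_fixed d \<Longrightarrow> x ^ (2 ^ d) = x"
  by (simp add: frob_fixed_def)

lemma frob_fixed_mult_exp:
  assumes "x \<in> frob_fixed d"
  shows "x ^ (2 ^ (d * k)) = x"
proof (induction k)
  case (Suc k)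
  have "x ^ (2 ^ (d * Suc k)) = (x ^ (2 ^ (d * k))) ^ (2 ^ d)"
    by (simp add: frobenius_comp add.commute)
  then show ?case using Suc assms by (simp add: frob_fixed_def)
qed simp

lemma frob_fixed_mono: "d dvd e \<Longrightarrow> x \<in> frob_fixed d \<Longrightarrow> x \<in> frob_fixed e"
  by (auto simp: frob_fixed_mult_exp frob_fixed_def[of e])

lemma frob_fixed_mod:
  assumes "x \<in> frob_fixed d"
  shows "x ^ (2 ^ e) = x ^ (2 ^ (e mod d))"
proof -
  have "x ^ (2 ^ e) = x ^ (2 ^ (d * (e div d) + e mod d))" by simp
  also have "\<dots> = (x ^ (2 ^ (d * (e div d)))) ^ (2 ^ (e mod d))" by (simp only: frobenius_comp)
  finally show ?thesis by (simp add: frob_fixed_mult_exp[OF assms])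
qed

text \<open>Euclid's algorithm on the exponents, each division step being
  \<open>frob_fixed_mod\<close>.\<close>

lemma frob_fixed_gcd:
  assumes "x \<in> frob_fixed d" "x \<in> frob_fixed e"
  shows "x \<in> frob_fixed (gcd d e)"
  using assms
proof (induction d e rule: gcd_nat_induct)
  case (step d e)
  have "x ^ (2 ^ (d mod e)) = x"
    using step.prems by (metis frob_fixed_mod frob_fixedD)
  then have "x \<in> frob_fixed (gcd e (d mod e))"
    using step by (simp add: frob_fixed_def)
  then show ?case by (simp add: gcd_red_nat[of d e])
qed simp

lemma frob_fixed_closed:
  fixes x y :: "'a::comm_ring_1"
  shows "0 \<in> frob_fixed d" "1 \<in> frob_fixed d"
    "x \<in> frob_fixed d \<Longrightarrow> y \<in> frob_fixed d \<Longrightarrow> x * y \<in> frob_fixed d"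
    "x \<in> frob_fixed d \<Longrightarrow> x ^ k \<in> frob_fixed d"
  by (auto simp: frob_fixed_def power_mult_distrib power_0_left power_commutes)
    (simp add: power_mult[symmetric] mult.commute[of k], simp add: power_mult)

lemma frob_fixed_add:
  fixes x y :: "'a::comm_ring_1"
  assumes "(2::'a) = 0" "x \<in> frob_fixed d" "y \<in> frob_fixed d"
  shows "x + y \<in> frob_fixed d"
  using assms by (simp add: frob_fixed_def frobenius_add)

lemma abs_trace_0 [simp]: "abs_trace d 0 = 0"
  by (simp add: abs_trace_def power_0_left)

lemma abs_trace_add:
  fixes x y :: "'a::comm_ring_1"
  assumes "(2::'a) = 0"
  shows "abs_trace d (x + y) = abs_trace d x + abs_trace d y"
  by (simp add: abs_trace_def frobenius_add[OF assms] sum.distrib)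

text \<open>Squaring shifts the terms of the trace by one, so the sum telescopes. Applied to
  \<open>c * eta\<close> for a root \<open>eta\<close> of the curve equation, it makes the trace
  satisfy a quadratic equation.\<close>

lemma abs_trace_square:
  fixes x :: "'a::comm_ring_1"
  assumes "(2::'a) = 0"
  shows "(abs_trace d x)\<^sup>2 + abs_trace d x = x ^ (2 ^ d) + x"
proof (induction d)
  case 0
  then show ?case using add_self_char2[OF assms] by (simp add: abs_trace_def)
next
  case (Suc d)
  let ?t = "abs_trace d x"
  have "abs_trace (Suc d) x = ?t + x ^ (2 ^ d)" by (simp add: abs_trace_def)
  then have "(abs_trace (Suc d) x)\<^sup>2 + abs_trace (Suc d) x
      = (?t\<^sup>2 + ?t) + (x ^ (2 ^ d) + (x ^ (2 ^ d))\<^sup>2)"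
    using frobenius_add[OF assms, of ?t "x ^ (2 ^ d)" 1] by (simp add: add_ac power2_eq_square)
  also have "\<dots> = (x ^ (2 ^ d) + x ^ (2 ^ d)) + (x + (x ^ (2 ^ d))\<^sup>2)"
    by (subst Suc) (simp only: add_ac)
  finally show ?case
    using add_self_char2[OF assms] by (simp add: power_mult[symmetric] mult.commute add.commute)
qed

lemma abs_trace_01:
  fixes x :: "'a::idom"
  assumes "(2::'a) = 0" "x \<in> frob_fixed d"
  shows "abs_trace d x \<in> {0, 1}"
proof -
  have "(abs_trace d x)\<^sup>2 + abs_trace d x = 0"
    using abs_trace_square[OF assms(1), of d x] assms add_self_char2[OF assms(1)]
    by (simp add: frob_fixedD)
  then have "abs_trace d x * (abs_trace d x + 1) = 0"
    by (simp add: power2_eq_square algebra_simps)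
  then have "abs_trace d x * (abs_trace d x - 1) = 0"
    by (simp only: minus_char2(2)[OF assms(1)])
  then show ?thesis by simp
qed

lemma abs_trace_frobenius:
  fixes x :: "'a::idom"
  assumes two: "(2::'a) = 0" and x: "x \<in> frob_fixed d"
  shows "abs_trace d (x ^ (2 ^ k)) = abs_trace d x"
proof -
  have "abs_trace d (x ^ (2 ^ k)) = (abs_trace d x) ^ (2 ^ k)"
    by (simp add: abs_trace_def frobenius_sum[OF two] frobenius_comp add.commute)
  then show ?thesis using abs_trace_01[OF assms] by auto
qed

lemma sum_lessThan_add:
  fixes f :: "nat \<Rightarrow> 'a::comm_monoid_add"
  shows "(\<Sum>i<m + n. f i) = (\<Sum>i<m. f i) + (\<Sum>i<n. f (m + i))"
  by (induction n) (simp_all add: add.assoc)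

text \<open>The conjugates of \<open>x\<close> repeat with period \<open>d\<close>. In
  characteristic 2 the larger trace therefore vanishes for even \<open>k\<close> and agrees with the
  smaller one for odd \<open>k\<close>.\<close>

lemma abs_trace_mult_degree:
  fixes x :: "'a::comm_ring_1"
  assumes x: "x \<in> frob_fixed d"
  shows "abs_trace (d * k) x = of_nat k * abs_trace d x"
proof (induction k)
  case (Suc k)
  have "abs_trace (d * Suc k) x = abs_trace (d * k) x + (\<Sum>i<d. x ^ (2 ^ (d * k + i)))"
    unfolding abs_trace_def mult_Suc_right
    by (subst add.commute, rule sum_lessThan_add)
  also have "(\<Sum>i<d. x ^ (2 ^ (d * k + i))) = abs_trace d x"
    unfolding abs_trace_def
    by (simp only: frobenius_comp[symmetric] frob_fixed_mult_exp[OF x])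
  finally show ?case by (simp add: Suc algebra_simps)
qed (simp add: abs_trace_def)

lemma card_le_fibers:
  assumes "finite B" "f ` A \<subseteq> B" "\<And>b. b \<in> B \<Longrightarrow> card {x \<in> A. f x = b} \<le> k"
  shows "card A \<le> card B * k"
proof -
  have "A = (\<Union>b\<in>B. {x \<in> A. f x = b})" using assms(2) by auto
  then have "card A \<le> (\<Sum>b\<in>B. card {x \<in> A. f x = b})"
    using card_UN_le[OF assms(1), of "\<lambda>b. {x \<in> A. f x = b}"] by simp
  also have "\<dots> \<le> card B * k" using sum_bounded_above[of B _ k] assms(3) by simp
  finally show ?thesis .
qed

text \<open>Root count for a linearized polynomial. The case \<open>r = 2\<close> bounds fixed
  fields and Artin-Schreier fibres, the case \<open>d = 1\<close> the kernel of the trace.\<close>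

lemma card_frobenius_sum_fiber:
  fixes c :: "'a::idom"
  assumes "r > 0" "d > 0"
  shows "card {x. (\<Sum>i<r. x ^ (2 ^ (d * i))) = c} \<le> 2 ^ (d * (r - 1))"
proof -
  define p :: "'a poly" where "p = (\<Sum>i<r. Polynomial.monom 1 (2 ^ (d * i))) - [:c:]"
  have "Polynomial.coeff p (2 ^ (d * (r - 1))) = (\<Sum>i<r. if i = r - 1 then 1 else 0)"
    using assms by (auto simp: p_def coeff_sum coeff_pCons split: nat.splits intro!: sum.cong)
  then have "p \<noteq> 0" using assms by (auto simp: sum.delta)
  moreover have "Polynomial.degree p \<le> 2 ^ (d * (r - 1))"
    unfolding p_def
  proof (intro degree_diff_le degree_sum_le)
    fix i assume "i \<in> {..<r}"
    then show "Polynomial.degree (Polynomial.monom (1::'a) (2 ^ (d * i))) \<le> 2 ^ (d * (r - 1))"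
      by (auto simp: Polynomial.degree_monom_eq intro!: power_increasing mult_le_mono)
  qed auto
  moreover have "{x. (\<Sum>i<r. x ^ (2 ^ (d * i))) = c} = {x. poly p x = 0}"
    by (auto simp: p_def poly_sum poly_monom)
  ultimately show ?thesis using card_poly_roots_bound[of p] by auto
qed

text \<open>Multiplication by a nonzero \<open>x\<close> permutes the nonzero elements, so it leaves
  their product unchanged.\<close>

lemma finite_field_power_card:
  fixes x :: "'k::{finite,field}"
  shows "x ^ CARD('k) = x"
proof (cases "x = 0")
  case False
  have "(\<Prod>y\<in>UNIV - {0}. y) = (\<Prod>y\<in>UNIV - {0}. x * y)"
    by (rule prod.reindex_bij_witness[of _ "\<lambda>y. x * y" "\<lambda>y. y / x"]) (use False in auto)
  also have "\<dots> = x ^ (CARD('k) - 1) * (\<Prod>y\<in>UNIV - {0}. y)"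
    by (simp add: prod.distrib card_Diff_singleton)
  finally have "x ^ (CARD('k) - 1) = 1" by simp
  then show ?thesis by (metis power_eq_if power_0_left mult.right_neutral zero_less_card_finite less_not_refl)
qed (simp add: power_0_left)

lemma two_eq_0_finite_field:
  assumes "CARD('k::{finite,field}) = 2 ^ n"
  shows "(2::'k) = 0"
proof -
  have "(\<Sum>x\<in>UNIV. x) = (\<Sum>x\<in>UNIV. x + (1::'k))"
    by (rule sum.reindex_bij_witness[of _ "\<lambda>x. x + 1" "\<lambda>x. x - 1"]) auto
  then have "of_nat CARD('k) = (0::'k)" by (simp add: sum.distrib)
  then show ?thesis using assms by simp
qed

section \<open>Subfields and orthogonality in a field with 2^n elements\<close>

locale binary_field =
  fixes ty :: "'k::{finite,field} itself" and n :: nat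
  assumes card_K: "CARD('k) = 2 ^ n"
begin

lemma two: "(2::'k) = 0"
  using two_eq_0_finite_field[OF card_K] .

lemmas char2 = add_self_char2[OF two] minus_char2[OF two]
lemmas frob_add = frobenius_add[OF two]

lemma add_eq_0: "x + y = 0 \<longleftrightarrow> x = y" for x y :: 'k
  by (metis char2(3) right_minus_eq)

lemma n_pos: "n > 0"
proof (rule ccontr)
  assume "\<not> n > 0"
  then have "CARD('k) = 1" using card_K by simp
  then have "card {0, 1::'k} \<le> 1" using card_mono[of UNIV "{0, 1::'k}"] by simp
  then show False by simp
qed

lemma frob_fixed_n: "(x::'k) \<in> frob_fixed n"
  using finite_field_power_card[of x] card_K by (simp add: frob_fixed_def)

lemma frob_fixed_inj:
  fixes x y :: 'k
  assumes "x ^ (2 ^ k) = y ^ (2 ^ k)"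
  shows "x = y"
proof -
  have "(x + y) ^ (2 ^ k) = 0" using assms by (simp add: frob_add char2)
  then show ?thesis using char2(3)[of x y] by simp
qed

text \<open>The upper bound counts roots. For the lower bound, the relative trace maps the whole
  field into \<open>frob_fixed d\<close> with fibres of at most \<open>2 ^ (d * (r - 1))\<close>
  elements.\<close>

lemma card_frob_fixed:
  assumes "d dvd n"
  shows "card (frob_fixed d :: 'k set) = 2 ^ d"
proof -
  from assms obtain r where r: "n = d * r" by auto
  have d: "d > 0" "r > 0" using n_pos r by auto
  have "{x::'k. (\<Sum>i<2. x ^ (2 ^ (d * i))) = 0} = frob_fixed d"
    using char2(3) by (auto simp: frob_fixed_def numeral_2_eq_2) (metis add_eq_0_iff char2(2))+
  then have le: "card (frob_fixed d :: 'k set) \<le> 2 ^ d"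
    using card_frobenius_sum_fiber[of 2 d "0::'k"] d by simp
  have "(\<Sum>i<r. x ^ (2 ^ (d * i))) \<in> frob_fixed d" for x :: 'k
  proof -
    have "(\<Sum>i<r. x ^ (2 ^ (d * i))) ^ (2 ^ d) = (\<Sum>i<r. x ^ (2 ^ (d * Suc i)))"
      by (simp add: frobenius_sum[OF two] frobenius_comp add.commute)
    also have "\<dots> = (\<Sum>i<r. x ^ (2 ^ (d * i))) + x ^ (2 ^ (d * r)) - x"
      using sum.lessThan_Suc_shift[of "\<lambda>i. x ^ (2 ^ (d * i))" r] by simp
    finally show ?thesis using frob_fixed_n[of x] r by (simp add: frob_fixed_def)
  qed
  then have "CARD('k) \<le> card (frob_fixed d :: 'k set) * 2 ^ (d * (r - 1))"
    using card_frobenius_sum_fiber[OF d(2,1)]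
    by (intro card_le_fibers[where f = "\<lambda>x. \<Sum>i<r. x ^ (2 ^ (d * i))"]) auto
  moreover have "CARD('k) = 2 ^ d * 2 ^ (d * (r - 1))"
    using card_K r d by (simp add: power_add[symmetric] algebra_simps)
  ultimately show ?thesis using le by simp
qed

text \<open>The trace is a polynomial of degree \<open>2 ^ (d - 1)\<close>, too small to vanish on
  all \<open>2 ^ d\<close> elements.\<close>

lemma ex_trace_nonzero:
  assumes "d dvd n"
  shows "\<exists>x \<in> frob_fixed d. abs_trace d (x::'k) \<noteq> 0"
proof (rule ccontr)
  assume neg: "\<not> ?thesis"
  have d: "d > 0" using assms n_pos by (auto intro: Nat.gr0I)
  have "frob_fixed d \<subseteq> {x::'k. (\<Sum>i<d. x ^ (2 ^ (1 * i))) = 0}"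
    using neg by (auto simp: abs_trace_def)
  then have "card (frob_fixed d :: 'k set) \<le> card {x::'k. (\<Sum>i<d. x ^ (2 ^ (1 * i))) = 0}"
    by (intro card_mono) auto
  also have "\<dots> \<le> 2 ^ (1 * (d - 1))" using card_frobenius_sum_fiber[of d 1 "0::'k"] d by simp
  finally show False using card_frob_fixed[OF assms] d by simp
qed

lemma ex_trace_mult_nonzero:
  assumes "d dvd n" "w \<in> frob_fixed d" "(w::'k) \<noteq> 0"
  shows "\<exists>x \<in> frob_fixed d. abs_trace d (x * w) \<noteq> 0"
proof -
  obtain x where "x \<in> frob_fixed d" "abs_trace d (x::'k) \<noteq> 0" using ex_trace_nonzero[OF assms(1)] by auto
  then show ?thesis using assms by (intro bexI[of _ "x / w"]) (auto simp: frob_fixed_def power_divide)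
qed

text \<open>Orthogonality of characters, resting on the nondegeneracy of the trace form.\<close>

lemma sum_sign_char_trace:
  assumes d: "d dvd n" and w: "(w::'k) \<in> frob_fixed d"
  shows "(\<Sum>x\<in>frob_fixed d. sign_char (abs_trace d (x * w))) = (if w = 0 then 2 ^ d else 0)"
proof -
  have "(\<Sum>x\<in>frob_fixed d. sign_char (abs_trace d (x * w)))
    = (if \<forall>x\<in>frob_fixed d. abs_trace d (x * w) = 0 then int (card (frob_fixed d :: 'k set)) else 0)"
    by (rule sum_sign_char_additive[OF two])
      (use w in \<open>auto simp: frob_fixed_add[OF two] char2(1) frob_fixed_closed distrib_right
        abs_trace_add[OF two] intro!: abs_trace_01[OF two, simplified]\<close>)
  then show ?thesis using ex_trace_mult_nonzero[OF assms] card_frob_fixed[OF d] by (auto split: if_splits)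
qed

end

section \<open>Fixed points of maps of prime order\<close>

text \<open>The points moved by \<open>f\<close> form the set \<open>B\<close>, which splits into
  orbits of exactly \<open>p\<close> elements.\<close>

lemma card_cong_card_fixed_points:
  assumes fin: "finite A" and p: "prime p" and fA: "\<And>x. x \<in> A \<Longrightarrow> f x \<in> A"
    and per: "\<And>x. x \<in> A \<Longrightarrow> (f ^^ p) x = x"
  shows "[int (card A) = int (card {x \<in> A. f x = x})] (mod int p)"
proof -
  define B where "B = {x \<in> A. f x \<noteq> x}"
  define orb where "orb x = range (\<lambda>k. (f ^^ k) x)" for x
  have p0: "p > 0" using p by (simp add: prime_gt_0_nat)
  have per': "(f ^^ (k * p)) x = x" if "x \<in> A" for x k
    by (induction k) (simp_all add: funpow_add per[OF that])
  have self: "x \<in> orb x" for x by (auto simp: orb_def intro: range_eqI[of _ _ 0])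
  have orb_eq: "orb y = orb x" if x: "x \<in> A" and y: "y \<in> orb x" for x y
  proof -
    have sub: "orb v \<subseteq> orb u" if "v \<in> orb u" for u v
    proof -
      from that obtain k where "v = (f ^^ k) u" by (auto simp: orb_def)
      then have "(f ^^ l) v = (f ^^ (l + k)) u" for l by (simp add: funpow_add)
      then show ?thesis by (auto simp: orb_def)
    qed
    from y obtain k where k: "y = (f ^^ k) x" by (auto simp: orb_def)
    have "(f ^^ (k * (p - 1))) y = (f ^^ (k * (p - 1) + k)) x" by (simp add: k funpow_add)
    also have "k * (p - 1) + k = k * p" using p0 by (cases p) auto
    finally have "x \<in> orb y" using per'[OF x] by (auto simp: orb_def intro: range_eqI[of _ _ "k * (p - 1)"])
    then show ?thesis using sub y by blast
  qed
  have orb_B: "orb x \<subseteq> B" if x: "x \<in> B" for x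
  proof
    fix y assume y: "y \<in> orb x"
    then obtain k where k: "y = (f ^^ k) x" by (auto simp: orb_def)
    have yA: "y \<in> A" unfolding k using x by (induction k) (auto simp: B_def fA)
    have xA: "x \<in> A" using x by (simp add: B_def)
    have "f y \<noteq> y"
    proof
      assume "f y = y"
      then have "(f ^^ j) y = y" for j by (induction j) auto
      then have "orb y = {y}" by (auto simp: orb_def)
      then have "x = y" using orb_eq[OF xA y] self[of x] by auto
      then show False using x \<open>f y = y\<close> by (simp add: B_def)
    qed
    then show "y \<in> B" using yA by (simp add: B_def)
  qed
  have card_orb: "card (orb x) = p" if x: "x \<in> B" for x
  proof -
    have xA: "x \<in> A" using x by (simp add: B_def)
    have *: "(f ^^ (k mod p)) x = (f ^^ k) x" for k by (rule funpow_mod_eq[OF per[OF xA]])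
    have "orb x = (\<lambda>k. (f ^^ k) x) ` {..<p}"
    proof (intro equalityI subsetI)
      fix y assume "y \<in> orb x"
      then obtain k where "y = (f ^^ k) x" by (auto simp: orb_def)
      then show "y \<in> (\<lambda>k. (f ^^ k) x) ` {..<p}" using * p0 by (intro image_eqI[of _ _ "k mod p"]) auto
    qed (auto simp: orb_def)
    moreover have "inj_on (\<lambda>k. (f ^^ k) x) {..<p}"
    proof (rule linorder_inj_onI')
      fix i j :: nat assume ij: "i < j" "i \<in> {..<p}" "j \<in> {..<p}"
      show "(f ^^ i) x \<noteq> (f ^^ j) x"
      proof
        assume eq: "(f ^^ i) x = (f ^^ j) x"
        have "(f ^^ (p - i + i)) x = (f ^^ (p - i + j)) x" by (simp only: funpow_add comp_apply eq)
        moreover have "p - i + j = (j - i) + p" using ij by auto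
        moreover have "(f ^^ ((j - i) + p)) x = (f ^^ (j - i)) x"
          by (simp only: funpow_add comp_apply per[OF xA])
        moreover have "p - i + i = p" using ij by auto
        ultimately have c: "(f ^^ (j - i)) x = x" using per[OF xA] by metis
        have c': "(f ^^ (u * (j - i))) x = x" for u by (induction u) (simp_all add: funpow_add c)
        \<comment> \<open>A return after \<open>j - i\<close> steps and one after \<open>p\<close>
          steps combine, by Bezout, to a return after a single step.\<close>
        have "coprime (j - i) p" using ij p
          by (metis coprime_commute diff_is_0_eq less_imp_diff_less lessThan_iff
              nat_dvd_not_less not_le prime_imp_coprime zero_less_diff)
        then obtain u v where "(j - i) * u = p * v + 1"
          using bezout_nat[of "j - i" p] ij by (metis coprime_imp_gcd_eq_1 gr_implies_not0 zero_less_diff)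
        then have "(f ^^ (u * (j - i))) x = f ((f ^^ (v * p)) x)" by (simp add: mult.commute)
        then have "f x = x" using c' per'[OF xA] by simp
        then show False using x by (simp add: B_def)
      qed
    qed
    ultimately show ?thesis by (simp add: card_image)
  qed
  have "p dvd card (\<Union> (orb ` B))"
  proof (rule dvd_partition)
    show "finite (\<Union> (orb ` B))"
      by (rule finite_subset[of _ B]) (use orb_B fin in blast, simp add: B_def fin)
    show "\<forall>c1\<in>orb ` B. \<forall>c2\<in>orb ` B. c1 \<noteq> c2 \<longrightarrow> c1 \<inter> c2 = {}"
    proof (intro ballI impI, rule ccontr)
      fix c1 c2 assume c: "c1 \<in> orb ` B" "c2 \<in> orb ` B" "c1 \<noteq> c2" "c1 \<inter> c2 \<noteq> {}"
      then obtain x y z where "x \<in> B" "y \<in> B" "c1 = orb x" "c2 = orb y" "z \<in> orb x" "z \<in> orb y"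
        by blast
      then show False using orb_eq[of x z] orb_eq[of y z] c(3) by (simp add: B_def)
    qed
  qed (auto simp: card_orb)
  moreover have "\<Union> (orb ` B) = B" using orb_B self by blast
  moreover have "card A = card {x \<in> A. f x = x} + card B"
  proof -
    have "A = {x \<in> A. f x = x} \<union> B" "{x \<in> A. f x = x} \<inter> B = {}" "finite B"
      using fin by (auto simp: B_def)
    then show ?thesis using fin card_Un_disjoint[of "{x \<in> A. f x = x}" B] by simp
  qed
  ultimately show ?thesis by (auto simp: cong_iff_dvd_diff)
qed

text \<open>The level sets of \<open>v\<close> are stable under \<open>f\<close>, so the counting
  congruence applies to each of the two.\<close>

lemma sum_sign_cong_fixed_points:
  fixes v :: "'b \<Rightarrow> int"
  assumes fin: "finite A" and p: "prime p" and fA: "\<And>x. x \<in> A \<Longrightarrow> f x \<in> A"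
    and per: "\<And>x. x \<in> A \<Longrightarrow> (f ^^ p) x = x"
    and v: "\<And>x. x \<in> A \<Longrightarrow> v x = 1 \<or> v x = - 1" and inv: "\<And>x. x \<in> A \<Longrightarrow> v (f x) = v x"
  shows "[(\<Sum>x\<in>A. v x) = (\<Sum>x\<in>{x \<in> A. f x = x}. v x)] (mod int p)"
proof -
  have *: "(\<Sum>x\<in>B. v x) = int (card {x \<in> B. v x = 1}) - int (card {x \<in> B. v x = - 1})" if "B \<subseteq> A" for B
  proof -
    have finB: "finite B" using that fin finite_subset by blast
    have "(\<Sum>x\<in>B. v x) = (\<Sum>x\<in>B. (if v x = 1 then 1 else 0) - (if v x = - 1 then 1 else 0))"
      using that v by (intro sum.cong refl) force
    then show ?thesis using finB by (simp add: sum_subtractf sum.inter_filter[symmetric])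
  qed
  have c: "[int (card {x \<in> A. v x = s}) = int (card {x \<in> {x \<in> A. f x = x}. v x = s})] (mod int p)" for s
  proof -
    have "{x \<in> {x \<in> A. f x = x}. v x = s} = {x \<in> {x \<in> A. v x = s}. f x = x}" by auto
    then show ?thesis
      using card_cong_card_fixed_points[OF _ p, of "{x \<in> A. v x = s}" f] fin fA per inv by simp
  qed
  show ?thesis using *[of A] *[of "{x \<in> A. f x = x}"] cong_diff[OF c[of 1] c[of "- 1"]] by simp
qed

section \<open>The quadratic character of two\<close>

text \<open>The Jacobi symbol \<open>(2/k)\<close>, meaningful for odd \<open>k\<close> only.\<close>

definition jac2 :: "nat \<Rightarrow> int" where
  "jac2 k = (if k mod 8 = 1 \<or> k mod 8 = 7 then 1 else - 1)"

lemma jac2_mult: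
  assumes "odd k" "odd l"
  shows "jac2 (k * l) = jac2 k * jac2 l"
proof -
  have "k mod 8 \<in> {1, 3, 5, 7}" "l mod 8 \<in> {1, 3, 5, 7}"
    using assms by (auto, presburger+)
  then show ?thesis
    unfolding jac2_def using mod_mult_eq[of k 8 l, symmetric] by (elim insertE emptyE) simp_all
qed

lemma jac2_square: "jac2 k * jac2 k = 1"
  by (simp add: jac2_def)

text \<open>Gauss's lemma for the multiplier 2: the set \<open>G.E\<close> consists of the doubles
  \<open>2 * x\<close> that exceed \<open>(p - 1) / 2\<close>, and the parity of its size depends on
  \<open>p\<close> modulo 8.\<close>

lemma two_power_half:
  assumes p: "prime p" "odd p"
  shows "[2 ^ ((p - 1) div 2) = jac2 p] (mod int p)"
proof -
  have p2: "p > 2" using p prime_ge_2_nat[of p] by (cases "p = 2") auto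
  interpret G: GAUSS p 2
    using p p2 by unfold_locales (auto simp: cong_def)
  let ?h = "(int p - 1) div 2"
  have h: "int p = 2 * ?h + 1" using p by presburger
  have "G.C = (\<lambda>x. x * 2) ` G.A"
    unfolding G.C_def G.B_def image_image
    by (rule image_cong) (use h in \<open>auto simp: G.A_def\<close>)
  moreover have "(\<lambda>x. x * 2) ` {0<..?h} \<inter> {?h<..} = (\<lambda>x. x * 2) ` {?h div 2 <.. ?h}"
  proof -
    have "?h < x * 2 \<longleftrightarrow> ?h div 2 < x" for x by presburger
    moreover have "?h div 2 \<ge> 0" using p2 by simp
    ultimately show ?thesis by fastforce
  qed
  ultimately have "G.E = (\<lambda>x. x * 2) ` {?h div 2 <.. ?h}"
    unfolding G.E_def G.A_def by simp
  then have "card G.E = nat (?h - ?h div 2)"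
    by (simp add: card_image inj_on_def)
  moreover have "(- 1) ^ nat (?h - ?h div 2) = jac2 p"
  proof -
    have "even (nat (?h - ?h div 2)) \<longleftrightarrow> p mod 8 = 1 \<or> p mod 8 = 7"
    proof -
      define h where "h = (p - 1) div 2"
      have "?h = int h" using p2 unfolding h_def by (simp add: of_nat_div of_nat_diff)
      then have "nat (?h - ?h div 2) = h - h div 2" by (simp add: nat_diff_distrib' nat_div_distrib)
      moreover have "even (h - h div 2) \<longleftrightarrow> p mod 8 = 1 \<or> p mod 8 = 7"
      proof -
        have "p mod 8 \<in> {1, 3, 5, 7}" using p(2) by (simp, presburger)
        moreover define k where "k = p div 8"
        then have "p = 8 * k + p mod 8" by simp
        ultimately consider "p = 8 * k + 1" | "p = 8 * k + 3" | "p = 8 * k + 5" | "p = 8 * k + 7" by fastforce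
        then show ?thesis by cases (simp_all add: h_def, presburger)
      qed
      ultimately show ?thesis by simp
    qed
    then show ?thesis by (simp add: jac2_def)
  qed
  moreover have "nat ?h = (p - 1) div 2" using p2 by simp
  ultimately show ?thesis using G.pre_gauss_lemma by simp
qed

section \<open>Points on the Suzuki curve\<close>

text \<open>F_q is \<open>frob_fixed m\<close>. The degree \<open>n\<close> is any multiple of
  \<open>m\<close>, so that both base fields are covered: \<open>n = m\<close> for F_q and
  \<open>n = 4 * m\<close> for F_(q^4).\<close>

locale suzuki = binary_field ty n for ty :: "'k::{finite,field} itself" and n +
  fixes a m q0 q :: nat
  assumes m_def: "m = 2 * a + 1" and q0_def: "q0 = 2 ^ a" and q_def: "q = 2 ^ m" and m_dvd: "m dvd n"
begin

definition F :: "'k \<Rightarrow> 'k" where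
  "F x = x ^ q0 * (x ^ q + x)"

lemma q0_add: "(x + y) ^ q0 = x ^ q0 + y ^ q0" for x y :: 'k
  by (simp add: q0_def frob_add)

lemma q_add: "(x + y) ^ q = x ^ q + y ^ q" for x y :: 'k
  by (simp add: q_def frob_add)

lemma F_add: "F (x + z) = F x + F z + (x ^ q0 * (z ^ q + z) + z ^ q0 * (x ^ q + x))"
  by (simp add: F_def q0_add q_add algebra_simps)

lemma F_closed: "x \<in> frob_fixed d \<Longrightarrow> F x \<in> frob_fixed d"
  by (simp add: F_def frob_fixed_closed frob_fixed_add[OF two])

text \<open>The trace is invariant under Frobenius, so every conjugate of \<open>x\<close> can be
  moved to \<open>x ^ q\<close>. The polar form becomes a trace pairing, whose radical can be read
  off from the second factor.\<close>

lemma trace_polar_form: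
  fixes x z :: 'k
  assumes x: "x \<in> frob_fixed e" and z: "z \<in> frob_fixed e"
  shows "abs_trace e (x ^ q0 * (z ^ q + z) + z ^ q0 * (x ^ q + x))
    = abs_trace e (x ^ q * ((z ^ q + z)\<^sup>2 + (z ^ q + z)) ^ q0)"
proof -
  define h where "h = z ^ q + z"
  have h: "h \<in> frob_fixed e" using z by (simp add: h_def frob_fixed_closed frob_fixed_add[OF two])
  note cl = frob_fixed_closed frob_fixed_add[OF two] x z h
  have 1: "abs_trace e (x ^ q0 * h) = abs_trace e (x ^ q * h ^ (2 * q0))"
  proof -
    \<comment> \<open>The exponent is chosen so that \<open>q0 * 2 ^ (a + 1) = q\<close>.\<close>
    have "abs_trace e (x ^ q0 * h) = abs_trace e ((x ^ q0 * h) ^ (2 ^ (a + 1)))"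
      by (rule abs_trace_frobenius[OF two, symmetric]) (simp add: cl)
    also have "(x ^ q0 * h) ^ (2 ^ (a + 1)) = x ^ q * h ^ (2 * q0)"
      by (simp only: power_mult_distrib q0_def q_def m_def frobenius_comp) (simp add: mult_2)
    finally show ?thesis .
  qed
  have 2: "abs_trace e (z ^ q0 * x) = abs_trace e (x ^ q * (z ^ q) ^ q0)"
  proof -
    have "abs_trace e (z ^ q0 * x) = abs_trace e ((z ^ q0 * x) ^ (2 ^ m))"
      by (rule abs_trace_frobenius[OF two, symmetric]) (simp add: cl)
    also have "(z ^ q0 * x) ^ (2 ^ m) = x ^ q * (z ^ q) ^ q0"
      by (simp add: power_mult_distrib q0_def q_def frobenius_comp add.commute mult.commute)
    finally show ?thesis .
  qed
  have "(h\<^sup>2 + h) ^ q0 = h ^ (2 * q0) + ((z ^ q) ^ q0 + z ^ q0)"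
    by (simp add: q0_add power_mult h_def)
  then show ?thesis
    unfolding h_def[symmetric]
    by (simp add: abs_trace_add[OF two] distrib_left[of "x ^ q"] distrib_left[of "z ^ q0"] 1 2
        mult.commute[of "x ^ q" "z ^ q0"])
qed

text \<open>With this weight the map from (x, y) to (z x, z^(q0+1) y) preserves the curve.\<close>

lemma F_scale: "z \<in> frob_fixed m \<Longrightarrow> F (z * x) = z ^ (q0 + 1) * F x"
  by (simp add: F_def power_mult_distrib q_def[symmetric] frob_fixed_def power_add algebra_simps)

end

section \<open>The quadratic exponential sum and its absolute value\<close>

locale suzuki4 = suzuki ty n a m q0 q for ty :: "'k::{finite,field} itself" and n a m q0 q +
  assumes n_def: "n = 4 * m"
begin

text \<open>The exponents \<open>q0\<close> and \<open>q\<close> in \<open>F\<close> stay fixed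
  while \<open>d\<close> runs over the divisors of \<open>m\<close>; this makes the sums for
  different \<open>d\<close> comparable.\<close>

definition quad_sum :: "nat \<Rightarrow> int" where
  "quad_sum d = (\<Sum>x\<in>frob_fixed (4 * d). sign_char (abs_trace (4 * d) (F x)))"

lemma odd_m: "odd m" using m_def by simp

lemma dvd_n: "d dvd m \<Longrightarrow> 4 * d dvd n" using n_def by simp

text \<open>Any element of F_4 outside F_2 will do, by the factorization of
  \<open>w ^ 4 - w\<close>.\<close>

lemma ex_omega: "\<exists>w::'k. w\<^sup>2 = w + 1"
proof -
  have "2 dvd n" using n_def by simp
  then have "card (frob_fixed 2 :: 'k set) = 4" using card_frob_fixed[of 2] by simp
  moreover have "card {0, 1::'k} = 2" by simp
  ultimately have "\<not> (frob_fixed 2 :: 'k set) \<subseteq> {0, 1}"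
    using card_mono[of "{0, 1::'k}" "frob_fixed 2"] by auto
  then obtain w :: 'k where w: "w ^ 4 = w" "w \<noteq> 0" "w \<noteq> 1" by (auto simp: frob_fixed_def)
  have "w * (w + 1) * (w\<^sup>2 + w + 1) = w ^ 4 + w + (w ^ 3 + w ^ 3) + (w ^ 2 + w ^ 2)"
    by (simp add: power_numeral_reduce algebra_simps)
  then have "w * (w + 1) * (w\<^sup>2 + w + 1) = 0" using w by (simp add: char2)
  moreover have "w + 1 \<noteq> 0" using w(3) add_eq_0 by blast
  ultimately have "w\<^sup>2 + (w + 1) = 0" using w by (simp add: add.assoc)
  then show ?thesis using add_eq_0 by blast
qed

text \<open>Since \<open>m\<close> is odd, the power \<open>q\<close> acts on F_4 as
  squaring.\<close>

lemma omega_powers: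
  assumes w: "w\<^sup>2 = w + (1::'k)"
  shows "w \<in> frob_fixed 2" "w ^ q = w + 1"
proof -
  have "w ^ 4 = (w\<^sup>2)\<^sup>2" by simp
  also have "\<dots> = (w + 1)\<^sup>2" using w by simp
  also have "\<dots> = w" using frob_add[of w 1 1] w char2(1)[of 1] by (simp add: add.assoc)
  finally show *: "w \<in> frob_fixed 2" by (simp add: frob_fixed_def)
  have "m mod 2 = 1" using odd_m by presburger
  then show "w ^ q = w + 1" using frob_fixed_mod[OF *, of m] w by (simp add: q_def)
qed

text \<open>The quotient of \<open>m\<close> by \<open>d\<close> is odd, so
  \<open>gcd (4 * d) m = d\<close>.\<close>

lemma frob_fixed_4d_m:
  assumes "d dvd m"
  shows "frob_fixed (4 * d) \<inter> frob_fixed m = (frob_fixed d :: 'k set)"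
proof -
  obtain j where j: "m = d * j" using assms by auto
  have "odd j" using odd_m j by simp
  then have "coprime 4 j" using coprime_power_left_iff[of 2 2 j] by simp
  then have "gcd (4 * d) m = d" using j
    by (metis gcd_mult_distrib_nat mult.commute coprime_imp_gcd_eq_1 mult_1_right)
  then show ?thesis using frob_fixed_gcd[of _ "4 * d" m] assms
    by (auto intro: frob_fixed_mono[of d m] frob_fixed_mono[of d "4 * d"])
qed

text \<open>The condition says that \<open>z ^ q + z\<close> is 0 or 1. The value 0 gives
  \<open>frob_fixed d\<close>, and \<open>w\<close> is a particular solution for the value 1, which
  gives the second coset.\<close>

lemma radical_eq:
  assumes d: "d dvd m" and w: "w\<^sup>2 = w + (1::'k)"
  shows "{z \<in> frob_fixed (4 * d). (z ^ q + z)\<^sup>2 + (z ^ q + z) = 0} = frob_fixed d \<union> (+) w ` frob_fixed d"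
    (is "?R = _")
proof -
  have w4: "w \<in> frob_fixed (4 * d)" using omega_powers(1)[OF w] by (rule frob_fixed_mono[rotated]) simp
  have sub: "z \<in> frob_fixed (4 * d)" if "z \<in> frob_fixed d" for z :: 'k
    using that by (rule frob_fixed_mono[rotated]) simp
  have fixq: "z ^ q = z \<longleftrightarrow> z \<in> frob_fixed d" if "z \<in> frob_fixed (4 * d)" for z :: 'k
    using that frob_fixed_4d_m[OF d] by (auto simp: q_def frob_fixed_def[of m])
  have h01: "h\<^sup>2 + h = 0 \<longleftrightarrow> h = 0 \<or> h = 1" for h :: 'k
  proof -
    have "h\<^sup>2 + h = h * (h - 1)" by (simp add: char2 power2_eq_square distrib_left)
    then show ?thesis by simp
  qed
  note eq0 = add_eq_0
  have eq1: "z ^ q + z = 1 \<longleftrightarrow> (w + z) ^ q + (w + z) = 0" for z :: 'k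
  proof -
    have "(w + z) ^ q + (w + z) = (w + w) + (1 + (z ^ q + z))"
      by (simp only: q_add omega_powers(2)[OF w] add_ac)
    also have "\<dots> = 1 + (z ^ q + z)" by (simp only: char2(1) add_0_left)
    finally show ?thesis using add_eq_0[of 1 "z ^ q + z"] by (simp only: eq_commute[of 1])
  qed
  show ?thesis
  proof (intro equalityI subsetI)
    fix z assume z: "z \<in> ?R"
    then consider "z ^ q + z = 0" | "z ^ q + z = 1" using h01 by auto
    then show "z \<in> frob_fixed d \<union> (+) w ` frob_fixed d"
    proof cases
      case 1
      then show ?thesis using z fixq eq0 by auto
    next
      case 2
      then have "w + z \<in> frob_fixed d"
        using eq1 eq0 fixq[of "w + z"] z w4 frob_fixed_add[OF two] by auto
      moreover have "z = w + (w + z)" by (simp add: add.assoc[symmetric] char2(1))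
      ultimately show ?thesis by blast
    qed
  next
    fix z assume "z \<in> frob_fixed d \<union> (+) w ` frob_fixed d"
    then consider "z \<in> frob_fixed d" | x where "z = w + x" "x \<in> frob_fixed d" by auto
    then show "z \<in> ?R"
    proof cases
      case 1
      then have "z ^ q + z = 0" using sub fixq eq0 by auto
      then show ?thesis using 1 sub by simp
    next
      case 2
      then have "z \<in> frob_fixed (4 * d)" using w4 sub frob_fixed_add[OF two] by auto
      moreover have "w + z = x" using 2 by (simp add: add.assoc[symmetric] char2(1))
      then have "z ^ q + z = 1" using eq1[of z] 2 sub fixq eq0 by auto
      ultimately show ?thesis by (simp add: h01)
    qed
  qed
qed

text \<open>As for a Gauss sum, put \<open>y = x + z\<close> in the double sum. For fixed
  \<open>z\<close> the sum over \<open>x\<close> is a character sum that vanishes unless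
  \<open>z\<close> lies in the radical. The form is zero there, so the square is
  \<open>2 ^ (4 * d)\<close> times the \<open>2 ^ (d + 1)\<close> elements of the radical.\<close>

lemma quad_sum_square:
  assumes d: "d dvd m"
  shows "(quad_sum d)\<^sup>2 = 2 ^ (5 * d + 1)"
proof -
  define e where "e = 4 * d"
  let ?E = "frob_fixed e :: 'k set"
  obtain w :: 'k where w: "w\<^sup>2 = w + 1" using ex_omega by auto
  let ?h = "\<lambda>z::'k. z ^ q + z"
  let ?R = "{z \<in> ?E. (?h z)\<^sup>2 + ?h z = 0}"
  have e: "e dvd n" using dvd_n[OF d] by (simp add: e_def)
  note cl = frob_fixed_closed frob_fixed_add[OF two] F_closed
  have chi: "sign_char (abs_trace e (x + y)) = sign_char (abs_trace e x) * sign_char (abs_trace e y)"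
    if "x \<in> ?E" "y \<in> ?E" for x y
    using that sign_char_add[OF two abs_trace_01[OF two] abs_trace_01[OF two]]
    by (simp only: abs_trace_add[OF two])
  have shift: "(\<Sum>y\<in>?E. g y) = (\<Sum>z\<in>?E. g (x + z))" if x: "x \<in> ?E" for x and g :: "'k \<Rightarrow> int"
  proof -
    have "x + (x + y) = y" for y using char2(1)[of x] by (simp only: add.assoc[symmetric] add_0_left)
    then show ?thesis
      by (intro sum.reindex_bij_witness[of _ "\<lambda>z. x + z" "\<lambda>z. x + z"]) (use x cl in auto)
  qed
  have "(quad_sum d)\<^sup>2 = (\<Sum>x\<in>?E. \<Sum>y\<in>?E. sign_char (abs_trace e (F x)) * sign_char (abs_trace e (F y)))"
    by (simp add: quad_sum_def e_def power2_eq_square sum_product)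
  also have "\<dots> = (\<Sum>x\<in>?E. \<Sum>z\<in>?E. sign_char (abs_trace e (F x)) * sign_char (abs_trace e (F (x + z))))"
    by (rule sum.cong[OF refl], rule shift)
  also have "\<dots> = (\<Sum>x\<in>?E. \<Sum>z\<in>?E. sign_char (abs_trace e (F z)) *
      sign_char (abs_trace e (x ^ q * ((?h z)\<^sup>2 + ?h z) ^ q0)))"
  proof (intro sum.cong refl)
    fix x z assume x: "x \<in> ?E" and z: "z \<in> ?E"
    have "sign_char (abs_trace e (F (x + z))) = sign_char (abs_trace e (F x)) * sign_char (abs_trace e (F z))
        * sign_char (abs_trace e (x ^ q0 * (z ^ q + z) + z ^ q0 * (x ^ q + x)))"
      unfolding F_add using x z by (subst chi, simp_all only: cl chi)
    then show "sign_char (abs_trace e (F x)) * sign_char (abs_trace e (F (x + z))) = sign_char (abs_trace e (F z)) *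
      sign_char (abs_trace e (x ^ q * ((?h z)\<^sup>2 + ?h z) ^ q0))"
      unfolding trace_polar_form[OF x z] using sign_char_square[of "abs_trace e (F x)"] by (simp add: sign_char_def)
  qed
  also have "\<dots> = (\<Sum>z\<in>?E. sign_char (abs_trace e (F z)) *
      (\<Sum>x\<in>?E. sign_char (abs_trace e (x ^ q * ((?h z)\<^sup>2 + ?h z) ^ q0))))"
    by (subst sum.swap) (simp add: sum_distrib_left)
  also have "\<dots> = (\<Sum>z\<in>?E. sign_char (abs_trace e (F z)) * (if (?h z)\<^sup>2 + ?h z = 0 then 2 ^ e else 0))"
  proof (intro sum.cong refl)
    fix z assume z: "z \<in> ?E"
    let ?v = "((?h z)\<^sup>2 + ?h z) ^ q0"
    have "(\<Sum>x\<in>?E. sign_char (abs_trace e (x ^ q * ?v))) = (\<Sum>x\<in>?E. sign_char (abs_trace e (x * ?v)))"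
    proof (rule sum.reindex_bij_betw)
      have "inj_on (\<lambda>x::'k. x ^ q) ?E" using frob_fixed_inj[of _ m] by (auto simp: inj_on_def q_def)
      moreover have "(\<lambda>x::'k. x ^ q) ` ?E \<subseteq> ?E" using cl by auto
      ultimately show "bij_betw (\<lambda>x. x ^ q) ?E ?E" by (simp add: bij_betw_def endo_inj_surj)
    qed
    also have "\<dots> = (if ?v = 0 then 2 ^ e else 0)" using z by (intro sum_sign_char_trace[OF e]) (simp add: cl)
    finally show "sign_char (abs_trace e (F z)) * (\<Sum>x\<in>?E. sign_char (abs_trace e (x ^ q * ?v)))
        = sign_char (abs_trace e (F z)) * (if (?h z)\<^sup>2 + ?h z = 0 then 2 ^ e else 0)"
      by (simp add: q0_def)
  qed
  also have "\<dots> = (\<Sum>z\<in>?R. 2 ^ e * sign_char (abs_trace e (F z)))"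
    by (simp add: sum.inter_filter mult.commute if_distrib cong: if_cong)
  also have "\<dots> = (\<Sum>z\<in>?R. 2 ^ e)"
  proof (intro sum.cong refl)
    fix z assume z: "z \<in> ?R"
    \<comment> \<open>The radical lies in the subfield of degree \<open>2 * d\<close>, and the trace
      from degree \<open>4 * d\<close> vanishes on that subfield.\<close>
    have z2: "z \<in> frob_fixed (2 * d)"
      using z radical_eq[OF d w] omega_powers(1)[OF w]
      by (auto simp: e_def intro!: frob_fixed_add[OF two]
          intro: frob_fixed_mono[of d "2 * d"] frob_fixed_mono[of 2 "2 * d"])
    have "(?h z) * (?h z - 1) = 0" using z
      by (simp only: char2(3) power2_eq_square distrib_left mult_1_right mem_Collect_eq)
    then consider "?h z = 0" | "?h z = 1" by auto
    then have "abs_trace e (F z) = 0"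
    proof cases
      case 2
      then have "abs_trace e (F z) = abs_trace (2 * d * 2) (z ^ q0)"
        by (simp add: F_def e_def mult.commute mult.left_commute)
      also have "\<dots> = of_nat 2 * abs_trace (2 * d) (z ^ q0)"
        by (intro abs_trace_mult_degree) (simp only: cl z2)
      finally show ?thesis using two by simp
    qed (simp add: F_def)
    then show "2 ^ e * sign_char (abs_trace e (F z)) = 2 ^ e" by (simp add: sign_char_def)
  qed
  also have "\<dots> = 2 ^ e * int (card ?R)" by simp
  also have "card ?R = 2 ^ (d + 1)"
  proof -
    have "frob_fixed d \<inter> (+) w ` frob_fixed d = {}"
    proof (rule ccontr)
      assume "\<not> ?thesis"
      then obtain x y where xy: "x \<in> frob_fixed d" "y \<in> frob_fixed d" "x = w + y" by auto
      then have "x + y = w" by (simp only: add.assoc char2(1) add_0_right)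
      then have "w \<in> frob_fixed d" using frob_fixed_add[OF two xy(1,2)] by simp
      then have "w \<in> frob_fixed m" using d frob_fixed_mono by blast
      then show False using omega_powers(2)[OF w] by (simp add: q_def frob_fixed_def)
    qed
    then show ?thesis using card_frob_fixed[of d] dvd_trans[OF d m_dvd] radical_eq[OF d w]
      by (simp add: e_def card_Un_disjoint card_image)
  qed
  finally show ?thesis by (simp add: e_def power_add[symmetric])
qed

end

section \<open>The sign of the exponential sum, by descent to F_16\<close>

context suzuki4
begin

text \<open>The Frobenius power fixing F_(2^(4 d)) permutes the larger field with period
  \<open>p\<close> and preserves the form. Because \<open>p\<close> is odd, both traces agree on the
  fixed points.\<close>

lemma quad_sum_cong:
  assumes d: "d * p dvd m" and p: "prime p"
  shows "[quad_sum (d * p) = quad_sum d] (mod int p)"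
proof -
  let ?f = "\<lambda>x::'k. x ^ (2 ^ (4 * d))"
  let ?e = "4 * (d * p)"
  let ?A = "frob_fixed ?e :: 'k set"
  have odd_p: "odd p" using d odd_m by (metis dvd_mult_right dvd_trans)
  have "[(\<Sum>x\<in>?A. sign_char (abs_trace ?e (F x)))
      = (\<Sum>x\<in>{x \<in> ?A. ?f x = x}. sign_char (abs_trace ?e (F x)))] (mod int p)"
  proof (rule sum_sign_cong_fixed_points[OF _ p])
    fix x assume x: "x \<in> ?A"
    show "?f x \<in> ?A" using x by (simp add: frob_fixed_closed)
    have "(?f ^^ k) x = x ^ (2 ^ (4 * d * k))" for k
      by (induction k) (simp_all add: frobenius_comp add.commute)
    then show "(?f ^^ p) x = x" using x by (simp add: frob_fixed_def mult.assoc)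
    show "sign_char (abs_trace ?e (F x)) = 1 \<or> sign_char (abs_trace ?e (F x)) = - 1"
      by (simp add: sign_char_def)
    have "F (?f x) = (F x) ^ (2 ^ (4 * d))"
      by (simp add: F_def power_mult_distrib frob_add power_mult[symmetric] mult.commute)
    then show "sign_char (abs_trace ?e (F (?f x))) = sign_char (abs_trace ?e (F x))"
      using abs_trace_frobenius[OF two F_closed[OF x]] by simp
  qed simp
  also have "{x \<in> ?A. ?f x = x} = frob_fixed (4 * d)"
    using frob_fixed_mono[of "4 * d" ?e] by (auto simp: frob_fixed_def[of "4 * d"])
  also have "(\<Sum>x\<in>frob_fixed (4 * d). sign_char (abs_trace ?e (F x))) = quad_sum d"
    unfolding quad_sum_def
  proof (intro sum.cong refl)
    fix x :: 'k assume x: "x \<in> frob_fixed (4 * d)"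
    have "of_nat p = (1::'k)" using odd_p two by (elim oddE) simp
    then show "sign_char (abs_trace ?e (F x)) = sign_char (abs_trace (4 * d) (F x))"
      using abs_trace_mult_degree[OF F_closed[OF x], of p] by (simp add: mult.assoc)
  qed
  finally show ?thesis by (simp add: quad_sum_def)
qed

text \<open>Outside F_4 the cube is a primitive fifth root of unity, and its four conjugates are all
  the primitive fifth roots, with sum 1. On F_4 the trace from F_16 vanishes.\<close>

lemma trace4_cube:
  fixes x :: 'k
  assumes x: "x \<in> frob_fixed 4"
  shows "abs_trace 4 (x ^ 3) = (if x \<in> frob_fixed 2 then 0 else 1)"
proof (cases "x \<in> frob_fixed 2")
  case True
  then have "abs_trace (2 * 2) (x ^ 3) = of_nat 2 * abs_trace 2 (x ^ 3)"
    by (intro abs_trace_mult_degree) (simp add: frob_fixed_closed)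
  then show ?thesis using True two by simp
next
  case False
  define z where "z = x ^ 3"
  have x0: "x \<noteq> 0" using False by (auto simp: frob_fixed_def)
  have "x * x ^ 15 = x * 1" using x by (simp add: frob_fixed_def power_Suc[symmetric])
  then have z5: "z ^ 5 = 1" using x0 by (simp add: z_def power_mult[symmetric])
  have "x * z \<noteq> x * 1" using False by (simp add: frob_fixed_def z_def power_Suc[symmetric])
  then have z1: "z \<noteq> 1" by auto
  have "(z - 1) * (1 + z + z ^ 2 + z ^ 3 + z ^ 4) = z ^ 5 - 1"
    by (simp add: power_numeral_reduce algebra_simps)
  then have "1 + (z + z ^ 2 + z ^ 3 + z ^ 4) = 0" using z1 z5 by (simp add: add.assoc)
  then have "z + z ^ 2 + z ^ 3 + z ^ 4 = 1" using add_eq_0[of 1] by simp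
  moreover have "z ^ 8 = z ^ 5 * z ^ 3" by (simp only: power_add[symmetric]) simp
  then have "z ^ 8 = z ^ 3" using z5 by simp
  ultimately show ?thesis using False
    by (simp add: abs_trace_def z_def[symmetric] lessThan_nat_numeral power2_eq_square add_ac)
qed

lemma trace4_frob_fixed_2:
  assumes "(x::'k) \<in> frob_fixed 2"
  shows "abs_trace 4 x = 0"
  using abs_trace_mult_degree[OF assms, of 2] two by simp

text \<open>On F_16 only \<open>a\<close> modulo 4 matters, which amounts to \<open>m\<close> modulo
  8. The terms \<open>x ^ 5\<close> that arise lie in F_4 and have trace 0.\<close>

lemma trace4_F:
  assumes x: "x \<in> frob_fixed 4"
  shows "abs_trace 4 (F x) = abs_trace 4 (x ^ 3) + (if jac2 m = 1 then abs_trace 4 x else 0)"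
proof -
  have x16: "x ^ 16 = x" using x by (simp add: frob_fixed_def)
  have fr: "abs_trace 4 (y ^ (2 ^ k)) = abs_trace 4 y" if "y \<in> frob_fixed 4" for y :: 'k and k
    using that by (rule abs_trace_frobenius[OF two])
  have x5: "abs_trace 4 (x ^ 5) = 0"
  proof (rule trace4_frob_fixed_2)
    have "(x ^ 5) ^ 4 = x ^ 16 * x ^ 4" by (simp only: power_mult[symmetric] power_add[symmetric]) simp
    then show "x ^ 5 \<in> frob_fixed 2" using x16 by (simp add: frob_fixed_def power_Suc[symmetric])
  qed
  have F: "F x = x ^ (2 ^ (a mod 4)) * (x ^ (2 ^ (m mod 4)) + x)"
    unfolding F_def unfolding q0_def q_def using frob_fixed_mod[OF x] by metis
  note tr = abs_trace_add[OF two]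
  have m8: "m = 8 * (a div 4) + (2 * (a mod 4) + 1)" unfolding m_def using div_mult_mod_eq[of a 4] by linarith
  then have m4: "m = 4 * (2 * (a div 4)) + (2 * (a mod 4) + 1)" by linarith
  have mm: "m mod 4 = (2 * (a mod 4) + 1) mod 4" "m mod 8 = (2 * (a mod 4) + 1) mod 8"
    by (subst m4, rule mod_mult_self4, subst m8, rule mod_mult_self4)
  consider "a mod 4 = 0" | "a mod 4 = 1" | "a mod 4 = 2" | "a mod 4 = 3"
    using mod_less_divisor[of 4 a] by linarith
  then show ?thesis
  proof cases
    case 1
    then have "m mod 4 = 1" "m mod 8 = 1" using mm by simp_all
    then show ?thesis using 1 fr[OF x, of 1]
      by (simp add: F tr distrib_left jac2_def power_numeral_reduce)
  next
    case 2
    then have "m mod 4 = 3" "m mod 8 = 3" using mm by simp_all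
    then have "F x = (x ^ 5) ^ (2 ^ 1) + x ^ 3" using 2
      by (simp add: F distrib_left power_numeral_reduce)
    then show ?thesis using \<open>m mod 8 = 3\<close> fr[of "x ^ 5" 1] x x5
      by (simp add: tr jac2_def frob_fixed_closed)
  next
    case 3
    then have "m mod 4 = 1" "m mod 8 = 5" using mm by simp_all
    then have "F x = (x ^ 3) ^ (2 ^ 1) + x ^ 5" using 3
      by (simp add: F distrib_left power_numeral_reduce)
    then show ?thesis using \<open>m mod 8 = 5\<close> fr[of "x ^ 3" 1] x x5
      by (simp add: tr jac2_def frob_fixed_closed)
  next
    case 4
    then have "m mod 4 = 3" "m mod 8 = 7" using mm by simp_all
    have "F x = x ^ 16 + x ^ 9" using 4 \<open>m mod 4 = 3\<close>
      by (simp add: F distrib_left power_numeral_reduce)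
    then have Fx: "F x = x + x ^ 9" using x16 by simp
    have "(x ^ 9) ^ (2 ^ 1) = x ^ 16 * x ^ 2" by (simp only: power_mult[symmetric] power_add[symmetric]) simp
    then have "(x ^ 9) ^ (2 ^ 1) = x ^ 3" using x16 by (simp add: power_numeral_reduce)
    then have "abs_trace 4 (x ^ 9) = abs_trace 4 (x ^ 3)"
      using fr[of "x ^ 9" 1] x by (simp only: frob_fixed_closed)
    then show ?thesis using \<open>m mod 8 = 7\<close> by (simp add: Fx tr jac2_def)
  qed
qed

text \<open>F_4 contributes 4. The twelve other elements contribute -12 if
  \<open>jac2 m = - 1\<close>; otherwise their signs are twisted by the trace of \<open>x\<close>,
  and orthogonality gives 4.\<close>

lemma quad_sum_1: "quad_sum 1 = 8 * jac2 m"
proof -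
  let ?E2 = "frob_fixed 2 :: 'k set" and ?E4 = "frob_fixed 4 :: 'k set"
  have n4: "2 dvd n" "4 dvd n" using n_def by auto
  have sub: "?E2 \<subseteq> ?E4" using frob_fixed_mono[of 2 4] by auto
  have card: "card ?E2 = 4" "card ?E4 = 16" using card_frob_fixed n4 by auto
  then have cardD: "card (?E4 - ?E2) = 12" using card_Diff_subset[of ?E2 ?E4] sub by simp
  have split: "(\<Sum>x\<in>?E4. g x) = (\<Sum>x\<in>?E4 - ?E2. g x) + (\<Sum>x\<in>?E2. g x)" for g :: "'k \<Rightarrow> int"
    using sum.subset_diff[OF sub, of g] by simp
  have j: "jac2 m = 1 \<or> jac2 m = - 1" by (simp add: jac2_def)
  have "quad_sum 1 = (\<Sum>x\<in>?E4. sign_char (abs_trace 4 (F x)))" by (simp add: quad_sum_def)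
  also have "\<dots> = (\<Sum>x\<in>?E4 - ?E2. - (if jac2 m = 1 then sign_char (abs_trace 4 x) else 1)) + (\<Sum>x\<in>?E2. 1)"
    unfolding split
  proof (intro arg_cong2[of _ _ _ _ "(+)"] sum.cong refl)
    fix x assume "x \<in> ?E4 - ?E2"
    then have x: "x \<in> ?E4" "x \<notin> ?E2" by auto
    show "sign_char (abs_trace 4 (F x)) = - (if jac2 m = 1 then sign_char (abs_trace 4 x) else 1)"
      using abs_trace_01[OF two x(1)] x char2(1)[of 1]
      by (auto simp: trace4_F[OF x(1)] trace4_cube[OF x(1)] sign_char_def)
  next
    fix x assume x: "x \<in> ?E2"
    then have "x \<in> ?E4" using sub by auto
    then show "sign_char (abs_trace 4 (F x)) = 1"
      using x trace4_frob_fixed_2[OF x] by (simp add: trace4_F trace4_cube sign_char_def)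
  qed
  also have "\<dots> = 8 * jac2 m"
  proof (cases "jac2 m = 1")
    case True
    have "(\<Sum>x\<in>?E4. sign_char (abs_trace 4 x)) = 0"
      using sum_sign_char_trace[OF n4(2), of 1] by (simp add: frob_fixed_closed)
    moreover have "(\<Sum>x\<in>?E2. sign_char (abs_trace 4 x)) = 4"
      using card by (simp add: trace4_frob_fixed_2 sign_char_def)
    ultimately have "(\<Sum>x\<in>?E4 - ?E2. sign_char (abs_trace 4 x)) = - 4"
      using split[of "\<lambda>x. sign_char (abs_trace 4 x)"] by simp
    then show ?thesis using True card by (simp add: sum_negf)
  next
    case False
    then show ?thesis using j card cardD by simp
  qed
  finally show ?thesis .
qed

text \<open>The square fixes the sum up to sign, and the congruence modulo an odd prime factor
  \<open>p\<close> of \<open>d\<close> fixes the sign in terms of the sum for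
  \<open>d / p\<close>.\<close>

lemma quad_sum_eq:
  assumes "d dvd m"
  shows "quad_sum d = jac2 d * jac2 m * 2 ^ ((5 * d + 1) div 2)"
  using assms
proof (induction d rule: less_induct)
  case (less d)
  have oddd: "odd d" using less.prems odd_m dvd_trans by blast
  show ?case
  proof (cases "d = 1")
    case True
    then show ?thesis using quad_sum_1 by (simp add: jac2_def[of "Suc 0"])
  next
    case False
    then obtain p where p: "prime p" "p dvd d" using prime_factor_nat by blast
    then obtain e where e: "d = e * p" by (metis dvdE mult.commute)
    have oddep: "odd e" "odd p" using oddd e by auto
    have e0: "e > 0" using oddep by (auto intro: Nat.gr0I)
    have "e < d" using e e0 prime_gt_1_nat[OF p(1)] by simp
    moreover have "e dvd m" using less.prems e dvd_mult_left by blast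
    ultimately have IH: "quad_sum e = jac2 e * jac2 m * 2 ^ ((5 * e + 1) div 2)" using less.IH by blast
    have J2: "jac2 p ^ (5 * e) = jac2 p" using oddep by (simp add: jac2_def)
    let ?k = "(5 * d + 1) div 2" and ?l = "(5 * e + 1) div 2"
    define T where "T = jac2 d * jac2 m * 2 ^ ?k"
    \<comment> \<open>The additional power of 2 is \<open>2 ^ ((p - 1) div 2)\<close> raised to an
      odd exponent, hence congruent to \<open>jac2 p\<close>.\<close>
    have k: "?k = ?l + ((p - 1) div 2) * (5 * e)"
    proof -
      from oddep obtain u v where "e = 2 * u + 1" "p = 2 * v + 1" by (metis oddE)
      then show ?thesis by (simp add: e algebra_simps)
    qed
    have "[T = jac2 d * jac2 m * (2 ^ ?l * jac2 p ^ (5 * e))] (mod int p)"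
      unfolding T_def k power_add power_mult
      by (intro cong_mult cong_refl cong_pow two_power_half p(1) oddep(2))
    also have "jac2 d * jac2 m * (2 ^ ?l * jac2 p ^ (5 * e)) = quad_sum e"
      using jac2_square[of p] by (simp only: J2 IH e jac2_mult[OF oddep]) (simp add: algebra_simps)
    finally have c: "[quad_sum d = T] (mod int p)"
      using quad_sum_cong[of e p] less.prems p e cong_trans cong_sym by metis
    have "5 * d + 1 = ?k * 2" using oddd by presburger
    then have "(quad_sum d)\<^sup>2 = (2 ^ ?k)\<^sup>2" using quad_sum_square[OF less.prems] by (metis power_mult)
    also have "\<dots> = T\<^sup>2"
      by (simp add: T_def power_mult_distrib power2_eq_square[of "jac2 _"] jac2_square)
    finally have "(quad_sum d)\<^sup>2 = T\<^sup>2" .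
    then have "quad_sum d = T \<or> quad_sum d = - T" by (simp add: power2_eq_iff)
    \<comment> \<open>The wrong sign would make the odd prime \<open>p\<close> divide a power of
      2.\<close>
    moreover have "quad_sum d \<noteq> - T"
    proof
      assume "quad_sum d = - T"
      then have "int p dvd 2 * T" using c by (simp add: cong_iff_dvd_diff)
      moreover have "\<bar>2 * T\<bar> = int (2 ^ (?k + 1))" by (simp add: T_def abs_mult jac2_def)
      ultimately have "int p dvd int (2 ^ (?k + 1))" by (metis dvd_abs_iff)
      then have "p dvd 2 ^ (?k + 1)" by (simp only: int_dvd_int_iff)
      then have "p dvd 2" using p(1) prime_dvd_power by blast
      then show False using oddep(2) p(1) by (metis primes_dvd_imp_eq two_is_prime_nat even_numeral)
    qed
    ultimately show ?thesis by (simp add: T_def)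
  qed
qed

text \<open>The two factors \<open>jac2 m\<close> cancel, so the sign is positive for every
  \<open>m\<close>.\<close>

lemma quad_sum_m: "quad_sum m = 2 * int q0 * int q ^ 2"
proof -
  have "(5 * m + 1) div 2 = Suc (a + m * 2)" unfolding m_def by simp
  then have "quad_sum m = 2 ^ Suc (a + m * 2)" using quad_sum_eq[of m] jac2_square[of m] by simp
  also have "\<dots> = 2 * int q0 * int q ^ 2" by (simp only: q0_def q_def power_Suc power_add power_mult) simp
  finally show ?thesis .
qed

end

section \<open>The image of \<open>y ^ q + y\<close> and the count of abscissas\<close>

context suzuki
begin

lemma q_pos: "q > 0" "q0 > 0" "q \<ge> 2" by (auto simp: q_def q0_def m_def)

lemma q_eq: "q = 2 * q0 * q0"
  by (simp add: q_def q0_def m_def power_add mult_2 distrib_right)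

lemma card_Fq: "card (frob_fixed m :: 'k set) = q"
  using card_frob_fixed[OF m_dvd] by (simp add: q_def)

lemma frob_fixed_UNIV: "(frob_fixed n :: 'k set) = UNIV"
  using frob_fixed_n by auto

text \<open>Here \<open>c\<close> runs over F_q while the trace is that of the whole field, so the
  sum may be nonzero for a nonzero \<open>w\<close>.\<close>

lemma sum_Fq_sign_char:
  fixes w :: 'k
  shows "(\<Sum>c\<in>frob_fixed m. sign_char (abs_trace n (c * w)))
    = (if \<forall>c\<in>frob_fixed m. abs_trace n (c * w) = 0 then int q else 0)"
  unfolding card_Fq[symmetric]
  by (rule sum_sign_char_additive[OF two])
    (auto simp: frob_fixed_add[OF two] char2(1) distrib_right abs_trace_add[OF two]
      intro!: abs_trace_01[OF two frob_fixed_n, simplified])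

text \<open>Additive Hilbert 90 by counting. Frobenius invariance of the trace gives one inclusion;
  the right side has \<open>2 ^ n / q\<close> elements by orthogonality, and the left side at least
  as many since its fibres have at most \<open>q\<close> elements.\<close>

lemma image_artin_schreier:
  "range (\<lambda>y::'k. y ^ q + y) = {w. \<forall>c\<in>frob_fixed m. abs_trace n (c * w) = 0}"
    (is "?I = ?M")
proof (rule card_subset_eq)
  show sub: "?I \<subseteq> ?M"
  proof (clarify)
    fix y c :: 'k assume c: "c \<in> frob_fixed m"
    have "c * (y ^ q + y) = (c * y) ^ (2 ^ m) + c * y"
      using c by (simp add: q_def power_mult_distrib frob_fixed_def distrib_left)
    then show "abs_trace n (c * (y ^ q + y)) = 0"
      using abs_trace_frobenius[OF two frob_fixed_n, of "c * y" m]
      by (simp add: abs_trace_add[OF two] char2(1))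
  qed
  have "(\<Sum>w\<in>UNIV. \<Sum>c\<in>frob_fixed m. sign_char (abs_trace n (c * (w::'k))))
      = (\<Sum>c\<in>frob_fixed m. \<Sum>w\<in>UNIV. sign_char (abs_trace n (w * (c::'k))))"
    by (subst sum.swap) (simp add: mult.commute)
  also have "\<dots> = (\<Sum>c\<in>frob_fixed m. if (c::'k) = 0 then 2 ^ n else 0)"
    using sum_sign_char_trace[OF dvd_refl frob_fixed_n] by (simp add: frob_fixed_UNIV)
  also have "\<dots> = 2 ^ n" by (simp add: sum.delta frob_fixed_closed)
  also have "(\<Sum>w\<in>UNIV. \<Sum>c\<in>frob_fixed m. sign_char (abs_trace n (c * (w::'k)))) = int (q * card ?M)"
    unfolding sum_Fq_sign_char by (simp add: sum.inter_filter[symmetric])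
  finally have "int (q * card ?M) = int (2 ^ n)" by simp
  then have M: "q * card ?M = 2 ^ n" by (simp only: of_nat_eq_iff)
  have "CARD('k) \<le> card ?I * q"
  proof (rule card_le_fibers[OF _ order_refl])
    fix b :: 'k
    show "card {x \<in> UNIV. x ^ q + x = b} \<le> q"
    proof -
      have "{x \<in> UNIV. x ^ q + x = b} = {x. (\<Sum>i<2. x ^ (2 ^ (m * i))) = b}"
        by (simp add: q_def lessThan_nat_numeral)
      then show ?thesis using card_frobenius_sum_fiber[of 2 m b] m_def by (simp add: q_def)
    qed
  qed simp
  then have "q * card ?M \<le> q * card ?I" unfolding M card_K by (simp only: mult.commute)
  then have "card ?M \<le> card ?I" using q_pos(1) by (simp only: mult_le_cancel1)
  moreover have "card ?I \<le> card ?M" by (rule card_mono[OF _ sub]) simp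
  ultimately show "card ?I = card ?M" by simp
qed simp

text \<open>From \<open>q = 2 * q0 * q0\<close> it follows that \<open>q + 1 - 2 * q0\<close>
  inverts \<open>q0 + 1\<close> modulo \<open>q - 1\<close>, so a power of \<open>c\<close> is the
  root.\<close>

lemma ex_root_Fq:
  assumes "c \<in> frob_fixed m" "(c::'k) \<noteq> 0"
  shows "\<exists>z \<in> frob_fixed m. z \<noteq> 0 \<and> z ^ (q0 + 1) = c"
proof -
  let ?z = "c ^ (q + 1 - 2 * q0)"
  have le: "2 * q0 \<le> q + 1" unfolding q_eq
    using q_pos(2) by (intro trans_le_add1) (simp add: mult.assoc)
  have "c ^ (q - 1) * c = 1 * c"
    using power_minus_mult[OF q_pos(1), of c] assms by (simp add: frob_fixed_def q_def[symmetric])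
  then have c1: "c ^ (q - 1) = 1" using assms by simp
  have "(q + 1 - 2 * q0) * (q0 + 1) = (q - 1) * q0 + 1"
  proof -
    have "int ((q + 1 - 2 * q0) * (q0 + 1)) = (int q + 1 - 2 * int q0) * (int q0 + 1)"
      by (simp only: of_nat_mult of_nat_add of_nat_diff[OF le] of_nat_1 of_nat_numeral)
    also have "\<dots> = (int q - 1) * int q0 + 1 + (int q - 2 * int q0 * int q0)" by (simp add: algebra_simps)
    also have "int q - 2 * int q0 * int q0 = 0" by (simp add: q_eq)
    also have "(int q - 1) * int q0 + 1 + 0 = int ((q - 1) * q0 + 1)" using q_pos(1)
      by (simp only: of_nat_mult of_nat_add of_nat_diff of_nat_1 Suc_leI One_nat_def[symmetric] add_0_right)
    finally show ?thesis by linarith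
  qed
  then have "?z ^ (q0 + 1) = c ^ ((q - 1) * q0 + 1)" by (metis power_mult)
  also have "\<dots> = c" by (simp only: power_add power_mult c1) simp
  finally show ?thesis using assms by (intro bexI[of _ ?z]) (auto simp: frob_fixed_closed)
qed

text \<open>Zero is left out so that the nonzero elements of F_q act freely by scaling.\<close>

definition suzuki_x :: "'k set" where
  "suzuki_x = {x. x \<noteq> 0 \<and> (\<exists>y. y ^ q + y = F x)}"

lemma suzuki_x_scale:
  assumes "x \<in> suzuki_x" "z \<in> frob_fixed m" "z \<noteq> 0"
  shows "z * x \<in> suzuki_x"
proof -
  from assms obtain y where y: "x \<noteq> 0" "y ^ q + y = F x" by (auto simp: suzuki_x_def)
  have "(z ^ (q0 + 1) * y) ^ q + z ^ (q0 + 1) * y = (z ^ q) ^ (q0 + 1) * y ^ q + z ^ (q0 + 1) * y"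
    by (simp only: power_mult_distrib power_mult[symmetric] mult.commute[of q])
  also have "\<dots> = z ^ (q0 + 1) * (y ^ q + y)"
    using assms(2) by (simp add: q_def[symmetric] frob_fixed_def distrib_left)
  finally show ?thesis using y assms F_scale[OF assms(2)] by (auto simp: suzuki_x_def)
qed

end

context suzuki4
begin

text \<open>Evaluate one double sum in two ways. Summing over \<open>c\<close> in F_q first detects
  the \<open>x\<close> with a point above them. Summing over \<open>x\<close> first gives
  \<open>q ^ 4\<close> for \<open>c = 0\<close> and \<open>quad_sum m\<close> otherwise, as
  \<open>c = z ^ (q0 + 1)\<close> is absorbed by replacing \<open>x\<close> with
  \<open>z * x\<close>.\<close>

lemma card_suzuki_x: "card suzuki_x = (q - 1) * (q\<^sup>2 + 2 * q * q0 + q + 1)"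
proof -
  let ?Z = "{x. \<exists>y. y ^ q + y = F x}"
  have nm: "4 * m = n" using n_def by simp
  have "(\<Sum>c\<in>frob_fixed m. \<Sum>x\<in>UNIV. sign_char (abs_trace n (c * F x)))
      = (\<Sum>c\<in>frob_fixed m. if (c::'k) = 0 then int q ^ 4 else quad_sum m)"
  proof (intro sum.cong refl)
    fix c :: 'k assume c: "c \<in> frob_fixed m"
    show "(\<Sum>x\<in>UNIV. sign_char (abs_trace n (c * F x))) = (if c = 0 then int q ^ 4 else quad_sum m)"
    proof (cases "c = 0")
      case True
      then show ?thesis using card_K
        by (simp add: sign_char_def q_def n_def power_mult[symmetric] mult.commute)
    next
      case False
      then obtain z where z: "z \<in> frob_fixed m" "z \<noteq> 0" "z ^ (q0 + 1) = c" using ex_root_Fq[OF c] by auto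
      have "(\<Sum>x\<in>UNIV. sign_char (abs_trace n (c * F x))) = (\<Sum>x\<in>UNIV. sign_char (abs_trace n (F (z * x))))"
        using z F_scale[OF z(1)] by simp
      also have "\<dots> = (\<Sum>x\<in>UNIV. sign_char (abs_trace n (F x)))"
        by (rule sum.reindex_bij_witness[of _ "\<lambda>x. x / z" "\<lambda>x. z * x"]) (use z in auto)
      finally show ?thesis using False by (simp add: quad_sum_def nm frob_fixed_UNIV)
    qed
  qed
  also have "\<dots> = int q ^ 4 + (int q - 1) * quad_sum m"
  proof -
    have "(\<Sum>c\<in>frob_fixed m. if (c::'k) = 0 then int q ^ 4 else quad_sum m)
      = int q ^ 4 + (\<Sum>c\<in>frob_fixed m - {0::'k}. quad_sum m)"
      by (subst sum.remove[of _ 0]) (auto simp: frob_fixed_closed intro!: sum.cong)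
    also have "(\<Sum>c\<in>frob_fixed m - {0::'k}. quad_sum m) = (int q - 1) * quad_sum m"
      using card_Fq q_pos by (simp add: card_Diff_singleton frob_fixed_closed of_nat_diff)
    finally show ?thesis .
  qed
  also have "(\<Sum>c\<in>frob_fixed m. \<Sum>x\<in>UNIV. sign_char (abs_trace n (c * F x)))
      = (\<Sum>x\<in>UNIV. if F x \<in> range (\<lambda>y. y ^ q + y) then int q else 0)"
    by (subst sum.swap) (simp add: sum_Fq_sign_char image_artin_schreier)
  also have "\<dots> = int q * int (card ?Z)"
  proof -
    have "?Z = {x. F x \<in> range (\<lambda>y. y ^ q + y)}" by (auto simp: image_iff) metis
    then show ?thesis by (simp add: sum.inter_filter[symmetric])
  qed
  finally have "int q * int (card ?Z) = int q * (int q ^ 3 + 2 * int q0 * int q * (int q - 1))"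
    unfolding quad_sum_m by (simp add: algebra_simps power_numeral_reduce)
  then have Z: "int (card ?Z) = int q ^ 3 + 2 * int q0 * int q * (int q - 1)" using q_pos by simp
  have "0 \<in> ?Z" using q_pos by (auto simp: F_def intro!: exI[of _ 0])
  moreover have "suzuki_x = ?Z - {0}" by (auto simp: suzuki_x_def)
  moreover have "card ?Z > 0" using \<open>0 \<in> ?Z\<close> card_gt_0_iff by fastforce
  ultimately have "int (card suzuki_x) = int (card ?Z) - 1" by (simp add: card_Diff_singleton of_nat_diff)
  also have "\<dots> = (int q - 1) * (int q ^ 2 + 2 * int q * int q0 + int q + 1)"
    unfolding Z by (simp add: algebra_simps power_numeral_reduce)
  also have "\<dots> = int ((q - 1) * (q\<^sup>2 + 2 * q * q0 + q + 1))"
    using q_pos by (simp only: of_nat_mult of_nat_add of_nat_diff of_nat_1 of_nat_power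
        of_nat_numeral One_nat_def[symmetric])
  finally show ?thesis by linarith
qed

end

section \<open>Irreducibility of the Suzuki polynomial\<close>

lemma two_poly_0: "(2::'a::comm_ring_1) = 0 \<Longrightarrow> (2::'a poly) = 0"
  by (metis of_nat_numeral of_nat_poly pCons_0_0)

lemma pcompose_power: "pcompose (p ^ k) r = pcompose p r ^ k" for p :: "'a::comm_semiring_1 poly"
  by (induction k) (simp_all add: pcompose_mult pcompose_1)

text \<open>Translation keeps the degree and the leading coefficient; the first alternative takes
  care of constants.\<close>

lemma degree_pcompose_linear_diff:
  fixes p :: "'a::idom poly"
  shows "pcompose p [:c, 1:] - p = 0 \<or> degree (pcompose p [:c, 1:] - p) < degree p"
proof (rule disjCI)
  let ?D = "pcompose p [:c, 1:] - p"
  have deg: "degree (pcompose p [:c, 1:]) = degree p" by (simp add: degree_pcompose)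
  have "Polynomial.coeff ?D (degree p) = 0"
    using lead_coeff_comp[of "[:c, 1:]" p] deg by simp
  moreover have "degree ?D \<le> degree p" using deg by (intro degree_diff_le) auto
  moreover assume "\<not> degree ?D < degree p"
  ultimately show "?D = 0" using leading_coeff_0_iff[of ?D] by auto
qed

section \<open>Evaluation of K[X, Y] in a domain that contains K[X]\<close>

locale poly_embedding =
  fixes emb :: "'k::field poly \<Rightarrow> 'd::idom"
  assumes emb_add: "emb (p + r) = emb p + emb r"
    and emb_mult: "emb (p * r) = emb p * emb r"
    and emb_1: "emb 1 = 1"
    and emb_eq_0: "emb p = 0 \<Longrightarrow> p = 0"
begin

lemma emb_0 [simp]: "emb 0 = 0"
  using emb_add[of 0 0] by (metis add.right_neutral add_left_cancel)

lemma emb_0_iff: "emb p = 0 \<longleftrightarrow> p = 0"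
  using emb_eq_0 by auto

lemma emb_uminus: "emb (- p) = - emb p"
  using emb_add[of p "- p"] by (simp add: add_eq_0_iff)

lemma emb_diff: "emb (p - r) = emb p - emb r"
  using emb_add[of p "- r"] by (simp add: emb_uminus)

lemma emb_inj: "emb p = emb r \<longleftrightarrow> p = r"
  using emb_0_iff[of "p - r"] by (simp add: emb_diff)

lemma emb_power: "emb (p ^ k) = emb p ^ k"
  by (induction k) (simp_all add: emb_mult emb_1)

text \<open>The ring homomorphism on K[X, Y] that extends \<open>emb\<close> and sends
  \<open>Y\<close> to \<open>y\<close>.\<close>

definition ev :: "'d \<Rightarrow> 'k poly poly \<Rightarrow> 'd" where
  "ev y G = poly (map_poly emb G) y"

lemma ev_0 [simp]: "ev y 0 = 0"
  by (simp add: ev_def)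

lemma ev_pCons: "ev y (pCons p G) = emb p + y * ev y G"
  by (simp add: ev_def map_poly_pCons)

lemma ev_const [simp]: "ev y [:p:] = emb p"
  by (simp add: ev_pCons)

lemma ev_1 [simp]: "ev y 1 = 1"
  by (metis ev_const emb_1 one_pCons)

lemma ev_add: "ev y (G + H) = ev y G + ev y H"
proof (induction G arbitrary: H)
  case (pCons p G)
  obtain r H' where "H = pCons r H'" by (cases H) auto
  then show ?case by (simp add: ev_pCons pCons.IH emb_add algebra_simps)
qed simp

lemma ev_smult: "ev y (smult p G) = emb p * ev y G"
  by (induction G) (simp_all add: ev_pCons emb_mult algebra_simps)

lemma ev_mult: "ev y (G * H) = ev y G * ev y H"
  by (induction G) (simp_all add: ev_pCons ev_add ev_smult algebra_simps)

lemma ev_uminus: "ev y (- G) = - ev y G"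
  using ev_add[of y G "- G"] by (simp add: add_eq_0_iff)

lemma ev_diff: "ev y (G - H) = ev y G - ev y H"
  using ev_add[of y G "- H"] by (simp add: ev_uminus)

lemma ev_power: "ev y (G ^ k) = ev y G ^ k"
  by (induction k) (simp_all add: ev_mult)

lemma ev_sum: "ev y (\<Sum>i\<in>A. G i) = (\<Sum>i\<in>A. ev y (G i))"
  by (induction A rule: infinite_finite_induct) (simp_all add: ev_add)

lemma ev_pcompose: "ev y (pcompose G H) = ev (ev y H) G"
  by (induction G) (simp_all add: pcompose_pCons ev_add ev_mult ev_pCons)

lemma ev_monom: "ev y (Polynomial.monom p k) = emb p * y ^ k"
  by (induction k) (simp_all add: monom_0 monom_Suc ev_pCons)

lemma map_poly_emb_0: "map_poly emb G = 0 \<longleftrightarrow> G = 0"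
  by (auto simp: poly_eq_iff coeff_map_poly emb_0_iff)

lemma card_ev_roots:
  assumes "G \<noteq> 0"
  shows "card {y. ev y G = 0} \<le> degree G" "finite {y. ev y G = 0}"
proof -
  have "map_poly emb G \<noteq> 0" using assms map_poly_emb_0 by simp
  then show "card {y. ev y G = 0} \<le> degree G" "finite {y. ev y G = 0}"
    using card_poly_roots_bound[of "map_poly emb G"] poly_roots_finite[of "map_poly emb G"]
    by (auto simp: ev_def degree_map_poly emb_0_iff)
qed

text \<open>
  A fraction that satisfies a monic quadratic equation over the polynomials is a polynomial: for a
  denominator \<open>A\<close> of minimal degree, the remainder of the numerator modulo \<open>A\<close> is again a denominator.
\<close>

lemma quadratic_integral:
  assumes t: "t\<^sup>2 + t = emb u" and A: "A \<noteq> 0" "emb A * t = emb B"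
  shows "\<exists>Q. t = emb Q"
proof -
  define P where "P D \<longleftrightarrow> D \<noteq> 0 \<and> (\<exists>B. emb D * t = emb B)" for D
  have "P A" using A by (auto simp: P_def)
  then obtain D where D: "P D" and min: "\<And>D'. P D' \<Longrightarrow> degree D \<le> degree D'"
    using ex_has_least_nat[of P A degree] by auto
  from D obtain B where D0: "D \<noteq> 0" and B: "emb D * t = emb B" by (auto simp: P_def)
  define Q R where "Q = B div D" and "R = B mod D"
  have BR: "B = D * Q + R" by (simp add: Q_def R_def)
  let ?t = "t - emb Q"
  have R: "emb D * ?t = emb R" using B by (simp add: BR emb_add emb_mult algebra_simps)
  have t2: "?t\<^sup>2 = emb u + emb Q * emb Q - t - (t * emb Q + t * emb Q)"
    using t[symmetric] by (simp add: power2_eq_square algebra_simps)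
  have "emb D * ?t\<^sup>2 = emb D * (emb u + emb Q * emb Q) - emb D * t
      - (emb D * t * emb Q + emb D * t * emb Q)"
    by (simp only: t2) (simp add: algebra_simps)
  then have "emb D * ?t\<^sup>2 = emb (D * (u + Q * Q) - B - (B * Q + B * Q))"
    by (simp only: B emb_add emb_mult emb_diff)
  then have "emb R * ?t = emb (D * (u + Q * Q) - B - (B * Q + B * Q))"
    using R by (simp add: power2_eq_square mult.assoc[symmetric])
  then have "emb R * t = emb (D * (u + Q * Q) - B - (B * Q + B * Q) + R * Q)"
    by (simp only: emb_add emb_mult right_diff_distrib) (simp add: algebra_simps)
  then have "R = 0 \<or> P R" by (auto simp: P_def)
  then have "R = 0" using min[of R] degree_mod_less[OF D0, of B] by (auto simp: R_def)
  then show ?thesis using R D0 by (auto simp: emb_0_iff)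
qed

end

section \<open>The Suzuki polynomial, its Artin-Schreier quotients and trace duality\<close>

context suzuki
begin

definition U :: "'k poly" where
  "U = Polynomial.monom 1 q0 * (Polynomial.monom 1 q + Polynomial.monom 1 1)"

abbreviation f :: "'k poly poly" where
  "f \<equiv> suzuki_poly q0 q"

lemma f_eq: "f = Polynomial.monom 1 q + Polynomial.monom 1 1 - [:U:]"
  by (simp add: suzuki_poly_def U_def)

lemma degree_f: "degree f = q"
proof -
  have "degree (Polynomial.monom (1::'k poly) 1 - [:U:]) < degree (Polynomial.monom (1::'k poly) q)"
    using q_pos by (intro le_less_trans[OF degree_diff_le[of _ 1]]) (auto simp: Polynomial.degree_monom_eq)
  then show ?thesis
    by (simp add: f_eq add_diff_eq[symmetric] degree_add_eq_left Polynomial.degree_monom_eq)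
qed

lemma lead_coeff_f: "lead_coeff f = 1"
  unfolding degree_f unfolding f_eq using q_pos by (auto simp: coeff_pCons split: nat.splits)

lemma f_nonzero: "f \<noteq> 0"
  using lead_coeff_f by auto

text \<open>The terms for \<open>i\<close> and \<open>k - i\<close> cancel in pairs, and only a
  middle term survives.\<close>

lemma char2_fps_square:
  fixes h :: "'k fps"
  shows "(h\<^sup>2) $ k = (if even k then (h $ (k div 2))\<^sup>2 else 0)"
proof -
  let ?g = "\<lambda>i. h $ i * h $ (k - i)"
  have "(h\<^sup>2) $ k = (\<Sum>i\<in>{0..k}. ?g i)" by (simp add: power2_eq_square fps_mult_nth)
  also have "{0..k} = {i. 2 * i < k} \<union> {i. i \<le> k \<and> 2 * i > k} \<union> {i. 2 * i = k}" by auto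
  also have "(\<Sum>i\<in>\<dots>. ?g i) = ((\<Sum>i | 2 * i < k. ?g i) + (\<Sum>i | i \<le> k \<and> 2 * i > k. ?g i)) + (\<Sum>i | 2 * i = k. ?g i)"
  proof (subst sum.union_disjoint, goal_cases)
    case 4
    show ?case by (subst sum.union_disjoint) (auto intro: finite_subset[of _ "{..k}"])
  qed (auto intro: finite_subset[of _ "{..k}"])
  also have "(\<Sum>i | i \<le> k \<and> 2 * i > k. ?g i) = (\<Sum>i | 2 * i < k. ?g i)"
    by (rule sum.reindex_bij_witness[of _ "\<lambda>i. k - i" "\<lambda>i. k - i"]) (auto simp: mult.commute)
  also have "(\<Sum>i | 2 * i < k. ?g i) + (\<Sum>i | 2 * i < k. ?g i) = 0" by (rule char2(1))
  also have "(\<Sum>i | 2 * i = k. ?g i) = (if even k then (h $ (k div 2))\<^sup>2 else 0)"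
  proof (cases "even k")
    case True
    then have "{i. 2 * i = k} = {k div 2}" by auto
    moreover have "k - k div 2 = k div 2" using True by auto
    ultimately show ?thesis using True by (simp add: power2_eq_square)
  next
    case False
    then have "{i. 2 * i = k} = {}" by auto
    then show ?thesis using False by simp
  qed
  finally show ?thesis by simp
qed

lemma char2_fps_power:
  fixes h :: "'k fps"
  shows "(h ^ (2 ^ j)) $ k = (if 2 ^ j dvd k then (h $ (k div 2 ^ j)) ^ (2 ^ j) else 0)"
proof (induction j arbitrary: k)
  case (Suc j)
  have "h ^ (2 ^ Suc j) = (h ^ (2 ^ j))\<^sup>2" by (simp add: power_mult[symmetric] mult.commute)
  then have "(h ^ (2 ^ Suc j)) $ k = (if even k then ((h ^ (2 ^ j)) $ (k div 2))\<^sup>2 else 0)"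
    by (simp only: char2_fps_square)
  also have "\<dots> = (if even k \<and> 2 ^ j dvd k div 2 then ((h $ (k div 2 div 2 ^ j)) ^ (2 ^ j))\<^sup>2 else 0)"
    by (simp add: Suc)
  also have "even k \<and> 2 ^ j dvd k div 2 \<longleftrightarrow> 2 ^ Suc j dvd k"
    by (auto elim!: evenE dvd_mult_left)
  finally show ?case by (simp add: div_mult2_eq power_mult[symmetric] mult.commute)
qed simp

text \<open>With \<open>k = 2 * q0 + 1\<close> odd, the coefficients of \<open>Q\<close> at
  \<open>2 ^ i * k\<close> satisfy a squaring recursion. They vanish for \<open>i < a\<close>, equal
  \<open>c\<close> at \<open>i = a\<close> and stay nonzero from there on, contrary to finite
  degree.\<close>

lemma no_polynomial_solution:
  fixes Q :: "'k poly"
  assumes c: "c \<noteq> 0"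
  shows "Q\<^sup>2 + Q \<noteq> smult c U"
proof
  assume eq: "Q\<^sup>2 + Q = smult c U"
  define k where "k = 2 * q0 + 1"
  have U: "Polynomial.coeff U (2 ^ i * k) = (if i = a then 1 else 0)" for i
  proof -
    have 1: "q0 + q = q0 * k" by (simp add: q_eq k_def algebra_simps)
    \<comment> \<open>The lower monomial of \<open>U\<close> is out of range; the upper one has
      exponent \<open>q0 + q = q0 * k\<close>.\<close>
    have 2: "q0 + 1 < 2 ^ i * k"
    proof -
      have "q0 + 1 < 1 * k" using q_pos by (simp add: k_def)
      also have "\<dots> \<le> 2 ^ i * k" by (intro mult_le_mono1) simp
      finally show ?thesis .
    qed
    have "U = Polynomial.monom 1 (q0 + q) + Polynomial.monom 1 (q0 + 1)"
      by (simp add: U_def distrib_left mult_monom)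
    then have "Polynomial.coeff U (2 ^ i * k) = (if q0 * k = 2 ^ i * k then 1 else 0)"
      using 2 by (simp only: 1 coeff_add coeff_monom) simp
    moreover have "q0 * k = 2 ^ i * k \<longleftrightarrow> i = a"
    proof -
      have "k \<noteq> 0" by (simp add: k_def)
      then show ?thesis by (auto simp add: q0_def)
    qed
    ultimately show ?thesis by (simp only:)
  qed
  have sq: "Polynomial.coeff (Q\<^sup>2) j = (if even j then (Polynomial.coeff Q (j div 2))\<^sup>2 else 0)" for j
    using char2_fps_square[of "fps_of_poly Q" j] by (simp add: fps_of_poly_power[symmetric])
  have co: "Polynomial.coeff Q j = c * Polynomial.coeff U j + Polynomial.coeff (Q\<^sup>2) j" for j
  proof -
    have "Polynomial.coeff (Q\<^sup>2) j + Polynomial.coeff Q j = c * Polynomial.coeff U j"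
      using arg_cong[OF eq, of "\<lambda>p. Polynomial.coeff p j"] by simp
    then have "c * Polynomial.coeff U j + Polynomial.coeff (Q\<^sup>2) j
        = (Polynomial.coeff (Q\<^sup>2) j + Polynomial.coeff (Q\<^sup>2) j) + Polynomial.coeff Q j"
      by (simp add: add_ac)
    then show ?thesis by (simp only: char2(1) add_0_left)
  qed
  have e0: "Polynomial.coeff Q (2 ^ 0 * k) = (if 0 = a then c else 0)"
    using co[of k] sq[of k] U[of 0] by (simp add: k_def)
  have eS: "Polynomial.coeff Q (2 ^ Suc i * k) = (if Suc i = a then c else 0) + (Polynomial.coeff Q (2 ^ i * k))\<^sup>2" for i
    using co[of "2 ^ Suc i * k"] sq[of "2 ^ Suc i * k"] U[of "Suc i"] by (simp add: mult.assoc)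
  have small: "i < a \<Longrightarrow> Polynomial.coeff Q (2 ^ i * k) = 0" for i
    by (induction i) (use e0 eS in auto)
  have at: "Polynomial.coeff Q (2 ^ a * k) = c"
    using e0 eS small by (cases a) auto
  have big: "Polynomial.coeff Q (2 ^ (a + i) * k) \<noteq> 0" for i
    by (induction i) (use at eS c in auto)
  have "degree Q < 2 ^ (a + degree Q) * k"
  proof -
    have "degree Q < 2 ^ degree Q" by simp
    also have "\<dots> \<le> 2 ^ (a + degree Q) * 1" by (simp add: power_add)
    also have "\<dots> \<le> 2 ^ (a + degree Q) * k" by (intro mult_le_mono2) (simp add: k_def)
    finally show ?thesis .
  qed
  then show False using big[of "degree Q"] coeff_eq_0 by blast
qed

text \<open>Duality for the trace form: without a nonzero annihilator, summing the character over
  \<open>c\<close> and \<open>s\<close> in both orders would give \<open>card S = q\<close>.\<close>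

lemma ex_trace_annihilator:
  assumes sub: "S \<subseteq> frob_fixed m" and zero: "0 \<in> S" and clos: "\<And>x y. x \<in> S \<Longrightarrow> y \<in> S \<Longrightarrow> x + y \<in> S"
    and card: "card S < q"
  shows "\<exists>c \<in> frob_fixed m. c \<noteq> (0::'k) \<and> (\<forall>s\<in>S. abs_trace m (c * s) = 0)"
proof (rule ccontr)
  assume neg: "\<not> ?thesis"
  have "(\<Sum>s\<in>S. \<Sum>c\<in>frob_fixed m. sign_char (abs_trace m (c * s)))
      = (\<Sum>s\<in>S. if s = 0 then 2 ^ m else 0)"
    using sub by (intro sum.cong refl sum_sign_char_trace[OF m_dvd]) auto
  also have "\<dots> = 2 ^ m" using zero by (simp add: sum.delta)
  also have "(\<Sum>s\<in>S. \<Sum>c\<in>frob_fixed m. sign_char (abs_trace m (c * s)))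
      = (\<Sum>c\<in>frob_fixed m. \<Sum>s\<in>S. sign_char (abs_trace m (c * s)))"
    by (rule sum.swap)
  also have "\<dots> = (\<Sum>c\<in>frob_fixed m. if (c::'k) = 0 then int (card S) else 0)"
  proof (intro sum.cong refl)
    fix c :: 'k assume c: "c \<in> frob_fixed m"
    have "(\<Sum>s\<in>S. sign_char (abs_trace m (c * s)))
        = (if \<forall>s\<in>S. abs_trace m (c * s) = 0 then int (card S) else 0)"
      by (rule sum_sign_char_additive[OF two])
        (use c sub in \<open>auto simp: clos char2(1) distrib_left abs_trace_add[OF two] frob_fixed_closed
          intro!: abs_trace_01[OF two, simplified]\<close>)
    moreover have "(\<forall>s\<in>S. abs_trace m (c * s) = 0) \<longleftrightarrow> c = 0" using neg c by auto
    ultimately show "(\<Sum>s\<in>S. sign_char (abs_trace m (c * s))) = (if c = 0 then int (card S) else 0)"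
      by simp
  qed
  also have "\<dots> = int (card S)" by (simp add: sum.delta frob_fixed_closed)
  finally have "int (card S) = int q" by (simp add: q_def)
  then show False using card by simp
qed

lemma two_poly: "(2::'k poly) = 0" "(2::'k poly poly) = 0"
  using two_poly_0[OF two] two_poly_0[OF two_poly_0[OF two]] by auto

end

section \<open>The kernel of evaluation at a root of the curve equation\<close>

locale suzuki_embedding = suzuki ty n a m q0 q + poly_embedding emb
  for ty :: "'k::{finite,field} itself" and n a m q0 q and emb :: "'k poly \<Rightarrow> 'd::idom" +
  fixes eta :: 'd
  assumes eta: "eta ^ q + eta = emb U"
begin

lemma two_d: "(2::'d) = 0"
  using emb_add[of 1 1] two_poly(1) by (simp add: emb_1)

lemma ev_f: "ev y f = y ^ q + y - emb U"
  by (simp add: f_eq ev_diff ev_add ev_monom emb_1)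

lemma ev_eta_f: "ev eta f = 0"
  using eta by (simp add: ev_f)

lemma ev_eta_f_shift:
  assumes "c \<in> frob_fixed m"
  shows "ev (eta + emb [:c:]) f = 0"
proof -
  have "emb [:c:] ^ q = emb [:c:]"
    using assms by (simp add: emb_power[symmetric] poly_const_pow q_def frob_fixed_def)
  then have "(eta + emb [:c:]) ^ q + (eta + emb [:c:]) = eta ^ q + eta + (emb [:c:] + emb [:c:])"
    by (simp only: q_def frobenius_add[OF two_d] add_ac)
  then show ?thesis using eta add_self_char2[OF two_d] by (simp only: ev_f) simp
qed

text \<open>The difference of the shifted polynomial and \<open>G\<close> also annihilates
  \<open>eta\<close>, and it has smaller degree or is zero.\<close>

lemma minimal_annihilator_shift:
  assumes G: "ev eta G = 0" and min: "\<And>H. ev eta H = 0 \<Longrightarrow> H \<noteq> 0 \<Longrightarrow> degree G \<le> degree H"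
    and c: "ev (eta + emb [:c:]) G = 0"
  shows "pcompose G [:[:c:], 1:] = G"
proof -
  let ?D = "pcompose G [:[:c:], 1:] - G"
  have "ev eta [:[:c:], 1:] = eta + emb [:c:]" by (simp add: ev_pCons emb_1 add.commute)
  then have "ev eta ?D = 0" using G c by (simp add: ev_diff ev_pcompose)
  then have "?D = 0" using min[of ?D] degree_pcompose_linear_diff[of G "[:c:]"] by linarith
  then show ?thesis by simp
qed

text \<open>Divide the trace polynomial \<open>L\<close> of \<open>c * Y\<close> by
  \<open>G\<close>. Both are invariant under shifts by \<open>S\<close>, hence so is the remainder,
  whose degree is too small for a nonconstant invariant polynomial. Evaluation at \<open>eta\<close>
  then puts the trace in the fraction field of K[X].\<close>

lemma trace_in_base:
  assumes r: "degree G > 0" and Gshift: "\<And>s. s \<in> S \<Longrightarrow> pcompose G [:[:s:], 1:] = G"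
    and card: "degree G \<le> card S" and G: "ev eta G = 0"
    and c: "\<And>s. s \<in> S \<Longrightarrow> abs_trace m (c * s) = 0"
  shows "\<exists>A B. A \<noteq> 0 \<and> emb A * abs_trace m (emb [:c:] * eta) = emb B"
proof -
  have G0: "G \<noteq> 0" using r by auto
  define L :: "'k poly poly" where "L = abs_trace m ([:[:c:]:] * [:0, 1:])"
  have pc: "pcompose (abs_trace m p) v = abs_trace m (pcompose p v)" for p v :: "'k poly poly"
    by (simp add: abs_trace_def pcompose_sum pcompose_power)
  have const: "abs_trace m [:[:x:]:] = [:[:abs_trace m x:]:]" for x :: 'k
  proof -
    have "[:[:\<Sum>i\<in>A. g i:]:] = (\<Sum>i\<in>A. [:[:g i:]:])" for A and g :: "nat \<Rightarrow> 'k"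
    proof (induction A rule: infinite_finite_induct)
      case (insert x A)
      have "[:[:sum g (insert x A):]:] = [:[:g x:]:] + [:[:sum g A:]:]" using insert(1,2) by simp
      then show ?case by (simp only: sum.insert[OF insert(1,2)] insert(3))
    qed simp_all
    then show ?thesis by (simp add: abs_trace_def poly_const_pow)
  qed
  have Lshift: "pcompose L [:[:s:], 1:] = L" if s: "s \<in> S" for s
  proof -
    have "pcompose L [:[:s:], 1:] = abs_trace m ([:[:c:]:] * [:0, 1:] + [:[:c * s:]:])"
      unfolding L_def pc by (rule arg_cong) (simp add: pcompose_mult pcompose_pCons mult.commute)
    also have "\<dots> = L + [:[:abs_trace m (c * s):]:]"
      by (simp only: abs_trace_add[OF two_poly(2)] L_def const)
    finally show ?thesis using c[OF s] by simp
  qed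
  \<comment> \<open>Coefficients lie in K[X], so division costs a factor \<open>A\<close>, which
    becomes the denominator.\<close>
  obtain A H R where A: "A \<noteq> 0" "smult A L = G * H + R" "R = 0 \<or> degree R < degree G"
    using pseudo_mod[OF G0, of L] by blast
  have Rshift: "pcompose R [:[:s:], 1:] = R" if s: "s \<in> S" for s
  proof -
    let ?s = "\<lambda>p. pcompose p [:[:s:], 1:]"
    have "smult A (?s L) = ?s (G * H + R)" by (simp only: A(2)[symmetric] pcompose_smult)
    then have "smult A L = G * ?s H + ?s R"
      by (simp only: pcompose_add pcompose_mult Lshift[OF s] Gshift[OF s])
    then have "G * H + R = G * ?s H + ?s R" using A(2) by simp
    then have eq: "G * (H - ?s H) = ?s R - R" by (simp add: algebra_simps)
    have "?s R - R = 0 \<or> degree (?s R - R) < degree G"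
      using degree_pcompose_linear_diff[of R "[:s:]"] A(3) by auto
    then have "?s R - R = 0"
      using G0 degree_mult_eq[OF G0, of "H - ?s H"] unfolding eq[symmetric]
      by (cases "H - ?s H = 0") auto
    then show ?thesis by simp
  qed
  \<comment> \<open>By invariance this polynomial vanishes at every constant in \<open>S\<close>,
    which are more roots than its degree permits.\<close>
  have "R - [:poly R 0:] = 0"
  proof (rule ccontr)
    let ?R = "R - [:poly R 0:]"
    assume R0: "?R \<noteq> 0"
    have "degree ?R < degree G" using A(3) r by (intro le_less_trans[OF degree_diff_le[of _ "degree R"]]) auto
    moreover have "card ((\<lambda>s. [:s:]) ` S) \<le> card {p. poly ?R p = 0}"
    proof (rule card_mono)
      show "finite {p. poly ?R p = 0}" using poly_roots_finite[OF R0] .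
      show "(\<lambda>s. [:s:]) ` S \<subseteq> {p. poly ?R p = 0}"
      proof (clarify)
        fix s assume "s \<in> S"
        then have "poly R 0 = poly (pcompose R [:[:s:], 1:]) 0" using Rshift by simp
        then show "poly ?R [:s:] = 0" by (simp add: poly_pcompose)
      qed
    qed
    moreover have "card ((\<lambda>s. [:s:]) ` S) = card S" by (intro card_image) (auto simp: inj_on_def)
    ultimately show False using card card_poly_roots_bound[OF R0] by linarith
  qed
  then have "ev eta R = emb (poly R 0)" by (metis ev_const eq_iff_diff_eq_0)
  moreover have "ev eta L = abs_trace m (emb [:c:] * eta)"
    by (simp add: L_def abs_trace_def ev_sum ev_power ev_mult ev_pCons emb_1 mult.commute)
  ultimately have "emb A * abs_trace m (emb [:c:] * eta) = emb (poly R 0)"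
    using arg_cong[OF A(2), of "ev eta"] G by (simp add: ev_smult ev_add ev_mult)
  then show ?thesis using A(1) by blast
qed

text \<open>Let \<open>D\<close> be an annihilator of least degree, below \<open>q\<close>. The
  shifts \<open>c\<close> with \<open>eta + c\<close> a root of \<open>D\<close> form a proper
  subgroup \<open>S\<close> of F_q with at least \<open>degree D\<close> elements. A trace that
  kills \<open>S\<close> gives a quotient of polynomials with \<open>t\<^sup>2 + t = c * U\<close>;
  being integral it is a polynomial, which is impossible.\<close>

lemma annihilator_degree:
  assumes "ev eta G = 0" "G \<noteq> 0"
  shows "degree G \<ge> q"
proof (rule ccontr)
  assume lt: "\<not> degree G \<ge> q"
  define P where "P G \<longleftrightarrow> ev eta G = 0 \<and> G \<noteq> 0" for G
  have "P G" using assms by (simp add: P_def)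
  then obtain D where D: "P D" and min: "\<And>H. P H \<Longrightarrow> degree D \<le> degree H"
    using ex_has_least_nat[of P G degree] by auto
  have D0: "ev eta D = 0" "D \<noteq> 0" using D by (auto simp: P_def)
  have dq: "degree D < q" using min[OF \<open>P G\<close>] lt by simp
  have dpos: "degree D > 0"
  proof (rule ccontr)
    assume "\<not> degree D > 0"
    then obtain p where "D = [:p:]" by (metis degree_eq_zeroE neq0_conv)
    then show False using D0 by (simp add: emb_0_iff)
  qed
  define S where "S = {c \<in> frob_fixed m. ev (eta + emb [:c:]) D = 0}"
  have inj: "inj_on (\<lambda>c. eta + emb [:c:]) A" for A
    by (auto simp: inj_on_def emb_inj)
  have roots_le: "card {c \<in> frob_fixed m. ev (eta + emb [:c:]) H = 0} \<le> degree H" if "H \<noteq> 0" for H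
  proof -
    have "card {c \<in> frob_fixed m. ev (eta + emb [:c:]) H = 0}
        = card ((\<lambda>c. eta + emb [:c:]) ` {c \<in> frob_fixed m. ev (eta + emb [:c:]) H = 0})"
      by (rule card_image[symmetric, OF inj])
    also have "\<dots> \<le> card {y. ev y H = 0}" by (rule card_mono[OF card_ev_roots(2)[OF that]]) auto
    finally show ?thesis using card_ev_roots(1)[OF that] by simp
  qed
  have cardS: "card S < q" using roots_le[OF D0(2)] dq by (simp add: S_def)
  obtain A H R where A: "A \<noteq> 0" "smult A f = D * H + R" "R = 0 \<or> degree R < degree D"
    using pseudo_mod[OF D0(2), of f] by blast
  have "ev eta R = 0"
    using arg_cong[OF A(2), of "ev eta"] D0(1) ev_eta_f by (simp add: ev_smult ev_add ev_mult)
  then have "R = 0" using A(3) min[of R] by (meson P_def not_le)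
  then have AD: "smult A f = D * H" using A by simp
  then have H0: "H \<noteq> 0" using A(1) f_nonzero by auto
  have "degree (smult A f) = q" using A(1) by (simp add: degree_f)
  then have dH: "q = degree D + degree H" using AD degree_mult_eq[OF D0(2) H0] by simp
  \<comment> \<open>All \<open>q\<close> shifts of \<open>eta\<close> are roots of \<open>f\<close>,
    hence of \<open>D\<close> or of the cofactor \<open>H\<close>, and \<open>H\<close> has at most
    \<open>q - degree D\<close> of them.\<close>
  have "frob_fixed m \<subseteq> S \<union> {c \<in> frob_fixed m. ev (eta + emb [:c:]) H = 0}"
  proof
    fix c :: 'k assume c: "c \<in> frob_fixed m"
    have "ev (eta + emb [:c:]) D * ev (eta + emb [:c:]) H = 0"
      using arg_cong[OF AD, of "ev (eta + emb [:c:])"] ev_eta_f_shift[OF c] by (simp add: ev_smult ev_mult)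
    then show "c \<in> S \<union> {c \<in> frob_fixed m. ev (eta + emb [:c:]) H = 0}" using c by (auto simp: S_def)
  qed
  then have "q \<le> card (S \<union> {c \<in> frob_fixed m. ev (eta + emb [:c:]) H = 0})"
    unfolding card_Fq[symmetric] by (intro card_mono) auto
  also have "\<dots> \<le> card S + degree H"
    using card_Un_le[of S "{c \<in> frob_fixed m. ev (eta + emb [:c:]) H = 0}"] roots_le[OF H0] by linarith
  finally have card_ge: "degree D \<le> card S" using dH by simp
  have shift: "pcompose D [:[:s:], 1:] = D" if "s \<in> S" for s
    using that by (intro minimal_annihilator_shift D0(1)) (auto simp: S_def P_def intro: min)
  have "\<exists>c \<in> frob_fixed m. c \<noteq> 0 \<and> (\<forall>s\<in>S. abs_trace m (c * s) = 0)"
  proof (rule ex_trace_annihilator[OF _ _ _ cardS])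
    show "0 \<in> S" using D0(1) by (simp add: S_def frob_fixed_closed)
    show "s + t \<in> S" if s: "s \<in> S" and t: "t \<in> S" for s t
    proof -
      have e: "ev (eta + emb [:t:]) [:[:s:], 1:] = eta + emb [:s + t:]"
        using emb_add[of "[:s:]" "[:t:]"] by (simp add: ev_pCons emb_1 add_ac)
      have "ev (eta + emb [:s + t:]) D = ev (eta + emb [:t:]) (pcompose D [:[:s:], 1:])"
        by (simp only: ev_pcompose e)
      then show ?thesis using s t shift[OF s] frob_fixed_add[OF two] by (auto simp: S_def)
    qed
  qed (auto simp: S_def)
  then obtain c where c: "c \<in> frob_fixed m" "c \<noteq> 0" "\<And>s. s \<in> S \<Longrightarrow> abs_trace m (c * s) = 0" by blast
  let ?t = "abs_trace m (emb [:c:] * eta)"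
  have "emb [:c:] ^ q = emb [:c:]"
    using c(1) by (simp add: emb_power[symmetric] poly_const_pow q_def frob_fixed_def)
  then have "?t\<^sup>2 + ?t = emb [:c:] * (eta ^ q + eta)"
    using abs_trace_square[OF two_d, of m "emb [:c:] * eta"]
    by (simp add: q_def[symmetric] power_mult_distrib distrib_left)
  also have "\<dots> = emb (smult c U)" by (simp add: eta emb_mult[symmetric])
  finally have t: "?t\<^sup>2 + ?t = emb (smult c U)" .
  obtain Q where "?t = emb Q"
    using trace_in_base[OF dpos shift card_ge D0(1) c(3)] quadratic_integral[OF t] by blast
  then have "emb (Q\<^sup>2 + Q) = emb (smult c U)" using t by (simp add: emb_add emb_power)
  then show False using no_polynomial_solution[OF c(2)] emb_inj by blast
qed

text \<open>As \<open>f\<close> is monic in \<open>Y\<close>, pseudo-division is division, and a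
  remainder of degree below \<open>q\<close> that annihilates \<open>eta\<close> is zero.\<close>

lemma ev_eq_0_iff: "ev eta G = 0 \<longleftrightarrow> f dvd G"
proof
  assume G: "ev eta G = 0"
  obtain H R where HR: "pseudo_divmod G f = (H, R)" by fastforce
  have eq: "G = f * H + R" and R: "R = 0 \<or> degree R < q"
    using pseudo_divmod[OF f_nonzero HR] lead_coeff_f degree_f by simp_all
  have "ev eta R = 0" using G ev_eta_f unfolding eq by (simp add: ev_add ev_mult)
  then have "R = 0" using annihilator_degree[of R] R by (meson not_le)
  then show "f dvd G" using eq by simp
next
  assume "f dvd G"
  then show "ev eta G = 0" using ev_eta_f by (auto simp: ev_mult)
qed

text \<open>The multiples of \<open>f\<close> are the kernel of a homomorphism into a
  domain.\<close>

lemma prime_elem_f: "prime_elem f"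
  unfolding prime_elem_def
  using f_nonzero ev_eq_0_iff[of 1] by (auto simp: ev_eq_0_iff[symmetric] ev_mult)

end

section \<open>Places at affine points\<close>

text \<open>
  The coefficients of the solution of \<open>Y^r + Y = u\<close> with constant term \<open>y\<close> in characteristic 2, for
  a power \<open>r\<close> of 2, where \<open>Y^r\<close> only involves exponents divisible by \<open>r\<close>.
\<close>

function branch_coeff :: "'k::field fps \<Rightarrow> 'k \<Rightarrow> nat \<Rightarrow> nat \<Rightarrow> 'k" where
  "branch_coeff u y r i = (if i = 0 then y
     else u $ i + (if r > 1 \<and> r dvd i then branch_coeff u y r (i div r) ^ r else 0))"
  by auto
termination by (relation "measure (\<lambda>(u, y, r, i). i)") auto

declare branch_coeff.simps [simp del]

locale suzuki_point = suzuki ty n a m q0 q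
  for ty :: "'k::{finite,field} itself" and n a m q0 q +
  fixes x0 y0 :: 'k
  assumes on_curve: "y0 ^ q + y0 = F x0"
begin

text \<open>Expansion at \<open>x0\<close>: the variable of the power series stands for
  \<open>X - x0\<close>.\<close>

definition emb_at :: "'k poly \<Rightarrow> 'k fps" where
  "emb_at p = fps_of_poly (pcompose p [:x0, 1:])"

definition branch :: "'k fps" where
  "branch = Abs_fps (branch_coeff (emb_at U) y0 q)"

lemma emb_at_nth_0: "emb_at p $ 0 = poly p x0"
  by (simp add: emb_at_def pcompose_coeff_0)

lemma branch_eq: "branch ^ q + branch = emb_at U"
proof (rule fps_ext)
  fix i
  have q1: "q > 1" using q_pos by simp
  have pw: "(branch ^ q) $ i = (if q dvd i then (branch $ (i div q)) ^ q else 0)"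
    unfolding q_def by (rule char2_fps_power)
  show "(branch ^ q + branch) $ i = emb_at U $ i"
  proof (cases "i = 0")
    case True
    have "branch $ 0 = y0" by (simp add: branch_def branch_coeff.simps[of _ _ _ 0])
    moreover have "emb_at U $ 0 = F x0" by (simp add: emb_at_nth_0 U_def F_def poly_monom)
    ultimately show ?thesis using pw on_curve True by simp
  next
    case False
    have "branch $ i = emb_at U $ i + (branch ^ q) $ i"
      using False q1 by (simp add: pw) (simp add: branch_def branch_coeff.simps[of _ _ _ i])
    then have "(branch ^ q + branch) $ i = emb_at U $ i + ((branch ^ q) $ i + (branch ^ q) $ i)"
      by (simp add: add_ac)
    then show ?thesis by (simp only: char2(1) add_0_right)
  qed
qed

sublocale suzuki_embedding ty n a m q0 q emb_at branch
proof
  show "emb_at (p + r) = emb_at p + emb_at r" for p r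
    by (simp add: emb_at_def pcompose_add fps_of_poly_add)
  show "emb_at (p * r) = emb_at p * emb_at r" for p r
    by (simp add: emb_at_def pcompose_mult fps_of_poly_mult)
  show "emb_at 1 = 1" by (simp add: emb_at_def pcompose_1)
  show "p = 0" if "emb_at p = 0" for p
    using that pcompose_eq_0[of p "[:x0, 1:]"] fps_of_poly_eq_iff[of "pcompose p [:x0, 1:]" 0]
    by (simp add: emb_at_def)
  show "branch ^ q + branch = emb_at U" by (rule branch_eq)
qed

abbreviation germ :: "'k poly poly \<Rightarrow> 'k fps" where
  "germ \<equiv> ev branch"

abbreviation FF where "FF \<equiv> function_field f"

lemma germ_nth_0: "germ G $ 0 = poly (poly G [:y0:]) x0"
proof (induction G)
  case (pCons p G)
  have "branch $ 0 = y0" by (simp add: branch_def branch_coeff.simps[of _ _ _ 0])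
  then show ?case using pCons by (simp add: ev_pCons emb_at_nth_0 mult.commute)
qed simp

sublocale FF: field FF
  by (rule field_function_field[OF prime_elem_f])

lemma not_dvd_1: "\<not> f dvd 1"
  using prime_elem_f by (auto simp: prime_elem_def)

lemma carrier_FF: "carrier FF = {fraction f g h | g h. \<not> f dvd h}"
  by (simp add: function_field_def)

lemma fraction_carrier: "\<not> f dvd h \<Longrightarrow> fraction f g h \<in> carrier FF"
  by (auto simp: carrier_FF)

lemma one_FF: "\<one>\<^bsub>FF\<^esub> = fraction f 1 1" and zero_FF: "\<zero>\<^bsub>FF\<^esub> = fraction f 0 1"
  by (simp_all add: function_field_def)

lemma fraction_eq_0: "\<not> f dvd h \<Longrightarrow> fraction f g h = \<zero>\<^bsub>FF\<^esub> \<longleftrightarrow> f dvd g"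
  by (simp add: zero_FF fraction_eq_iff[OF prime_elem_f] not_dvd_1)

lemma inv_fraction:
  assumes "\<not> f dvd g" "\<not> f dvd h"
  shows "inv\<^bsub>FF\<^esub> (fraction f g h) = fraction f h g"
  by (rule FF.comm_inv_char)
    (use assms prime_elem_f in \<open>simp_all add: fraction_carrier function_field_mult[OF prime_elem_f]
      one_FF fraction_eq_iff[OF prime_elem_f] not_dvd_1 prime_elem_dvd_mult_iff mult.commute\<close>)

lemma minus_fraction:
  assumes "\<not> f dvd h"
  shows "\<ominus>\<^bsub>FF\<^esub> (fraction f g h) = fraction f (- g) h"
  by (rule FF.minus_equality)
    (use assms prime_elem_f in \<open>simp_all add: fraction_carrier function_field_add[OF prime_elem_f]
      fraction_eq_0 prime_elem_dvd_mult_iff\<close>)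

lemma fraction_diff_const:
  assumes "\<not> f dvd h"
  shows "fraction f g h \<ominus>\<^bsub>FF\<^esub> const_fun f c = fraction f (g - [:[:c:]:] * h) h"
  by (simp only: a_minus_def const_fun_def minus_fraction[OF not_dvd_1]
      function_field_add[OF prime_elem_f assms not_dvd_1])
    (simp only: mult_1_right mult_minus_left diff_conv_add_uminus)

text \<open>Divisibility of germs says that the quotient of germs has no pole, without forming
  Laurent series.\<close>

definition local_ring :: "('k poly poly \<times> 'k poly poly) set set" where
  "local_ring = {fraction f g h | g h. \<not> f dvd h \<and> germ h dvd germ g}"

lemma fraction_in_local_ring:
  assumes h: "\<not> f dvd h"
  shows "fraction f g h \<in> local_ring \<longleftrightarrow> germ h dvd germ g"
proof
  assume "fraction f g h \<in> local_ring"
  then obtain g' h' where *: "fraction f g h = fraction f g' h'" "\<not> f dvd h'" "germ h' dvd germ g'"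
    by (auto simp: local_ring_def)
  then have "f dvd g * h' - g' * h" using h by (simp add: fraction_eq_iff[OF prime_elem_f])
  then have "germ g * germ h' = germ g' * germ h"
    by (simp add: ev_eq_0_iff[symmetric] ev_diff ev_mult)
  moreover obtain k where "germ g' = germ h' * k" using *(3) by auto
  ultimately have "germ h' * germ g = germ h' * (germ h * k)" by (simp add: algebra_simps)
  then show "germ h dvd germ g" using *(2) by (simp add: ev_eq_0_iff)
qed (use h in \<open>auto simp: local_ring_def\<close>)

lemma fps_dvd_total: "(u :: 'k fps) dvd v \<or> v dvd u"
  by (cases "u = 0"; cases "v = 0") (auto simp: fps_dvd_iff)

text \<open>The quotient series \<open>s\<close> is a non-unit exactly when its constant term is
  zero.\<close>

lemma fraction_in_maximal_ideal:
  assumes h: "\<not> f dvd h"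
  shows "fraction f g h \<in> maximal_ideal_of FF local_ring \<longleftrightarrow> (\<exists>s. germ g = germ h * s \<and> s $ 0 = 0)"
proof (cases "f dvd g")
  case True
  then have "germ g = 0" by (simp add: ev_eq_0_iff)
  then show ?thesis using True h
    by (auto simp: maximal_ideal_of_def fraction_in_local_ring fraction_eq_0 intro: exI[of _ 0])
next
  case False
  then have gh: "germ g \<noteq> 0" "germ h \<noteq> 0" using h by (auto simp: ev_eq_0_iff)
  have "fraction f g h \<in> maximal_ideal_of FF local_ring \<longleftrightarrow> germ h dvd germ g \<and> \<not> germ g dvd germ h"
    using False h by (simp add: maximal_ideal_of_def fraction_in_local_ring fraction_eq_0 inv_fraction)
  also have "\<dots> \<longleftrightarrow> (\<exists>s. germ g = germ h * s \<and> s $ 0 = 0)"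
  proof (intro iffI; elim conjE exE)
    assume "germ h dvd germ g" and n: "\<not> germ g dvd germ h"
    then obtain s where s: "germ g = germ h * s" by auto
    have "\<not> s dvd 1" using n s gh by auto
    then show "\<exists>s. germ g = germ h * s \<and> s $ 0 = 0" using s by auto
  next
    fix s assume s: "germ g = germ h * s" "s $ 0 = 0"
    then have "\<not> s dvd 1" by simp
    then show "germ h dvd germ g \<and> \<not> germ g dvd germ h" using s gh by auto
  qed
  finally show ?thesis .
qed

text \<open>The value of a fraction at the place is the constant term of its power series.\<close>

lemma value_unique:
  assumes h: "\<not> f dvd h" and s: "germ g = germ h * s"
  shows "fraction f g h \<ominus>\<^bsub>FF\<^esub> const_fun f c \<in> maximal_ideal_of FF local_ring \<longleftrightarrow> c = s $ 0"
proof -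
  have h0: "germ h \<noteq> 0" using h by (simp add: ev_eq_0_iff)
  have c: "germ [:[:c:]:] = fps_const c" by (simp add: emb_at_def fps_of_poly_const)
  have "germ (g - [:[:c:]:] * h) = germ h * (s - fps_const c)"
    by (simp only: ev_diff ev_mult c s) (simp add: algebra_simps)
  then have "fraction f g h \<ominus>\<^bsub>FF\<^esub> const_fun f c \<in> maximal_ideal_of FF local_ring
      \<longleftrightarrow> (\<exists>s'. germ h * (s - fps_const c) = germ h * s' \<and> s' $ 0 = 0)"
    by (simp only: fraction_diff_const[OF h] fraction_in_maximal_ideal[OF h])
  also have "\<dots> \<longleftrightarrow> (s - fps_const c) $ 0 = 0" using h0 by auto
  finally show ?thesis by auto
qed

lemma value_at_polynomial:
  "value_at FF (const_fun f) local_ring (fraction f g 1) = poly (poly g [:y0:]) x0"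
  using value_unique[OF not_dvd_1, of g "germ g"] by (simp add: value_at_def germ_nth_0)

lemma polynomial_in_local_ring: "fraction f g 1 \<in> local_ring"
  by (simp add: fraction_in_local_ring[OF not_dvd_1])

lemma coordinate_not_dvd: "\<not> f dvd [:[:- c, 1:]:]"
  using ev_eq_0_iff[of "[:[:- c, 1:]:]"] emb_0_iff[of "[:- c, 1:]"] by simp

lemma valuation_ring_local_ring: "valuation_ring FF (const_fun f) local_ring"
  unfolding valuation_ring_def
proof (intro conjI ballI)
  note pf = prime_elem_f
  have E: "\<exists>g h. x = fraction f g h \<and> \<not> f dvd h" if "x \<in> carrier FF" for x
    using that by (auto simp: carrier_FF)
  have sub: "local_ring \<subseteq> carrier FF" by (auto simp: local_ring_def carrier_FF)
  have lrE: "\<exists>g h. x = fraction f g h \<and> \<not> f dvd h \<and> germ h dvd germ g" if "x \<in> local_ring" for x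
    using that by (auto simp: local_ring_def)
  show "subring local_ring FF"
  proof (rule FF.subringI)
    show "local_ring \<subseteq> carrier FF" by (rule sub)
    show "\<one>\<^bsub>FF\<^esub> \<in> local_ring" by (simp add: one_FF polynomial_in_local_ring)
    fix x assume x: "x \<in> local_ring"
    obtain g h where gh: "x = fraction f g h" "\<not> f dvd h" "germ h dvd germ g" using lrE[OF x] by blast
    show "\<ominus>\<^bsub>FF\<^esub> x \<in> local_ring"
      using gh by (simp add: minus_fraction fraction_in_local_ring ev_uminus)
    fix y assume y: "y \<in> local_ring"
    obtain e k where ek: "y = fraction f e k" "\<not> f dvd k" "germ k dvd germ e" using lrE[OF y] by blast
    have hk: "\<not> f dvd h * k" using gh ek pf by (simp add: prime_elem_dvd_mult_iff)
    show "x \<otimes>\<^bsub>FF\<^esub> y \<in> local_ring"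
      using gh ek by (simp add: function_field_mult[OF pf] fraction_in_local_ring[OF hk] ev_mult mult_dvd_mono)
    show "x \<oplus>\<^bsub>FF\<^esub> y \<in> local_ring"
      using gh ek by (simp add: function_field_add[OF pf] fraction_in_local_ring[OF hk] ev_mult ev_add)
  qed
  \<comment> \<open>The function \<open>X - x0\<close> makes both inclusions strict: it is regular
    and not constant, and its inverse is not regular because its germ has constant term 0.\<close>
  have t: "fraction f [:[:- x0, 1:]:] 1 \<notin> range (const_fun f)"
  proof
    assume "fraction f [:[:- x0, 1:]:] 1 \<in> range (const_fun f)"
    then obtain c where "f dvd [:[:- x0, 1:]:] - [:[:c:]:]"
      by (auto simp: const_fun_def fraction_eq_iff[OF pf] not_dvd_1)
    moreover have "[:[:- x0, 1:]:] - [:[:c:]:] = [:[:- (x0 + c), 1:]:]" by simp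
    ultimately show False using coordinate_not_dvd[of "x0 + c"] by metis
  qed
  show "range (const_fun f) \<subset> local_ring"
    using t polynomial_in_local_ring by (auto simp: const_fun_def psubset_eq)
  have "germ [:[:- x0, 1:]:] $ 0 = 0" by (simp only: germ_nth_0) simp
  then have "\<not> germ [:[:- x0, 1:]:] dvd germ 1" by simp
  then have "fraction f 1 [:[:- x0, 1:]:] \<notin> local_ring"
    using fraction_in_local_ring[OF coordinate_not_dvd] by blast
  then show "local_ring \<subset> carrier FF" using sub fraction_carrier[OF coordinate_not_dvd] by blast
  fix z assume z: "z \<in> carrier FF - {\<zero>\<^bsub>FF\<^esub>}"
  obtain g h where gh: "z = fraction f g h" "\<not> f dvd h" using E[of z] z by blast
  moreover have "\<not> f dvd g" using z gh fraction_eq_0 by simp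
  ultimately show "z \<in> local_ring \<or> inv\<^bsub>FF\<^esub> z \<in> local_ring"
    using fps_dvd_total[of "germ h" "germ g"] by (simp add: inv_fraction fraction_in_local_ring)
qed

lemma rational_point_local_ring: "rational_point FF (const_fun f) local_ring"
  unfolding rational_point_def
proof (intro conjI ballI)
  fix z assume "z \<in> local_ring"
  then obtain g h s where "z = fraction f g h" "\<not> f dvd h" "germ g = germ h * s"
    by (auto simp: local_ring_def elim!: dvdE)
  then show "\<exists>c. z \<ominus>\<^bsub>FF\<^esub> const_fun f c \<in> maximal_ideal_of FF local_ring"
    using value_unique by blast
qed (rule valuation_ring_local_ring)

end

section \<open>The code\<close>

text \<open>A nonzero polynomial of degree below \<open>k\<close> has fewer than \<open>k\<close>
  roots.\<close>

lemma power_sum_eq_0_coeffs: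
  fixes b :: "nat \<Rightarrow> 'a::idom"
  assumes "finite R" "card R \<ge> k" and zero: "\<And>x. x \<in> R \<Longrightarrow> (\<Sum>i<k. b i * x ^ i) = 0" and "i < k"
  shows "b i = 0"
proof (rule ccontr)
  assume bi: "b i \<noteq> 0"
  define p where "p = (\<Sum>i<k. Polynomial.monom (b i) i)"
  have co: "Polynomial.coeff p j = (if j < k then b j else 0)" for j
    by (auto simp: p_def coeff_sum sum.delta)
  have p0: "p \<noteq> 0" using co[of i] bi \<open>i < k\<close> by auto
  have "degree p < k" using p0 co by (metis leading_coeff_0_iff)
  moreover have "R \<subseteq> {x. poly p x = 0}" using zero by (auto simp: p_def poly_sum poly_monom)
  then have "card R \<le> card {x. poly p x = 0}" by (intro card_mono poly_roots_finite[OF p0])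
  ultimately show False using card_poly_roots_bound[OF p0] assms(2) by linarith
qed

text \<open>The condition selects one residue class modulo \<open>M\<close>, and the range consists
  of \<open>N\<close> full periods.\<close>

lemma card_residue_class:
  assumes M: "M > 0"
  shows "card {i. i < M * N \<and> M dvd i + t} = (N::nat)"
proof -
  define r where "r = (M - t mod M) mod M"
  have r: "r < M" using M by (simp add: r_def)
  have iff: "M dvd i + t \<longleftrightarrow> i mod M = r" for i
  proof -
    have "M dvd i + t \<longleftrightarrow> M dvd i mod M + t mod M" by (metis dvd_eq_mod_eq_0 mod_add_eq)
    also have "\<dots> \<longleftrightarrow> i mod M + t mod M = 0 \<or> i mod M + t mod M = M"
    proof
      assume "M dvd i mod M + t mod M"
      then obtain k where k: "i mod M + t mod M = M * k" by auto
      have "i mod M < M" "t mod M < M" using M by auto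
      then have "M * k < M * 2" using k by linarith
      then have "k = 0 \<or> k = 1" by auto
      then show "i mod M + t mod M = 0 \<or> i mod M + t mod M = M" using k by auto
    qed auto
    also have "\<dots> \<longleftrightarrow> i mod M = r"
    proof (cases "t mod M = 0")
      case True
      then show ?thesis using mod_less_divisor[OF M, of i] by (auto simp: r_def)
    next
      case False
      then have "r = M - t mod M" using M by (simp add: r_def)
      then show ?thesis using False mod_less_divisor[OF M, of t] by auto
    qed
    finally show ?thesis .
  qed
  have "{i. i < M * N \<and> M dvd i + t} = (\<lambda>k. M * k + r) ` {..<N}"
  proof (intro equalityI subsetI)
    fix i assume "i \<in> {i. i < M * N \<and> M dvd i + t}"
    then have i: "i < M * N" "i mod M = r" using iff by auto
    then have "i = M * (i div M) + r" by (metis mult_div_mod_eq)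
    moreover have "i div M < N" using i(1) M by (simp add: less_mult_imp_div_less mult.commute)
    ultimately show "i \<in> (\<lambda>k. M * k + r) ` {..<N}" by blast
  next
    fix i assume "i \<in> (\<lambda>k. M * k + r) ` {..<N}"
    then obtain k where k: "i = M * k + r" "k < N" by auto
    have "M * k + r < M * Suc k" using r by simp
    also have "\<dots> \<le> M * N" using k(2) by (intro mult_le_mono2) simp
    finally show "i \<in> {i. i < M * N \<and> M dvd i + t}" using k r by (simp add: iff)
  qed
  moreover have "inj_on (\<lambda>k. M * k + r) {..<N}" using M by (auto simp: inj_on_def)
  ultimately show ?thesis by (simp add: card_image)
qed

text \<open>The recovery function chooses any codeword with the given restriction and reads off its
  entry.\<close>

lemma recovery_setI:
  assumes "\<And>w w'. w \<in> C \<Longrightarrow> w' \<in> C \<Longrightarrow> (\<And>k. k \<in> A \<Longrightarrow> w k = w' k) \<Longrightarrow> w i = w' i"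
  shows "recovery_set C i A"
  unfolding recovery_set_def
proof (intro exI ballI)
  fix w assume w: "w \<in> C"
  let ?\<phi> = "\<lambda>r. (SOME w'. w' \<in> C \<and> restrict w' A = r) i"
  define w' where "w' = (SOME w'. w' \<in> C \<and> restrict w' A = restrict w A)"
  have "w' \<in> C \<and> restrict w' A = restrict w A"
    unfolding w'_def by (rule someI[of _ w]) (simp add: w)
  then have w': "w' \<in> C" and r: "restrict w' A = restrict w A" by auto
  have "w i = w' i"
  proof (rule assms[OF w w'])
    show "w k = w' k" if "k \<in> A" for k using fun_cong[OF r, of k] that by simp
  qed
  then show "w i = ?\<phi> (restrict w A)" by (simp add: w'_def)
qed

section \<open>Places, torus power sums and fibres\<close>

context suzuki
begin

lemma origin_on_curve: "(0::'k) ^ q + 0 = F 0"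
  using q_pos by (simp add: F_def)

text \<open>Primality was derived at a point of the curve; the origin is always available.\<close>

lemma prime_elem_suzuki_poly: "prime_elem f"
proof -
  interpret suzuki_point ty n a m q0 q 0 0
    by unfold_locales (rule origin_on_curve)
  show ?thesis by (rule prime_elem_f)
qed

lemma ex_place:
  assumes "y ^ q + y = F x"
  shows "\<exists>V. rational_point (function_field f) (const_fun f) V \<and>
    (\<forall>g. fraction f g 1 \<in> V \<and>
      value_at (function_field f) (const_fun f) V (fraction f g 1) = poly (poly g [:y:]) x)"
proof -
  interpret suzuki_point ty n a m q0 q x y
    by unfold_locales (rule assms)
  show ?thesis
    using rational_point_local_ring polynomial_in_local_ring value_at_polynomial by blast
qed

text \<open>Multiplication by \<open>g\<close> permutes the units of F_q and multiplies the sum by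
  \<open>g ^ e\<close>, so a \<open>g\<close> with \<open>g ^ e \<noteq> 1\<close> suffices.\<close>

lemma sum_units_power_eq_0:
  assumes e: "\<not> (q - 1) dvd e"
  shows "(\<Sum>z\<in>frob_fixed m - {0}. z ^ e) = (0::'k)"
proof -
  let ?E = "frob_fixed m - {0::'k}"
  have cardE: "card ?E = q - 1" using card_Fq by (simp add: card_Diff_singleton frob_fixed_closed)
  define d where "d = e mod (q - 1)"
  have d: "0 < d" "d < q - 1" using e q_pos by (auto simp: d_def dvd_eq_mod_eq_0)
  have unit: "z ^ (q - 1) = 1" if "z \<in> ?E" for z
  proof -
    have "z ^ (q - 1) * z = 1 * z"
      using power_minus_mult[OF q_pos(1), of z] that by (simp add: frob_fixed_def q_def[symmetric])
    then show ?thesis using that by simp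
  qed
  have ed: "z ^ e = z ^ d" if "z \<in> ?E" for z
  proof -
    have "z ^ e = z ^ ((q - 1) * (e div (q - 1)) + d)" by (simp add: d_def)
    then show ?thesis by (simp only: power_add power_mult unit[OF that]) simp
  qed
  have "\<exists>g \<in> ?E. g ^ d \<noteq> 1"
  proof (rule ccontr)
    assume "\<not> ?thesis"
    then have all: "\<And>z. z \<in> ?E \<Longrightarrow> z ^ d = 1" by blast
    \<comment> \<open>These are the coefficients of \<open>X^d - 1\<close>, whose degree is below
      the number \<open>q - 1\<close> of units.\<close>
    define b where "b i = (if i = d then 1 else if i = 0 then - 1 else (0::'k))" for i
    have "b d = 0"
    proof (rule power_sum_eq_0_coeffs[of ?E "d + 1" b])
      fix z assume z: "z \<in> ?E"
      have "(\<Sum>i<d + 1. b i * z ^ i) = (\<Sum>i\<in>{0, d}. b i * z ^ i)"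
        by (rule sum.mono_neutral_right) (auto simp: b_def)
      then show "(\<Sum>i<d + 1. b i * z ^ i) = 0" using d all[OF z] by (simp add: b_def)
    qed (use d cardE in auto)
    then show False by (simp add: b_def)
  qed
  then obtain g where g: "g \<in> ?E" "g ^ d \<noteq> 1" by blast
  let ?s = "\<Sum>z\<in>?E. z ^ e"
  have "?s = (\<Sum>z\<in>?E. (g * z) ^ e)"
    by (rule sum.reindex_bij_witness[of _ "\<lambda>z. g * z" "\<lambda>z. z / g"])
      (use g in \<open>auto simp: frob_fixed_def power_divide power_mult_distrib\<close>)
  also have "\<dots> = g ^ e * ?s" by (simp add: power_mult_distrib sum_distrib_left)
  finally have "(1 - g ^ e) * ?s = 0" by (simp add: algebra_simps)
  then show ?thesis using g ed[OF g(1)] by simp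
qed

text \<open>A nonempty fibre is a coset of F_q, the kernel of \<open>y ^ q + y\<close>.\<close>

lemma card_fiber:
  assumes "x \<in> suzuki_x"
  shows "card {y. y ^ q + y = F x} = q"
proof -
  from assms obtain y where y: "y ^ q + y = F x" by (auto simp: suzuki_x_def)
  have "{y. y ^ q + y = F x} = (+) y ` frob_fixed m"
  proof (intro equalityI subsetI)
    fix y' assume "y' \<in> {y. y ^ q + y = F x}"
    then have "(y ^ q + y) + (y' ^ q + y') = 0" using y by (simp add: char2(1))
    then have "(y + y') ^ q + (y + y') = 0" by (simp only: q_add add_ac)
    then have "(y + y') ^ q = y + y'" by (simp only: add_eq_0)
    then have "y + y' \<in> frob_fixed m" by (simp add: frob_fixed_def q_def)
    moreover have "y + (y + y') = y'" by (simp only: add.assoc[symmetric] char2(1) add_0_left)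
    ultimately show "y' \<in> (+) y ` frob_fixed m" by (metis imageI)
  next
    fix y' assume "y' \<in> (+) y ` frob_fixed m"
    then obtain c where c: "y' = y + c" "c ^ q = c" by (auto simp: frob_fixed_def q_def)
    have "y' ^ q + y' = (y ^ q + y) + (c + c)" unfolding c(1) q_add c(2) by (simp only: add_ac)
    then show "y' \<in> {y. y ^ q + y = F x}" using y by (simp only: char2(1) add_0_right mem_Collect_eq)
  qed
  then show ?thesis using card_Fq by (simp add: card_image)
qed

end

text \<open>\<open>N\<close> counts the torus orbits on the abscissas, each of size
  \<open>q - 1\<close>: it is 1 over F_q and \<open>q\<^sup>2 + 2 * q * q0 + q + 1\<close> over
  F_(q^4).\<close>

locale suzuki_code = suzuki ty n a m q0 q
  for ty :: "'k::{finite,field} itself" and n a m q0 q +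
  fixes N :: nat
  assumes card_x: "card suzuki_x = (q - 1) * N"
begin

definition points :: "('k \<times> 'k) set" where
  "points = (SIGMA x:suzuki_x. {y. y ^ q + y = F x})"

definition len :: nat where "len = q * (q - 1) * N"

lemma card_points: "card points = len"
proof -
  have "card points = (\<Sum>x\<in>suzuki_x. card {y. y ^ q + y = F x})"
    unfolding points_def by (rule card_SigmaI) simp_all
  also have "\<dots> = (\<Sum>x\<in>suzuki_x. q)" by (rule sum.cong[OF refl card_fiber])
  finally show ?thesis by (simp add: card_x len_def)
qed

definition pt :: "nat \<Rightarrow> 'k \<times> 'k" where
  "pt = (SOME b. bij_betw b {0..<len} points)"

lemma bij_pt: "bij_betw pt {..<len} points"
proof -
  have "\<exists>b. bij_betw b {0..<len} points" using ex_bij_betw_nat_finite[of points] card_points by auto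
  then have "bij_betw pt {0..<len} points" unfolding pt_def by (rule someI_ex)
  then show ?thesis by (simp add: lessThan_atLeast0)
qed

text \<open>The torus acts on \<open>x^i y^j\<close> with weight \<open>i + (q0 + 1) * j\<close>,
  and orbit sums kill the weights not divisible by \<open>q - 1\<close>. The bound on
  \<open>j\<close> permits interpolation from \<open>q - 1\<close> points of a fibre.\<close>

definition supported :: "(nat \<Rightarrow> nat \<Rightarrow> 'k) \<Rightarrow> bool" where
  "supported c \<longleftrightarrow> (\<forall>i j. c i j \<noteq> 0 \<longrightarrow>
     i < (q - 1) * N \<and> j < q - 1 \<and> \<not> (q - 1) dvd i + (q0 + 1) * j)"

definition exponents :: "(nat \<times> nat) set" where
  "exponents = {(i, j). i < (q - 1) * N \<and> j < q - 1 \<and> \<not> (q - 1) dvd i + (q0 + 1) * j}"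

definition cval :: "(nat \<Rightarrow> nat \<Rightarrow> 'k) \<Rightarrow> 'k \<Rightarrow> 'k \<Rightarrow> 'k" where
  "cval c x y = (\<Sum>j<q - 1. (\<Sum>i<(q - 1) * N. c i j * x ^ i) * y ^ j)"

definition polynomial :: "(nat \<Rightarrow> nat \<Rightarrow> 'k) \<Rightarrow> 'k poly poly" where
  "polynomial c = (\<Sum>j<q - 1. Polynomial.monom (\<Sum>i<(q - 1) * N. Polynomial.monom (c i j) i) j)"

definition codeword :: "(nat \<Rightarrow> nat \<Rightarrow> 'k) \<Rightarrow> nat \<Rightarrow> 'k" where
  "codeword c k = (if k < len then cval c (fst (pt k)) (snd (pt k)) else 0)"

definition code :: "(nat \<Rightarrow> 'k) set" where
  "code = codeword ` {c. supported c}"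

lemma poly_polynomial: "poly (poly (polynomial c) [:y:]) x = cval c x y"
  by (simp add: polynomial_def cval_def poly_sum poly_monom poly_const_pow mult.commute)

text \<open>Interpolation first in \<open>y\<close> on each fibre, then in \<open>x\<close> on the
  abscissas.\<close>

lemma cval_zero_imp:
  assumes "\<And>x y. (x, y) \<in> points \<Longrightarrow> cval c x y = 0" "i < (q - 1) * N" "j < q - 1"
  shows "c i j = 0"
proof (rule power_sum_eq_0_coeffs[of suzuki_x "(q - 1) * N" "\<lambda>i. c i j"])
  fix x assume x: "x \<in> suzuki_x"
  show "(\<Sum>i<(q - 1) * N. c i j * x ^ i) = 0"
    by (rule power_sum_eq_0_coeffs[of "{y. y ^ q + y = F x}" "q - 1" "\<lambda>j. \<Sum>i<(q - 1) * N. c i j * x ^ i"])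
      (use x assms in \<open>auto simp: card_fiber points_def cval_def\<close>)
qed (use assms card_x in auto)

lemma cval_linear:
  "cval (\<lambda>i j. c i j + d i j) x y = cval c x y + cval d x y"
  "cval (\<lambda>i j. s * c i j) x y = s * cval c x y"
  by (simp only: cval_def sum.distrib distrib_right)
    (simp only: cval_def mult.assoc sum_distrib_left[symmetric])

lemma polynomial_linear:
  "polynomial (\<lambda>i j. c i j + d i j) = polynomial c + polynomial d"
  "polynomial (\<lambda>i j. - c i j) = - polynomial c"
  "polynomial (\<lambda>i j. s * c i j) = [:[:s:]:] * polynomial c"
  "polynomial (\<lambda>i j. 0) = 0"
proof -
  show "polynomial (\<lambda>i j. s * c i j) = [:[:s:]:] * polynomial c"
  proof -
    have 1: "Polynomial.monom (s * b) i = [:s:] * Polynomial.monom b i" for b :: 'k and i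
      by (simp add: smult_monom)
    have 2: "Polynomial.monom ([:s:] * p) j = [:[:s:]:] * Polynomial.monom p j" for p :: "'k poly" and j
      by (simp add: smult_monom)
    show ?thesis by (simp only: polynomial_def 1 2 sum_distrib_left[symmetric])
  qed
qed (simp_all add: polynomial_def add_monom[symmetric] minus_monom[symmetric] sum.distrib sum_negf)

lemma codeword_linear:
  "codeword (\<lambda>i j. c i j + d i j) = codeword c + codeword d"
  "codeword (\<lambda>i j. s * c i j) = scale_word s (codeword c)"
  by (auto simp: codeword_def cval_linear scale_word_def fun_eq_iff)

lemma supported_linear:
  "supported c \<Longrightarrow> supported d \<Longrightarrow> supported (\<lambda>i j. c i j + d i j)"
  "supported c \<Longrightarrow> supported (\<lambda>i j. - c i j)"
  "supported c \<Longrightarrow> supported (\<lambda>i j. s * c i j)"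
  "supported (\<lambda>i j. 0)"
  unfolding supported_def
  by (metis add.right_neutral, metis neg_equal_0_iff_equal, metis mult_zero_right, blast)

text \<open>Each of the \<open>q - 1\<close> values of \<open>j\<close> excludes one residue class
  of \<open>i\<close> modulo \<open>q - 1\<close>, that is \<open>N\<close> of the
  \<open>(q - 1) * N\<close> values.\<close>

lemma card_exponents: "card exponents = (q - 1) * (q - 2) * N"
proof -
  have q1: "q - 1 > 0" using q_pos by simp
  have fib: "card {i. i < (q - 1) * N \<and> \<not> (q - 1) dvd i + t} = (q - 2) * N" for t
  proof -
    have "{i. i < (q - 1) * N \<and> \<not> (q - 1) dvd i + t} = {..<(q - 1) * N} - {i. i < (q - 1) * N \<and> (q - 1) dvd i + t}"
      by auto
    then have "card {i. i < (q - 1) * N \<and> \<not> (q - 1) dvd i + t} = (q - 1) * N - N"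
      using card_residue_class[OF q1, of N t] by (simp add: card_Diff_subset subset_iff)
    also have "\<dots> = (q - 2) * N" by (simp add: diff_mult_distrib)
    finally show ?thesis .
  qed
  have "exponents = prod.swap ` (SIGMA j:{..<q - 1}. {i. i < (q - 1) * N \<and> \<not> (q - 1) dvd i + (q0 + 1) * j})"
    by (force simp: exponents_def)
  then have "card exponents = card (SIGMA j:{..<q - 1}. {i. i < (q - 1) * N \<and> \<not> (q - 1) dvd i + (q0 + 1) * j})"
    by (simp add: card_image)
  also have "\<dots> = (\<Sum>j<q - 1. (q - 2) * N)"
    by (subst card_SigmaI) (simp_all only: fib finite_lessThan, auto)
  finally show ?thesis by (simp add: mult.assoc)
qed

lemma codeword_0: "codeword (\<lambda>i j. 0) = 0"
  by (auto simp: codeword_def cval_def)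

lemma pt_in_points: "k < len \<Longrightarrow> (fst (pt k), snd (pt k)) \<in> points"
  using bij_pt by (auto simp: bij_betw_def)

lemma pt_inj: "k < len \<Longrightarrow> l < len \<Longrightarrow> pt k = pt l \<longleftrightarrow> k = l"
  using bij_pt by (auto simp: bij_betw_def inj_on_def)

lemma pt_surj: "p \<in> points \<Longrightarrow> \<exists>k<len. pt k = p"
  using bij_pt unfolding bij_betw_def by (metis imageE lessThan_iff)

lemma codeword_eq_0_imp:
  assumes sup: "supported c" and zero: "codeword c = 0"
  shows "c i j = 0"
proof (rule ccontr)
  assume nz: "c i j \<noteq> 0"
  then have "i < (q - 1) * N" "j < q - 1" using sup by (auto simp: supported_def)
  moreover have "cval c x y = 0" if xy: "(x, y) \<in> points" for x y
  proof -
    obtain k where k: "k < len" "pt k = (x, y)" using pt_surj[OF xy] by blast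
    then show ?thesis using fun_cong[OF zero, of k] by (simp add: codeword_def)
  qed
  ultimately show False using cval_zero_imp nz by blast
qed

definition basis_word :: "nat \<times> nat \<Rightarrow> nat \<Rightarrow> 'k" where
  "basis_word e = codeword (\<lambda>i j. if (i, j) = e then 1 else 0)"

lemma sum_basis_word:
  assumes "finite A"
  shows "(\<Sum>e\<in>A. scale_word (d e) (basis_word e)) = codeword (\<lambda>i j. if (i, j) \<in> A then d (i, j) else 0)"
  using assms
proof (induction A rule: finite_induct)
  case empty
  then show ?case by (simp add: codeword_0)
next
  case (insert e A)
  have "(\<lambda>i j. if (i, j) \<in> insert e A then d (i, j) else 0)
      = (\<lambda>i j. d e * (if (i, j) = e then 1 else 0) + (if (i, j) \<in> A then d (i, j) else 0))"
    using insert(2) by (auto simp: fun_eq_iff)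
  then have "codeword (\<lambda>i j. if (i, j) \<in> insert e A then d (i, j) else 0)
      = scale_word (d e) (basis_word e) + codeword (\<lambda>i j. if (i, j) \<in> A then d (i, j) else 0)"
    by (simp only: codeword_linear basis_word_def)
  then show ?case by (simp only: sum.insert[OF insert(1,2)] insert(3))
qed

lemma finite_exponents: "finite exponents"
  by (rule finite_subset[of _ "{..<(q - 1) * N} \<times> {..<q - 1}"]) (auto simp: exponents_def)

lemma supported_restrict: "supported (\<lambda>i j. if (i, j) \<in> exponents then d (i, j) else 0)"
  by (auto simp: supported_def exponents_def)

lemma basis_combination_eq_0:
  assumes "(\<Sum>e\<in>exponents. scale_word (d e) (basis_word e)) = 0" "e \<in> exponents"
  shows "d e = 0"
  using codeword_eq_0_imp[OF supported_restrict, of d "fst e" "snd e"] assms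
  by (simp add: sum_basis_word[OF finite_exponents])

lemma inj_basis_word: "inj_on basis_word exponents"
proof (rule inj_onI, rule ccontr)
  fix e e' assume e: "e \<in> exponents" "e' \<in> exponents" "basis_word e = basis_word e'" "e \<noteq> e'"
  define d where "d x = (if x = e then 1 else if x = e' then - 1 else (0::'k))" for x
  have "(\<Sum>x\<in>exponents. scale_word (d x) (basis_word x)) = (\<Sum>x\<in>{e, e'}. scale_word (d x) (basis_word x))"
    by (rule sum.mono_neutral_right[OF finite_exponents])
      (use e in \<open>auto simp: d_def scale_word_def fun_eq_iff\<close>)
  also have "\<dots> = 0" using e by (auto simp: d_def scale_word_def fun_eq_iff)
  finally have "d e = 0" using basis_combination_eq_0 e by blast
  then show False by (simp add: d_def)
qed

lemma dim_code: "word.dim code = (q - 1) * (q - 2) * N"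
proof (rule word.dim_unique)
  show "basis_word ` exponents \<subseteq> code"
    by (auto simp: basis_word_def code_def exponents_def supported_def intro!: imageI split: if_splits)
  show "code \<subseteq> word.span (basis_word ` exponents)"
  proof
    fix w assume "w \<in> code"
    then obtain c where c: "supported c" "w = codeword c" by (auto simp: code_def)
    have "c = (\<lambda>i j. if (i, j) \<in> exponents then (\<lambda>(i, j). c i j) (i, j) else 0)"
      using c(1) by (auto simp: fun_eq_iff supported_def exponents_def)
    then have "w = (\<Sum>e\<in>exponents. scale_word ((\<lambda>(i, j). c i j) e) (basis_word e))"
      using sum_basis_word[OF finite_exponents, of "\<lambda>(i, j). c i j"] c(2) by simp
    moreover have "(\<Sum>e\<in>exponents. scale_word ((\<lambda>(i, j). c i j) e) (basis_word e)) \<in> word.span (basis_word ` exponents)"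
      by (intro word.span_sum word.span_scale word.span_base imageI)
    ultimately show "w \<in> word.span (basis_word ` exponents)" by simp
  qed
  show "word.independent (basis_word ` exponents)"
    unfolding word.dependent_finite[OF finite_imageI[OF finite_exponents]]
  proof (intro notI, elim exE conjE bexE)
    fix u v assume v: "v \<in> basis_word ` exponents" "u v \<noteq> 0"
      and s: "(\<Sum>v\<in>basis_word ` exponents. scale_word (u v) v) = 0"
    from v obtain e where e: "e \<in> exponents" "v = basis_word e" by auto
    have "(\<Sum>e\<in>exponents. scale_word (u (basis_word e)) (basis_word e)) = 0"
      using s by (simp add: sum.reindex[OF inj_basis_word])
    then show False using basis_combination_eq_0[of "\<lambda>e. u (basis_word e)"] e v(2) by blast
  qed
  show "card (basis_word ` exponents) = (q - 1) * (q - 2) * N"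
    by (simp add: card_image[OF inj_basis_word] card_exponents)
qed

lemma linear_code_code: "linear_code len code"
  unfolding linear_code_def
proof
  show "word.subspace code"
  proof (rule word.subspaceI)
    show "0 \<in> code" unfolding code_def codeword_0[symmetric] using supported_linear(4) by blast
  next
    fix w w' assume "w \<in> code" "w' \<in> code"
    then show "w + w' \<in> code"
      unfolding code_def by (auto simp: codeword_linear[symmetric] intro!: imageI supported_linear)
  next
    fix s w assume "w \<in> code"
    then show "scale_word s w \<in> code"
      unfolding code_def by (auto simp: codeword_linear[symmetric] intro!: imageI supported_linear)
  qed
  show "\<forall>w\<in>code. \<forall>i\<ge>len. w i = 0" by (auto simp: code_def codeword_def)
qed

lemma suzuki_evaluation_code_code: "suzuki_evaluation_code q0 q len code"
proof -
  let ?FF = "function_field f" and ?c = "const_fun f"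
  define place where "place p = (SOME V. rational_point ?FF ?c V \<and>
    (\<forall>g. fraction f g 1 \<in> V \<and>
      value_at ?FF ?c V (fraction f g 1) = poly (poly g [:snd p:]) (fst p)))" for p
  have place: "rational_point ?FF ?c (place p) \<and> (\<forall>g. fraction f g 1 \<in> place p \<and>
      value_at ?FF ?c (place p) (fraction f g 1) = poly (poly g [:snd p:]) (fst p))" if "p \<in> points" for p
    unfolding place_def by (rule someI_ex, rule ex_place) (use that in \<open>auto simp: points_def\<close>)
  have ptp: "pt k \<in> points" if "k < len" for k using pt_in_points[OF that] by simp
  define P where "P k = place (pt k)" for k
  have P: "rational_point ?FF ?c (P k)" "fraction f g 1 \<in> P k"
      "value_at ?FF ?c (P k) (fraction f g 1) = poly (poly g [:snd (pt k):]) (fst (pt k))" if "k < len" for k g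
    using place[OF ptp[OF that]] by (auto simp: P_def)
  define L where "L = (\<lambda>c. fraction f (polynomial c) 1) ` {c. supported c}"
  note pf = prime_elem_suzuki_poly
  have n1: "\<not> f dvd 1" using pf by (auto simp: prime_elem_def)
  interpret FF: field ?FF by (rule field_function_field[OF pf])
  have car: "fraction f g 1 \<in> carrier ?FF" for g using n1 by (auto simp: function_field_def)
  have zero: "\<zero>\<^bsub>?FF\<^esub> = fraction f 0 1" by (simp add: function_field_def)
  have add: "fraction f g 1 \<oplus>\<^bsub>?FF\<^esub> fraction f h 1 = fraction f (g + h) 1" for g h
    using function_field_add[OF pf n1 n1] by simp
  have neg: "\<ominus>\<^bsub>?FF\<^esub> fraction f g 1 = fraction f (- g) 1" for g
    by (rule FF.minus_equality) (simp_all add: car add zero)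
  have mult: "const_fun f s \<otimes>\<^bsub>?FF\<^esub> fraction f g 1 = fraction f ([:[:s:]:] * g) 1" for s g
    unfolding const_fun_def using function_field_mult[OF pf n1 n1] by simp
  have LI: "fraction f (polynomial c) 1 \<in> L" if "supported c" for c using that by (auto simp: L_def)
  have fs: "function_space ?FF ?c L"
    unfolding function_space_def
  proof (intro conjI allI ballI)
    show "subgroup L (add_monoid ?FF)"
    proof
      show "L \<subseteq> carrier (add_monoid ?FF)" using car by (auto simp: L_def)
      show "\<one>\<^bsub>add_monoid ?FF\<^esub> \<in> L" using LI[OF supported_linear(4)] by (simp add: zero polynomial_linear)
    next
      fix x y assume "x \<in> L" "y \<in> L"
      then show "x \<otimes>\<^bsub>add_monoid ?FF\<^esub> y \<in> L"
        using LI[OF supported_linear(1)] by (auto simp: L_def add polynomial_linear(1)[symmetric])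
    next
      fix x assume "x \<in> L"
      then show "inv\<^bsub>add_monoid ?FF\<^esub> x \<in> L"
        using LI[OF supported_linear(2)] unfolding a_inv_def[symmetric]
        by (auto simp: L_def neg polynomial_linear(2)[symmetric])
    qed
    fix s z assume "z \<in> L"
    then show "const_fun f s \<otimes>\<^bsub>?FF\<^esub> z \<in> L"
      using LI[OF supported_linear(3)]
      by (auto simp: L_def mult polynomial_linear(3)[symmetric]
          simp del: mult_pCons_left)
  qed
  have inj: "inj_on P {..<len}"
  proof (rule inj_onI)
    fix k l assume kl: "k \<in> {..<len}" "l \<in> {..<len}" "P k = P l"
    have "poly (poly g [:snd (pt k):]) (fst (pt k)) = poly (poly g [:snd (pt l):]) (fst (pt l))" for g
      using P(3)[of k g] P(3)[of l g] kl by simp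
    \<comment> \<open>The coordinate functions \<open>X\<close> and \<open>Y\<close> separate the
      points, so distinct points give distinct places.\<close>
    from this[of "[:[:0, 1:]:]"] this[of "[:0, 1:]"] have "pt k = pt l" by (simp add: prod_eq_iff)
    then show "k = l" using pt_inj kl by simp
  qed
  have "code = evaluation_code ?FF ?c len P L"
    unfolding evaluation_code_def code_def L_def image_image
    by (rule image_cong) (auto simp: codeword_def fun_eq_iff P(3) poly_polynomial)
  moreover have "L \<subseteq> P k" if "k < len" for k using P(2)[OF that] by (auto simp: L_def)
  ultimately show ?thesis
    unfolding suzuki_evaluation_code_def is_evaluation_code_def
    using inj P(1) fs by blast
qed

text \<open>By linearity it is enough to consider the difference of two codewords that agree on
  \<open>A\<close>.\<close>

lemma recovery_set_codeI:
  assumes "\<And>c. supported c \<Longrightarrow> (\<And>k. k \<in> A \<Longrightarrow> codeword c k = 0) \<Longrightarrow> codeword c i = 0"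
  shows "recovery_set code i A"
proof (rule recovery_setI)
  fix w w' assume "w \<in> code" "w' \<in> code" and eq: "\<And>k. k \<in> A \<Longrightarrow> w k = w' k"
  then obtain c d where c: "supported c" "w = codeword c" and d: "supported d" "w' = codeword d"
    by (auto simp: code_def)
  have *: "codeword (\<lambda>i j. c i j + (- 1) * d i j) k = w k - w' k" for k
    by (simp only: codeword_linear c d) (simp add: scale_word_def)
  have "codeword (\<lambda>i j. c i j + (- 1) * d i j) i = 0"
    using eq by (intro assms supported_linear c d) (simp only: *, simp)
  then show "w i = w' i" by (simp only: *) simp
qed

text \<open>Exchanging the sums leaves, for each monomial, a power sum over the units of F_q with
  exponent the torus weight.\<close>

lemma cval_orbit_sum:
  assumes "supported c"
  shows "(\<Sum>z\<in>frob_fixed m - {0}. cval c (z * x) (z ^ (q0 + 1) * y)) = 0"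
proof -
  have "(\<Sum>z\<in>frob_fixed m - {0}. cval c (z * x) (z ^ (q0 + 1) * y))
    = (\<Sum>z\<in>frob_fixed m - {0}. \<Sum>j<q - 1. \<Sum>i<(q - 1) * N. c i j * x ^ i * y ^ j * z ^ (i + (q0 + 1) * j))"
    unfolding cval_def sum_distrib_right
  proof (intro sum.cong refl)
    fix z i j
    show "c i j * (z * x) ^ i * (z ^ (q0 + 1) * y) ^ j = c i j * x ^ i * y ^ j * z ^ (i + (q0 + 1) * j)"
      by (simp only: power_mult_distrib power_add[of z i] power_mult[symmetric]) (simp only: mult_ac)
  qed
  also have "\<dots> = (\<Sum>j<q - 1. \<Sum>i<(q - 1) * N. c i j * x ^ i * y ^ j * (\<Sum>z\<in>frob_fixed m - {0}. z ^ (i + (q0 + 1) * j)))"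
    unfolding sum_distrib_left by (subst sum.swap, intro sum.cong refl, subst sum.swap) simp
  also have "\<dots> = 0"
  proof (intro sum.neutral ballI)
    fix j i
    show "c i j * x ^ i * y ^ j * (\<Sum>z\<in>frob_fixed m - {0}. z ^ (i + (q0 + 1) * j)) = 0"
      using assms sum_units_power_eq_0[of "i + (q0 + 1) * j"] unfolding supported_def by (cases "c i j = 0") auto
  qed
  finally show ?thesis .
qed

lemma points_orbit:
  assumes "(x, y) \<in> points" "z \<in> frob_fixed m" "z \<noteq> 0"
  shows "(z * x, z ^ (q0 + 1) * y) \<in> points"
proof -
  have "(z ^ (q0 + 1) * y) ^ q + z ^ (q0 + 1) * y = z ^ (q0 + 1) * (y ^ q + y)"
  proof -
    have "(z ^ (q0 + 1)) ^ q = (z ^ q) ^ (q0 + 1)" by (simp only: power_mult[symmetric] mult.commute)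
    also have "z ^ q = z" using assms(2) by (simp add: q_def frob_fixed_def)
    finally show ?thesis by (simp only: power_mult_distrib distrib_left)
  qed
  then show ?thesis using assms suzuki_x_scale F_scale[OF assms(2)] by (auto simp: points_def)
qed

text \<open>\<open>A1\<close> is the rest of the fibre of \<open>x\<close>, \<open>A2\<close> the
  rest of the torus orbit. They are disjoint because a scaling by \<open>z \<noteq> 1\<close>
  changes the nonzero abscissa.\<close>

lemma availability_code: "availability2_locality len code (q - 1) (q - 2)"
  unfolding availability2_locality_def
proof (intro allI impI)
  fix k assume k: "k < len"
  define x y where "x = fst (pt k)" and "y = snd (pt k)"
  have xy: "(x, y) \<in> points" "pt k = (x, y)" using pt_in_points[OF k] by (auto simp: x_def y_def)
  then have x: "x \<in> suzuki_x" "x \<noteq> 0" by (auto simp: points_def suzuki_x_def)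
  define idx where "idx p = the_inv_into {..<len} pt p" for p
  have idx: "idx p < len" "pt (idx p) = p" if "p \<in> points" for p
    using that bij_pt by (auto simp: idx_def bij_betw_def intro: f_the_inv_into_f
        dest: the_inv_into_into[OF _ _ order_refl])
  have idx_inj: "inj_on idx points" using idx by (metis inj_onI)
  define Y where "Y = {y'. y' ^ q + y' = F x} - {y}"
  define Z where "Z = frob_fixed m - {0, 1::'k}"
  define A1 where "A1 = (\<lambda>y'. idx (x, y')) ` Y"
  define A2 where "A2 = (\<lambda>z. idx (z * x, z ^ (q0 + 1) * y)) ` Z"
  have Yp: "(x, y') \<in> points" if "y' \<in> Y" for y' using that x by (auto simp: Y_def points_def)
  have Zp: "(z * x, z ^ (q0 + 1) * y) \<in> points" if "z \<in> Z" for z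
    using that points_orbit[OF xy(1)] by (auto simp: Z_def)
  have yF: "y \<in> {y'. y' ^ q + y' = F x}" using xy(1) by (auto simp: points_def)
  have cY: "card Y = q - 1" using yF card_fiber[OF x(1)] by (simp add: Y_def card_Diff_singleton)
  have cZ: "card Z = q - 2"
  proof -
    have "card (frob_fixed m - {0, 1::'k}) = card (frob_fixed m :: 'k set) - card {0, 1::'k}"
      by (rule card_Diff_subset) (auto simp: frob_fixed_closed)
    then show ?thesis by (simp add: Z_def card_Fq)
  qed
  show "\<exists>A1 A2. A1 \<subseteq> {..<len} - {k} \<and> A2 \<subseteq> {..<len} - {k} \<and> A1 \<inter> A2 = {} \<and>
      card A1 = q - 1 \<and> card A2 = q - 2 \<and> recovery_set code k A1 \<and> recovery_set code k A2"
  proof (intro exI conjI)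
    show "A1 \<subseteq> {..<len} - {k}"
    proof
      fix l assume "l \<in> A1"
      then obtain y' where y': "y' \<in> Y" "l = idx (x, y')" by (auto simp: A1_def)
      then have "pt l = (x, y')" "l < len" using idx Yp by auto
      moreover have "y' \<noteq> y" using y' by (auto simp: Y_def)
      ultimately show "l \<in> {..<len} - {k}" using xy by auto
    qed
    show "A2 \<subseteq> {..<len} - {k}"
    proof
      fix l assume "l \<in> A2"
      then obtain z where z: "z \<in> Z" "l = idx (z * x, z ^ (q0 + 1) * y)" by (auto simp: A2_def)
      then have "pt l = (z * x, z ^ (q0 + 1) * y)" "l < len" using idx Zp by auto
      moreover have "z * x \<noteq> x" using z x by (auto simp: Z_def)
      ultimately show "l \<in> {..<len} - {k}" using xy by auto
    qed
    show "A1 \<inter> A2 = {}"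
    proof (rule ccontr)
      assume "A1 \<inter> A2 \<noteq> {}"
      then obtain y' z where yz: "y' \<in> Y" "z \<in> Z" "idx (x, y') = idx (z * x, z ^ (q0 + 1) * y)"
        by (auto simp: A1_def A2_def)
      then have "(x, y') = (z * x, z ^ (q0 + 1) * y)" using inj_onD[OF idx_inj] Yp Zp by blast
      then show False using yz x by (auto simp: Z_def)
    qed
    have "inj_on (\<lambda>y'. idx (x, y')) Y"
      using inj_onD[OF idx_inj] Yp by (intro inj_onI) blast
    then show "card A1 = q - 1" by (simp add: A1_def card_image cY)
    have "inj_on (\<lambda>z. idx (z * x, z ^ (q0 + 1) * y)) Z"
    proof (rule inj_onI)
      fix z z' assume z: "z \<in> Z" "z' \<in> Z" "idx (z * x, z ^ (q0 + 1) * y) = idx (z' * x, z' ^ (q0 + 1) * y)"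
      then have "(z * x, z ^ (q0 + 1) * y) = (z' * x, z' ^ (q0 + 1) * y)" using inj_onD[OF idx_inj] Zp by blast
      then show "z = z'" using x by simp
    qed
    then show "card A2 = q - 2" by (simp add: A2_def card_image cZ)
    show "recovery_set code k A1"
    proof (rule recovery_set_codeI)
      fix c assume z: "\<And>l. l \<in> A1 \<Longrightarrow> codeword c l = 0"
      \<comment> \<open>The polynomial in \<open>y\<close> has degree below \<open>q - 1\<close>, so
        the \<open>q - 1\<close> other points of the fibre determine it.\<close>
      have "(\<Sum>i<(q - 1) * N. c i j * x ^ i) = 0" if j: "j < q - 1" for j
      proof (rule power_sum_eq_0_coeffs[of Y "q - 1" "\<lambda>j. \<Sum>i<(q - 1) * N. c i j * x ^ i"])
        fix y' assume y': "y' \<in> Y"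
        then have "codeword c (idx (x, y')) = 0" by (intro z) (simp add: A1_def)
        then show "(\<Sum>j<q - 1. (\<Sum>i<(q - 1) * N. c i j * x ^ i) * y' ^ j) = 0"
          using idx[OF Yp[OF y']] by (simp add: codeword_def cval_def)
      qed (use cY j in auto)
      then show "codeword c k = 0" using k xy(2) by (simp add: codeword_def cval_def)
    qed
    show "recovery_set code k A2"
    proof (rule recovery_set_codeI)
      fix c assume sup: "supported c" and z: "\<And>l. l \<in> A2 \<Longrightarrow> codeword c l = 0"
      have zero: "cval c (z * x) (z ^ (q0 + 1) * y) = 0" if zz: "z \<in> Z" for z
      proof -
        have "codeword c (idx (z * x, z ^ (q0 + 1) * y)) = 0" using zz by (intro z) (simp add: A2_def)
        then show ?thesis using idx[OF Zp[OF zz]] by (simp add: codeword_def)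
      qed
      have Z1: "frob_fixed m - {0} = insert 1 Z" "1 \<notin> Z" "finite Z" by (auto simp: Z_def frob_fixed_closed)
      \<comment> \<open>The point to be recovered is the term \<open>z = 1\<close> of the vanishing
        orbit sum.\<close>
      have "0 = (\<Sum>z\<in>insert 1 Z. cval c (z * x) (z ^ (q0 + 1) * y))"
        using cval_orbit_sum[OF sup, of x y] by (simp only: Z1(1))
      also have "\<dots> = cval c x y" using Z1 zero by simp
      finally show "codeword c k = 0" using k xy(2) by (simp add: codeword_def)
    qed
  qed
qed

lemma ex_code:
  "\<exists>C :: (nat \<Rightarrow> 'k) set. suzuki_evaluation_code q0 q (q * (q - 1) * N) C \<and>
    linear_code (q * (q - 1) * N) C \<and>
    word.dim C = (q - 1) * (q - 2) * N \<and> availability2_locality (q * (q - 1) * N) C (q - 1) (q - 2)"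
  using suzuki_evaluation_code_code linear_code_code dim_code availability_code unfolding len_def by blast

end

section \<open>The two base fields\<close>

lemma suzuki_code_Fq:
  assumes "q0 = 2 ^ a" "q = 2 * q0\<^sup>2" and card: "CARD('k::{finite,field}) = q"
  shows "\<exists>C :: (nat \<Rightarrow> 'k) set. suzuki_evaluation_code q0 q (q * (q - 1)) C \<and>
    linear_code (q * (q - 1)) C \<and>
    word.dim C = (q - 1) * (q - 2) \<and> availability2_locality (q * (q - 1)) C (q - 1) (q - 2)"
proof -
  define m where "m = 2 * a + 1"
  have q: "q = 2 ^ m" using assms(1,2) by (simp add: m_def power_mult power2_eq_square mult_2 power_add)
  interpret suzuki "TYPE('k)" m a m q0 q
    by unfold_locales (use card q m_def assms(1) in auto)
  have "x ^ q = x" for x :: 'k using finite_field_power_card[of x] card by simp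
  \<comment> \<open>Over F_q the right side of the curve equation vanishes identically, so every
    nonzero element is an abscissa and \<open>N = 1\<close>.\<close>
  then have "F x = 0" for x by (simp add: F_def char2(1))
  then have "suzuki_x = UNIV - {0}" using q_pos by (auto simp: suzuki_x_def intro!: exI[of _ 0])
  then have "card suzuki_x = (q - 1) * 1" using card by (simp add: card_Diff_singleton)
  then interpret suzuki_code "TYPE('k)" m a m q0 q 1 by unfold_locales
  show ?thesis using ex_code by simp
qed

lemma suzuki_code_Fq4:
  assumes "q0 = 2 ^ a" "q = 2 * q0\<^sup>2" and card: "CARD('k::{finite,field}) = q ^ 4"
  defines "N \<equiv> q\<^sup>2 + 2 * q * q0 + q + 1"
  shows "\<exists>C :: (nat \<Rightarrow> 'k) set. suzuki_evaluation_code q0 q (q * (q - 1) * N) C \<and>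
    linear_code (q * (q - 1) * N) C \<and>
    word.dim C = (q - 1) * (q - 2) * N \<and> availability2_locality (q * (q - 1) * N) C (q - 1) (q - 2)"
proof -
  define m where "m = 2 * a + 1"
  have q: "q = 2 ^ m" using assms(1,2) by (simp add: m_def power_mult power2_eq_square mult_2 power_add)
  have "CARD('k) = 2 ^ (4 * m)" using card q by (simp add: power_mult[symmetric] mult.commute)
  then interpret suzuki4 "TYPE('k)" "4 * m" a m q0 q
    by unfold_locales (use q m_def assms(1) in \<open>simp_all only: dvd_triv_right\<close>)
  interpret suzuki_code "TYPE('k)" "4 * m" a m q0 q N
    by unfold_locales (use card_suzuki_x in \<open>simp add: N_def\<close>)
  show ?thesis by (rule ex_code)
qed

theorem theorem6p1:
  fixes a q0 q :: nat
  assumes "q0 = 2 ^ a" and "q = 2 * q0\<^sup>2"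
  shows
    "(CARD('k::{finite,field}) = q \<longrightarrow>
       (\<exists>C :: (nat \<Rightarrow> 'k) set.
          suzuki_evaluation_code q0 q (q * (q - 1)) C \<and>
          linear_code (q * (q - 1)) C \<and>
          word.dim C = (q - 1) * (q - 2) \<and>
          availability2_locality (q * (q - 1)) C (q - 1) (q - 2))) \<and>
     (CARD('l::{finite,field}) = q ^ 4 \<longrightarrow>
       (\<exists>C :: (nat \<Rightarrow> 'l) set.
          suzuki_evaluation_code q0 q (q * (q - 1) * (q\<^sup>2 + 2 * q * q0 + q + 1)) C \<and>
          linear_code (q * (q - 1) * (q\<^sup>2 + 2 * q * q0 + q + 1)) C \<and>
          word.dim C = (q - 1) * (q - 2) * (q\<^sup>2 + 2 * q * q0 + q + 1) \<and>
          availability2_locality (q * (q - 1) * (q\<^sup>2 + 2 * q * q0 + q + 1)) C (q - 1) (q - 2)))"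
  using suzuki_code_Fq[OF assms, where ?'k = 'k] suzuki_code_Fq4[OF assms, where ?'k = 'l] by blast

end
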